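(* For $i=1,\dots,n$ let $\mu_i\in M_1(\mathcal{X}_i)$, let $c_i$ be a cost function on $\mathcal{X}_i^2$, let $(\mathcal{E}_i,\mathbb{D}(\mathcal{E}_i))$ be a Dirichlet form on $L^2(\mu_i)$ with Fisher-Donsker-Varadhan information $I_i(\cdot|\mu_i)$, and let $\alpha_i:[0,\infty)\to[0,\infty]$ be left continuous, increasing and convex with $\alpha_i(0)=0$. Assume that for each $i$, $$\alpha_i(T_{c_i}(\nu,\mu_i))\le I_i(\nu|\mu_i),\qquad\forall\nu\in M_1(\mathcal{X}_i).$$ Let $\mathcal{X}^{(n)}=\prod_{i=1}^n\mathcal{X}_i$, $\mu=\prod_{i=1}^n\mu_i$, let $\oplus_ic_i(x,y)=\sum_{i=1}^nc_i(x_i,y_i)$ for $x,y\in\mathcal{X}^{(n)}$, let $$\alpha_1\Box\cdots\Box\alpha_n(r)=\inf\Big\{\sum_{i=1}^n\alpha_i(r_i):\ r_i\ge0,\ \sum_{i=1}^nr_i=r\Big\},$$ and let $I_{\oplus_i\mathcal{E}_i}(\cdot|\mu)$ be the Fisher-Donsker-Varadhan information associated with the sum-Dirichlet form $(\oplus_i\mathcal{E}_i,\mathbb{D}(\oplus_i\mathcal{E}_i))$. Then $$\alpha_1\Box\cdots\Box\alpha_n\big(T_{\oplus_ic_i}(\nu,\mu)\big)\le I_{\oplus_i\mathcal{E}_i}(\nu|\mu),\qquad\forall\nu\in M_1(\mathcal{X}^{(n)}).$$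
   Context: Each $\mathcal{X}_i$ is a complete separable metric space, $M_1(\cdot)$ denotes the set of Borel probability measures. A cost function $c$ on $\mathcal{X}^2$ is a lower semicontinuous function with values in $[0,+\infty]$ such that $c(x,x)=0$ for all $x$. $T_c(\nu,\mu)=\inf_\pi\iint c(x,y)\,\pi(dx,dy)$, the infimum being over probability measures $\pi$ on $\mathcal{X}^2$ with first marginal $\nu$ and second marginal $\mu$. For a Dirichlet form $(\mathcal{E},\mathbb{D}(\mathcal{E}))$ on $L^2(\mu)$, the Fisher-Donsker-Varadhan information is $I(\nu|\mu)=\mathcal{E}(\sqrt f,\sqrt f)$ if $\nu=f\mu$ with $\sqrt f\in\mathbb{D}(\mathcal{E})$, and $+\infty$ otherwise. Standing assumption: each $\mathcal{E}_i$ is the (symmetrized) Dirichlet form of an ergodic Markov process with invariant probability $\mu_i$, i.e. the closure in $L^2(\mu_i)$ of $g\mapsto\langle-\mathcal{L}_ig,g\rangle_{\mu_i}$, where $\mathcal{L}_i$ is the $L^2(\mu_i)$-generator of its strongly continuous transition semigroup. Sum-Dirichlet form: for $g$ on $\mathcal{X}^{(n)}$, $g_i$ denotes $x_i\mapsto g(x_1,\dots,x_n)$ with $\hat x_i=(x_1,\dots,x_{i-1},x_{i+1},\dots,x_n)$ fixed. $\mathbb{D}(\oplus_i\mathcal{E}_i)$ is the set of $g\in L^2(\mu)$ such that, for each $i$, $g_i\in\mathbb{D}(\mathcal{E}_i)$ for $\mu$-a.e. $\hat x_i$, and $\int\sum_{i=1}^n\mathcal{E}_i(g_i,g_i)\,d\mu<+\infty$;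 for such $g$, $\oplus_i\mathcal{E}_i(g,g)=\int_{\mathcal{X}^{(n)}}\sum_{i=1}^n\mathcal{E}_i(g_i,g_i)\,d\mu$. "Increasing" means nondecreasing; a function $\alpha$ on $[0,\infty)$ is extended by $\alpha(+\infty)=\lim_{r\to\infty}\alpha(r)$. *)

theory Defs
  imports "HOL-Probability.Probability"
begin

subsection \<open>Spaces, measures, transport costs\<close>

definition polish_metric :: "'a metric \<Rightarrow> bool" where
  "polish_metric X \<longleftrightarrow> mcomplete_of X \<and> separable_space (mtopology_of X)"

definition borel_of :: "'a topology \<Rightarrow> 'a measure" where
  "borel_of T = sigma (topspace T) {U. openin T U}"

definition M1 :: "'a topology \<Rightarrow> 'a measure set" where
  "M1 T = {\<nu>. prob_space \<nu> \<and> sets \<nu> = sets (borel_of T)}"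

definition cost_function :: "'a topology \<Rightarrow> ('a \<Rightarrow> 'a \<Rightarrow> ennreal) \<Rightarrow> bool" where
  "cost_function T c \<longleftrightarrow>
     (\<forall>a. openin (prod_topology T T) {p \<in> topspace (prod_topology T T). a < c (fst p) (snd p)}) \<and>
     (\<forall>x\<in>topspace T. c x x = 0)"

definition couplings :: "'a topology \<Rightarrow> 'a measure \<Rightarrow> 'a measure \<Rightarrow> ('a \<times> 'a) measure set" where
  "couplings T \<nu> \<mu> =
     {\<pi> \<in> M1 (prod_topology T T). distr \<pi> (borel_of T) fst = \<nu> \<and> distr \<pi> (borel_of T) snd = \<mu>}"

definition transport_cost ::
  "'a topology \<Rightarrow> ('a \<Rightarrow> 'a \<Rightarrow> ennreal) \<Rightarrow> 'a measure \<Rightarrow> 'a measure \<Rightarrow> ennreal" where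
  "transport_cost T c \<nu> \<mu> = (INF \<pi>\<in>couplings T \<nu> \<mu>. \<integral>\<^sup>+p. c (fst p) (snd p) \<partial>\<pi>)"

definition sum_cost :: "nat \<Rightarrow> (nat \<Rightarrow> 'a \<Rightarrow> 'a \<Rightarrow> ennreal) \<Rightarrow> (nat \<Rightarrow> 'a) \<Rightarrow> (nat \<Rightarrow> 'a) \<Rightarrow> ennreal" where
  "sum_cost n c x y = (\<Sum>i\<in>{1..n}. c i (x i) (y i))"


subsection \<open>Functions on the half-line\<close>

text \<open>Functions \<open>[0,\<infinity>) \<rightarrow> [0,\<infinity>]\<close> have type \<open>real \<Rightarrow> ennreal\<close>; their values at negative
  arguments are never used.\<close>

definition rate_function :: "(real \<Rightarrow> ennreal) \<Rightarrow> bool" where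
  "rate_function \<alpha> \<longleftrightarrow>
     \<alpha> 0 = 0 \<and> mono_on {0..} \<alpha> \<and>
     (\<forall>r>0. continuous (at_left r) \<alpha>) \<and>
     (\<forall>x\<ge>0. \<forall>y\<ge>0. \<forall>t\<in>{0..1}.
        \<alpha> ((1 - t) * x + t * y) \<le> ennreal (1 - t) * \<alpha> x + ennreal t * \<alpha> y)"

definition extend_infinity :: "(real \<Rightarrow> ennreal) \<Rightarrow> ennreal \<Rightarrow> ennreal" where
  "extend_infinity \<alpha> r = (if r = \<infinity> then Lim at_top \<alpha> else \<alpha> (enn2real r))"

definition inf_convolution :: "nat \<Rightarrow> (nat \<Rightarrow> real \<Rightarrow> ennreal) \<Rightarrow> real \<Rightarrow> ennreal" where
  "inf_convolution n \<alpha> r =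
     (INF \<rho> \<in> {\<rho>. (\<forall>i\<in>{1..n}. 0 \<le> \<rho> i) \<and> (\<Sum>i\<in>{1..n}. \<rho> i) = r}. \<Sum>i\<in>{1..n}. \<alpha> i (\<rho> i))"


subsection \<open>Dirichlet forms\<close>

text \<open>Elements of $L^2$ are represented by functions rather than by classes modulo
  a.e. equality; form domains are accordingly required to be stable under a.e. equality.\<close>

definition L2 :: "'a measure \<Rightarrow> ('a \<Rightarrow> real) set" where
  "L2 M = {f \<in> borel_measurable M. integrable M (\<lambda>x. (f x)\<^sup>2)}"

definition L2_norm_sq :: "'a measure \<Rightarrow> ('a \<Rightarrow> real) \<Rightarrow> ennreal" where
  "L2_norm_sq M f = (\<integral>\<^sup>+x. ennreal ((f x)\<^sup>2) \<partial>M)"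

definition form_norm_sq ::
  "'a measure \<Rightarrow> (('a \<Rightarrow> real) \<Rightarrow> ('a \<Rightarrow> real) \<Rightarrow> real) \<Rightarrow> ('a \<Rightarrow> real) \<Rightarrow> ennreal" where
  "form_norm_sq M E f = ennreal (E f f) + L2_norm_sq M f"

definition dirichlet_form ::
  "'a measure \<Rightarrow> ('a \<Rightarrow> real) set \<Rightarrow> (('a \<Rightarrow> real) \<Rightarrow> ('a \<Rightarrow> real) \<Rightarrow> real) \<Rightarrow> bool" where
  "dirichlet_form M D E \<longleftrightarrow>
     \<comment> \<open>dense linear subspace of $L^2$\<close>
     D \<subseteq> L2 M \<and>
     (\<forall>f\<in>D. \<forall>g\<in>D. \<forall>a b. (\<lambda>x. a * f x + b * g x) \<in> D) \<and>
     (\<forall>f\<in>L2 M. \<forall>e>0. \<exists>g\<in>D. L2_norm_sq M (\<lambda>x. f x - g x) < e) \<and>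
     \<comment> \<open>compatibility with a.e. equality\<close>
     (\<forall>f\<in>D. \<forall>f'\<in>borel_measurable M. (AE x in M. f x = f' x) \<longrightarrow>
        f' \<in> D \<and> (\<forall>g\<in>D. E f' g = E f g)) \<and>
     \<comment> \<open>nonnegative symmetric bilinear form\<close>
     (\<forall>f\<in>D. \<forall>g\<in>D. E f g = E g f) \<and>
     (\<forall>f\<in>D. \<forall>g\<in>D. \<forall>h\<in>D. \<forall>a b. E (\<lambda>x. a * f x + b * g x) h = a * E f h + b * E g h) \<and>
     (\<forall>f\<in>D. 0 \<le> E f f) \<and>
     \<comment> \<open>closed\<close>
     (\<forall>u. (\<forall>k. u k \<in> D) \<and>
          (\<forall>e>0. \<exists>N. \<forall>j\<ge>N. \<forall>k\<ge>N. form_norm_sq M E (\<lambda>x. u j x - u k x) < e) \<longrightarrow>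
        (\<exists>f\<in>D. (\<lambda>k. form_norm_sq M E (\<lambda>x. u (k::nat) x - f x)) \<longlonglongrightarrow> 0)) \<and>
     \<comment> \<open>the unit contraction operates\<close>
     (\<forall>f\<in>D. (\<lambda>x. min 1 (max 0 (f x))) \<in> D \<and>
        E (\<lambda>x. min 1 (max 0 (f x))) (\<lambda>x. min 1 (max 0 (f x))) \<le> E f f)"

definition fisher_dv_information ::
  "'a measure \<Rightarrow> ('a \<Rightarrow> real) set \<Rightarrow> (('a \<Rightarrow> real) \<Rightarrow> real) \<Rightarrow> 'a measure \<Rightarrow> ennreal" where
  "fisher_dv_information M D Q \<nu> =
     (let f = RN_deriv M \<nu>; sqrt_f = (\<lambda>x. sqrt (enn2real (f x)))
      in if \<nu> = density M f \<and> sqrt_f \<in> D then ennreal (Q sqrt_f) else \<infinity>)"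


subsection \<open>Markov processes\<close>

text \<open>A Markov process is given by its semigroup of transition kernels
  \<open>P t x = \<P>(X\<^sub>t \<in> \<cdot> | X\<^sub>0 = x)\<close>; on a Polish space every such semigroup is realized by a process.\<close>

definition transition_semigroup :: "'a measure \<Rightarrow> (real \<Rightarrow> 'a \<Rightarrow> 'a measure) \<Rightarrow> bool" where
  "transition_semigroup B P \<longleftrightarrow>
     (\<forall>t\<ge>0. P t \<in> B \<rightarrow>\<^sub>M prob_algebra B) \<and>
     (\<forall>x\<in>space B. P 0 x = return B x) \<and>
     (\<forall>s\<ge>0. \<forall>t\<ge>0. \<forall>x\<in>space B. P (s + t) x = P s x \<bind> P t)"

definition semigroup_op ::
  "(real \<Rightarrow> 'a \<Rightarrow> 'a measure) \<Rightarrow> real \<Rightarrow> ('a \<Rightarrow> real) \<Rightarrow> 'a \<Rightarrow> real" where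
  "semigroup_op P t f = (\<lambda>x. \<integral>y. f y \<partial>P t x)"

definition ergodic_process :: "'a measure \<Rightarrow> (real \<Rightarrow> 'a \<Rightarrow> 'a measure) \<Rightarrow> bool" where
  "ergodic_process M P \<longleftrightarrow>
     transition_semigroup M P \<and>
     (\<forall>t\<ge>0. M \<bind> P t = M) \<and>
     (\<forall>f\<in>L2 M. ((\<lambda>t. L2_norm_sq M (\<lambda>x. semigroup_op P t f x - f x)) \<longlongrightarrow> 0) (at_right 0)) \<and>
     (\<forall>f\<in>L2 M. (\<forall>t\<ge>0. AE x in M. semigroup_op P t f x = f x) \<longrightarrow> (\<exists>a. AE x in M. f x = a))"

text \<open>The graph of the $L^2$-generator: \<open>generator M P f h\<close> means that \<open>f\<close> is in its domain
  and is mapped to \<open>h\<close>.\<close>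

definition generator ::
  "'a measure \<Rightarrow> (real \<Rightarrow> 'a \<Rightarrow> 'a measure) \<Rightarrow> ('a \<Rightarrow> real) \<Rightarrow> ('a \<Rightarrow> real) \<Rightarrow> bool" where
  "generator M P f h \<longleftrightarrow> f \<in> L2 M \<and> h \<in> L2 M \<and>
     ((\<lambda>t. L2_norm_sq M (\<lambda>x. (semigroup_op P t f x - f x) / t - h x)) \<longlongrightarrow> 0) (at_right 0)"

text \<open>The form is the closure of \<open>g \<mapsto> \<langle>-Lg,g\<rangle>\<close> on the domain of \<open>L\<close>: it extends
  this quadratic form and the domain of \<open>L\<close> is dense in the form norm (a Dirichlet form
  being closed, this makes it the smallest closed extension). No symmetry of \<open>L\<close>
  is assumed, so only the diagonal values of the form are prescribed.\<close>

definition dirichlet_form_of_process ::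
  "'a measure \<Rightarrow> (real \<Rightarrow> 'a \<Rightarrow> 'a measure) \<Rightarrow> ('a \<Rightarrow> real) set \<Rightarrow>
   (('a \<Rightarrow> real) \<Rightarrow> ('a \<Rightarrow> real) \<Rightarrow> real) \<Rightarrow> bool" where
  "dirichlet_form_of_process M P D E \<longleftrightarrow>
     dirichlet_form M D E \<and>
     (\<forall>g h. generator M P g h \<longrightarrow> g \<in> D \<and> E g g = (\<integral>x. - h x * g x \<partial>M)) \<and>
     (\<forall>f\<in>D. \<exists>u. (\<forall>k. \<exists>h. generator M P (u k) h) \<and>
        (\<lambda>k. form_norm_sq M E (\<lambda>x. u (k::nat) x - f x)) \<longlonglongrightarrow> 0)"


subsection \<open>The sum-Dirichlet form\<close>

definition section_fun :: "((nat \<Rightarrow> 'a) \<Rightarrow> real) \<Rightarrow> (nat \<Rightarrow> 'a) \<Rightarrow> nat \<Rightarrow> 'a \<Rightarrow> real" where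
  "section_fun g x i = (\<lambda>y. g (x(i := y)))"

text \<open>The lower integral \<open>\<integral>\<^sup>+\<close> is insensitive to the arbitrary values of \<open>E i\<close> on the null set
  where a section lies outside \<open>D i\<close>.\<close>

definition sum_form_integral ::
  "nat \<Rightarrow> (nat \<Rightarrow> 'a measure) \<Rightarrow> (nat \<Rightarrow> ('a \<Rightarrow> real) \<Rightarrow> ('a \<Rightarrow> real) \<Rightarrow> real) \<Rightarrow>
   ((nat \<Rightarrow> 'a) \<Rightarrow> real) \<Rightarrow> ennreal" where
  "sum_form_integral n \<mu> E g =
     (\<integral>\<^sup>+x. (\<Sum>i\<in>{1..n}. ennreal (E i (section_fun g x i) (section_fun g x i))) \<partial>PiM {1..n} \<mu>)"

definition sum_form_domain ::
  "nat \<Rightarrow> (nat \<Rightarrow> 'a measure) \<Rightarrow> (nat \<Rightarrow> ('a \<Rightarrow> real) set) \<Rightarrow>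
   (nat \<Rightarrow> ('a \<Rightarrow> real) \<Rightarrow> ('a \<Rightarrow> real) \<Rightarrow> real) \<Rightarrow> ((nat \<Rightarrow> 'a) \<Rightarrow> real) set" where
  "sum_form_domain n \<mu> D E =
     {g \<in> L2 (PiM {1..n} \<mu>).
        (\<forall>i\<in>{1..n}. AE x in PiM {1..n} \<mu>. section_fun g x i \<in> D i) \<and>
        sum_form_integral n \<mu> E g < \<infinity>}"

definition sum_form ::
  "nat \<Rightarrow> (nat \<Rightarrow> 'a measure) \<Rightarrow> (nat \<Rightarrow> ('a \<Rightarrow> real) \<Rightarrow> ('a \<Rightarrow> real) \<Rightarrow> real) \<Rightarrow>
   ((nat \<Rightarrow> 'a) \<Rightarrow> real) \<Rightarrow> real" where
  "sum_form n \<mu> E g = enn2real (sum_form_integral n \<mu> E g)"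

end

(*
  Let nu have density f with respect to mu, let nu_k be its marginal on the first k coordinates and mu_k
  that of mu. Marton's coupling is built one coordinate at a time: a coupling of nu_{i-1} and mu_{i-1} is
  extended by couplings of mu_i with the conditional laws nu(dx_i | x^i) of the i-th coordinate given all
  the others, averaged over the coordinates after i. Hence T(nu_i, mu_i) <= T(nu_{i-1}, mu_{i-1}) + r_i, where
  r_i is the mean of T(nu(dx_i | x^i), mu_i). By Jensen and the hypothesis alpha_i(r_i) is at most the mean of
  I_i(nu(dx_i | x^i) | mu_i), that is, the integral of E_i(g_i, g_i) against mu for g = sqrt f, because
  I_i(nu(dx_i | x^i) | mu_i) is E_i(g_i, g_i) divided by the density of x^i. Summing over i gives the theorem.

  No measurable selection of optimal couplings is made. The conditional laws are approximated in L^1 by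
  finitely many representatives, and the resulting couplings, whose first marginal is only close to nu_i, are
  passed to a limit, which exists by tightness and does not increase a lower semicontinuous cost. In this way
  only lower integrals of E_i(g_i, g_i) occur and its measurability is never needed.
*)
theory Submission
  imports Defs
begin

section \<open>Polish spaces\<close>

text \<open>Conditioning is on all other coordinates, not only on the preceding ones, because the
  sum form freezes exactly those: the conditional density is a section of g^2 divided by its mass,
  and its square root is a rescaled section of g. The law of x_i given the preceding coordinates is
  a mixture of these laws, and a mixture of their couplings is a coupling of it.

  Two small parameters are kept apart. \<open>e\<close> bounds, uniformly over Borel sets, the error
  in the first marginal; it tends to 0 while \<open>\<delta>\<close>, the loss in near-optimal
  couplings and in the choice of representatives, stays fixed. Only afterwards does
  \<open>\<delta>\<close> tend to 0. The first limit wants a cost bound independent of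
  \<open>e\<close>, the second the left continuity of \<open>\<alpha>\<close>.

  Jensen's inequality is applied to real costs. A convex \<open>\<alpha>\<close> that is not
  identically 0 tends to infinity, so finite information gives finite cost;
  \<open>\<alpha> = 0\<close> is treated apart.

  Lower integrals are superadditive, which is the direction in which the n bounds are added.\<close>

definition polish_space :: "'a topology \<Rightarrow> bool" where
  "polish_space T \<longleftrightarrow> completely_metrizable_space T \<and> second_countable T"

section \<open>Borel sigma-algebras of topologies\<close>

lemma space_borel_of [simp]: "space (borel_of T) = topspace T"
  unfolding borel_of_def by (rule space_measure_of) (auto dest: openin_subset)

lemma sets_borel_of: "sets (borel_of T) = sigma_sets (topspace T) {U. openin T U}"
  unfolding borel_of_def by (rule sets_measure_of) (auto dest: openin_subset)

lemma openin_borel_of: "openin T U \<Longrightarrow> U \<in> sets (borel_of T)"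
  by (simp add: sets_borel_of sigma_sets.Basic)

lemma closedin_borel_of:
  assumes "closedin T F" shows "F \<in> sets (borel_of T)"
proof -
  have "F = space (borel_of T) - (topspace T - F)"
    using closedin_subset[OF assms] by auto
  also have "\<dots> \<in> sets (borel_of T)"
    using assms by (intro sets.Diff sets.top openin_borel_of) (auto simp: closedin_def)
  finally show ?thesis .
qed

lemma borel_of_continuous_map:
  assumes f: "continuous_map S T f"
  shows "f \<in> borel_of S \<rightarrow>\<^sub>M borel_of T"
  unfolding borel_of_def[of T]
proof (rule measurable_measure_of)
  show "{U. openin T U} \<subseteq> Pow (topspace T)" using openin_subset by blast
  show "f \<in> space (borel_of S) \<rightarrow> topspace T"
    using continuous_map_funspace[OF f] by simp
  fix U assume "U \<in> {U. openin T U}"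
  then have "openin S {p \<in> topspace S. f p \<in> U}"
    using f openin_continuous_map_preimage by blast
  from openin_borel_of[OF this]
  show "f -` U \<inter> space (borel_of S) \<in> sets (borel_of S)"
    by (simp add: vimage_def Int_def conj_commute)
qed

lemma polish_imp_Hausdorff: "polish_space T \<Longrightarrow> Hausdorff_space T"
  by (simp add: polish_space_def completely_metrizable_imp_metrizable_space metrizable_imp_Hausdorff_space)

lemma compactin_borel_of: "polish_space T \<Longrightarrow> compactin T K \<Longrightarrow> K \<in> sets (borel_of T)"
  by (simp add: closedin_borel_of compactin_imp_closedin polish_imp_Hausdorff)

text \<open>Balls of radius 1/(n+1) centred at a countable dense set form a base. From here on only
  the topology matters, so that products need no explicit metric.\<close>

lemma polish_metric_imp_polish_space:
  assumes "polish_metric X" shows "polish_space (mtopology_of X)"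
proof -
  interpret Metric_space "mspace X" "mdist X" by simp
  have T: "mtopology_of X = mtopology" by (simp add: mtopology_of_def)
  from assms obtain C where C: "countable C" "C \<subseteq> mspace X" "mtopology closure_of C = mspace X"
    unfolding polish_metric_def separable_space_def T by auto
  let ?B = "(\<lambda>(c,n::nat). mball c (inverse (Suc n))) ` (C \<times> UNIV)"
  have "second_countable mtopology"
    unfolding second_countable_def
  proof (intro exI[of _ ?B] conjI allI impI ballI)
    show "countable ?B" using C(1) by auto
    show "openin mtopology V" if "V \<in> ?B" for V using that by auto
    fix U x assume Ux: "openin mtopology U \<and> x \<in> U"
    then obtain r where r: "r > 0" "mball x r \<subseteq> U" by (meson openin_mtopology)
    have xM: "x \<in> mspace X" using Ux openin_subset by fastforce
    obtain n::nat where n: "inverse (Suc n) < r / 2" using r(1) reals_Archimedean[of "r/2"] by auto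
    have "x \<in> mtopology closure_of C" using C xM by auto
    then obtain c where c: "c \<in> C" "c \<in> mball x (inverse (Suc n))"
      unfolding metric_closure_of by (auto simp del: in_mball dest!: spec[of _ "inverse (Suc n)"])
    have "x \<in> mball c (inverse (Suc n))" using c C(2) by (auto simp: commute)
    moreover have "mball c (inverse (Suc n)) \<subseteq> U"
    proof
      fix y assume y: "y \<in> mball c (inverse (Suc n))"
      then have "mdist X x y \<le> mdist X x c + mdist X c y"
        using c C(2) xM by (intro triangle) auto
      then have "y \<in> mball x r" using y c xM n by auto
      with r show "y \<in> U" by auto
    qed
    ultimately show "\<exists>V\<in>?B. x \<in> V \<and> V \<subseteq> U"
      using c(1) by (intro bexI[of _ "mball c (inverse (Suc n))"]) auto
  qed
  moreover have "completely_metrizable_space mtopology"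
    using assms by (auto simp: polish_metric_def mcomplete_of_def completely_metrizable_space_mtopology)
  ultimately show ?thesis by (simp add: polish_space_def T)
qed

section \<open>Products: countable bases and sigma-algebras\<close>

text \<open>The base is required to consist of open boxes: countable unions of boxes lie in the
  product sigma-algebra, and this is how every open set gets there.\<close>

lemma second_countable_product_topology_finite:
  assumes I: "finite I" and X: "\<And>i. i \<in> I \<Longrightarrow> second_countable (X i)"
  shows "\<exists>\<B>. countable \<B> \<and> (\<forall>V\<in>\<B>. \<exists>W. V = Pi\<^sub>E I W \<and> (\<forall>i\<in>I. openin (X i) (W i))) \<and>
    (\<forall>U x. openin (product_topology X I) U \<and> x \<in> U \<longrightarrow> (\<exists>V\<in>\<B>. x \<in> V \<and> V \<subseteq> U))"
proof -
  define B where "B i = (SOME \<B>. countable \<B> \<and> (\<forall>V \<in> \<B>. openin (X i) V) \<and>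
             (\<forall>U x. openin (X i) U \<and> x \<in> U \<longrightarrow> (\<exists>V \<in> \<B>. x \<in> V \<and> V \<subseteq> U)))" for i
  have "countable (B i) \<and> (\<forall>V \<in> B i. openin (X i) V) \<and>
             (\<forall>U x. openin (X i) U \<and> x \<in> U \<longrightarrow> (\<exists>V \<in> B i. x \<in> V \<and> V \<subseteq> U))" if "i \<in> I" for i
    unfolding B_def using X[OF that] unfolding second_countable_def by (rule someI_ex)
  then have B: "\<And>i. i \<in> I \<Longrightarrow> countable (B i)"
      "\<And>i V. i \<in> I \<Longrightarrow> V \<in> B i \<Longrightarrow> openin (X i) V"
      "\<And>i U x. i \<in> I \<Longrightarrow> openin (X i) U \<Longrightarrow> x \<in> U \<Longrightarrow> \<exists>V \<in> B i. x \<in> V \<and> V \<subseteq> U"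
    by simp_all
  have "\<exists>V\<in>Pi\<^sub>E I ` Pi\<^sub>E I B. x \<in> V \<and> V \<subseteq> U"
    if "openin (product_topology X I) U" "x \<in> U" for U x
  proof -
    from that obtain W where W: "\<And>i. i \<in> I \<Longrightarrow> openin (X i) (W i)" "x \<in> Pi\<^sub>E I W" "Pi\<^sub>E I W \<subseteq> U"
      unfolding openin_product_topology_alt by (metis (no_types))
    have "\<forall>i\<in>I. \<exists>V \<in> B i. x i \<in> V \<and> V \<subseteq> W i"
      using B(3) W by (auto simp: PiE_iff)
    then obtain V where V: "\<And>i. i \<in> I \<Longrightarrow> V i \<in> B i \<and> x i \<in> V i \<and> V i \<subseteq> W i"
      by metis
    have "Pi\<^sub>E I (restrict V I) \<subseteq> Pi\<^sub>E I W" using V by (auto simp: PiE_iff subset_iff)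
    moreover have "x \<in> Pi\<^sub>E I (restrict V I)" using V W(2) by (auto simp: PiE_iff)
    moreover have "restrict V I \<in> Pi\<^sub>E I B" using V by auto
    ultimately show ?thesis
      using W(3) by (metis imageI order_trans)
  qed
  moreover have "countable (Pi\<^sub>E I ` Pi\<^sub>E I B)"
    using I B(1) by (intro countable_image countable_PiE) auto
  moreover have "\<exists>W. V = Pi\<^sub>E I W \<and> (\<forall>i\<in>I. openin (X i) (W i))" if "V \<in> Pi\<^sub>E I ` Pi\<^sub>E I B" for V
    using that B(2) by (auto simp: PiE_iff)
  ultimately show ?thesis
    by (intro exI[of _ "Pi\<^sub>E I ` Pi\<^sub>E I B"] conjI ballI allI impI) auto
qed

lemma polish_space_product_topology:
  assumes I: "finite I" and X: "\<And>i. i \<in> I \<Longrightarrow> polish_space (X i)"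
  shows "polish_space (product_topology X I)"
proof -
  obtain \<B> where \<B>: "countable \<B>" "\<forall>V\<in>\<B>. \<exists>W. V = Pi\<^sub>E I W \<and> (\<forall>i\<in>I. openin (X i) (W i))"
      "\<forall>U x. openin (product_topology X I) U \<and> x \<in> U \<longrightarrow> (\<exists>V\<in>\<B>. x \<in> V \<and> V \<subseteq> U)"
    using second_countable_product_topology_finite[OF I, of X] X by (auto simp: polish_space_def)
  have "second_countable (product_topology X I)"
    unfolding second_countable_def using \<B> I
    by (intro exI[of _ \<B>]) (fastforce simp: openin_PiE_gen)
  moreover have "completely_metrizable_space (product_topology X I)"
    using X I by (auto simp: completely_metrizable_space_product_topology polish_space_def intro: countable_finite)
  ultimately show ?thesis by (simp add: polish_space_def)
qed

text \<open>One inclusion uses the countable base of boxes, the other the continuity of the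
  projections. Only the sets of \<open>M i\<close> are prescribed, so the lemma applies directly to
  a family of probability measures.\<close>

lemma sets_borel_of_product_topology:
  assumes I: "finite I" and X: "\<And>i. i \<in> I \<Longrightarrow> second_countable (X i)"
    and M: "\<And>i. i \<in> I \<Longrightarrow> sets (M i) = sets (borel_of (X i))"
  shows "sets (borel_of (product_topology X I)) = sets (PiM I M)"
proof -
  have sp: "space (M i) = topspace (X i)" if "i \<in> I" for i
    using sets_eq_imp_space_eq[OF M[OF that]] by simp
  have sp': "(\<Pi>\<^sub>E i\<in>I. space (M i)) = (\<Pi>\<^sub>E i\<in>I. topspace (X i))"
    using sp by (intro PiE_cong) auto
  obtain \<B> where \<B>: "countable \<B>" "\<And>V. V\<in>\<B> \<Longrightarrow> \<exists>W. V = Pi\<^sub>E I W \<and> (\<forall>i\<in>I. openin (X i) (W i))"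
      "\<And>U x. openin (product_topology X I) U \<Longrightarrow> x \<in> U \<Longrightarrow> (\<exists>V\<in>\<B>. x \<in> V \<and> V \<subseteq> U)"
    using second_countable_product_topology_finite[OF I, of X] X by metis
  show ?thesis
  proof
    show "sets (borel_of (product_topology X I)) \<subseteq> sets (PiM I M)"
      unfolding sets_borel_of
    proof (rule sets.sigma_sets_subset')
      show "{U. openin (product_topology X I) U} \<subseteq> sets (PiM I M)"
      proof clarify
        fix U assume U: "openin (product_topology X I) U"
        have "U = \<Union>{V\<in>\<B>. V \<subseteq> U}" using \<B>(3)[OF U] by auto
        also have "\<dots> \<in> sets (PiM I M)"
        proof (rule sets.countable_Union)
          show "countable {V \<in> \<B>. V \<subseteq> U}" using \<B>(1) by auto
          show "{V \<in> \<B>. V \<subseteq> U} \<subseteq> sets (PiM I M)"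
          proof clarify
            fix V assume "V \<in> \<B>"
            from \<B>(2)[OF this] obtain W where "V = Pi\<^sub>E I W" "\<forall>i\<in>I. openin (X i) (W i)" by auto
            then show "V \<in> sets (PiM I M)"
              using I M by (auto intro!: sets_PiM_I_finite intro: openin_borel_of)
          qed
        qed
        finally show "U \<in> sets (PiM I M)" .
      qed
      show "topspace (product_topology X I) \<in> sets (PiM I M)"
        using sets.top[of "PiM I M"] by (simp add: space_PiM sp')
    qed
    have "sets (PiM I M) = sets (PiM I (\<lambda>i. borel_of (X i)))"
      using M by (intro sets_PiM_cong) auto
    also have "\<dots> \<subseteq> sets (borel_of (product_topology X I))"
      unfolding sets_PiM_single
    proof (rule sets.sigma_sets_subset')
      show "{{f \<in> \<Pi>\<^sub>E i\<in>I. space (borel_of (X i)). f i \<in> A} |i A. i \<in> I \<and> A \<in> sets (borel_of (X i))}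
        \<subseteq> sets (borel_of (product_topology X I))"
      proof clarify
        fix i A assume i: "i \<in> I" and A: "A \<in> sets (borel_of (X i))"
        have "(\<lambda>f. f i) \<in> borel_of (product_topology X I) \<rightarrow>\<^sub>M borel_of (X i)"
          by (intro borel_of_continuous_map continuous_map_product_projection i)
        from measurable_sets[OF this A]
        show "{f \<in> \<Pi>\<^sub>E i\<in>I. space (borel_of (X i)). f i \<in> A} \<in> sets (borel_of (product_topology X I))"
          by (simp add: vimage_def Int_def conj_commute)
      qed
      show "(\<Pi>\<^sub>E i\<in>I. space (borel_of (X i))) \<in> sets (borel_of (product_topology X I))"
        using sets.top[of "borel_of (product_topology X I)"] by simp
    qed
    finally show "sets (PiM I M) \<subseteq> sets (borel_of (product_topology X I))" .
  qed
qed

text \<open>Besides identifying the Borel sets of the product, this allows a content that is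
  controlled on finite unions of rectangles to be compared with a measure on every open set.\<close>

lemma openin_prod_topology_countable_Union:
  assumes "second_countable S" "second_countable T" and U: "openin (prod_topology S T) U"
  shows "\<exists>\<R>. countable \<R> \<and> \<R> \<subseteq> {A \<times> B | A B. openin S A \<and> openin T B} \<and> U = \<Union>\<R>"
proof -
  obtain \<A> where \<A>: "countable \<A>" "\<forall>V \<in> \<A>. openin S V"
     "\<And>U x. openin S U \<Longrightarrow> x \<in> U \<Longrightarrow> (\<exists>V \<in> \<A>. x \<in> V \<and> V \<subseteq> U)"
    using assms(1) unfolding second_countable_def by metis
  obtain \<B> where \<B>: "countable \<B>" "\<forall>V \<in> \<B>. openin T V"
     "\<And>U x. openin T U \<Longrightarrow> x \<in> U \<Longrightarrow> (\<exists>V \<in> \<B>. x \<in> V \<and> V \<subseteq> U)"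
    using assms(2) unfolding second_countable_def by metis
  let ?R = "{R \<in> (\<lambda>(A,B). A \<times> B) ` (\<A> \<times> \<B>). R \<subseteq> U}"
  have "U \<subseteq> \<Union>?R"
  proof clarify
    fix x y assume "(x,y) \<in> U"
    with U obtain A B where AB: "openin S A" "openin T B" "x \<in> A" "y \<in> B" "A \<times> B \<subseteq> U"
      unfolding openin_prod_topology_alt by meson
    obtain A' B' where "A' \<in> \<A>" "x \<in> A'" "A' \<subseteq> A" "B' \<in> \<B>" "y \<in> B'" "B' \<subseteq> B"
      using \<A>(3)[OF AB(1,3)] \<B>(3)[OF AB(2,4)] by auto
    then show "(x,y) \<in> \<Union>?R" using AB(5) by (intro UnionI[of "A' \<times> B'"]) auto
  qed
  then have "U = \<Union>?R" by auto
  moreover have "countable ?R" using \<A>(1) \<B>(1) by (intro countable_Collect countable_image) auto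
  moreover have "?R \<subseteq> {A \<times> B | A B. openin S A \<and> openin T B}"
  proof clarify
    fix A B assume "A \<in> \<A>" "B \<in> \<B>"
    then show "\<exists>A' B'. A \<times> B = A' \<times> B' \<and> openin S A' \<and> openin T B'"
      using \<A>(2) \<B>(2) by (intro exI[of _ A] exI[of _ B]) auto
  qed
  ultimately show ?thesis by (intro exI[of _ ?R] conjI)
qed

lemma sets_borel_of_prod_topology:
  assumes "second_countable S" "second_countable T"
  shows "sets (borel_of (prod_topology S T)) = sets (borel_of S \<Otimes>\<^sub>M borel_of T)"
proof
  show "sets (borel_of (prod_topology S T)) \<subseteq> sets (borel_of S \<Otimes>\<^sub>M borel_of T)"
    unfolding sets_borel_of[of "prod_topology S T"]
  proof (rule sets.sigma_sets_subset')
    show "{U. openin (prod_topology S T) U} \<subseteq> sets (borel_of S \<Otimes>\<^sub>M borel_of T)"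
    proof clarify
      fix U assume "openin (prod_topology S T) U"
      from openin_prod_topology_countable_Union[OF assms this]
      obtain \<R> where \<R>: "countable \<R>" "\<R> \<subseteq> {A \<times> B | A B. openin S A \<and> openin T B}" "U = \<Union>\<R>" by blast
      have "\<R> \<subseteq> sets (borel_of S \<Otimes>\<^sub>M borel_of T)" using \<R>(2) by (auto intro!: pair_measureI openin_borel_of)
      then show "U \<in> sets (borel_of S \<Otimes>\<^sub>M borel_of T)" using \<R> by auto
    qed
    show "topspace (prod_topology S T) \<in> sets (borel_of S \<Otimes>\<^sub>M borel_of T)"
      using sets.top[of "borel_of S \<Otimes>\<^sub>M borel_of T"] by (simp add: space_pair_measure)
  qed
  have proj: "fst \<in> borel_of (prod_topology S T) \<rightarrow>\<^sub>M borel_of S" "snd \<in> borel_of (prod_topology S T) \<rightarrow>\<^sub>M borel_of T"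
    by (intro borel_of_continuous_map continuous_map_fst continuous_map_snd)+
  show "sets (borel_of S \<Otimes>\<^sub>M borel_of T) \<subseteq> sets (borel_of (prod_topology S T))"
    unfolding sets_pair_measure
  proof (rule sets.sigma_sets_subset')
    show "{a \<times> b |a b. a \<in> sets (borel_of S) \<and> b \<in> sets (borel_of T)} \<subseteq> sets (borel_of (prod_topology S T))"
    proof clarify
      fix a b assume ab: "a \<in> sets (borel_of S)" "b \<in> sets (borel_of T)"
      have "a \<times> b = (fst -` a \<inter> space (borel_of (prod_topology S T))) \<inter> (snd -` b \<inter> space (borel_of (prod_topology S T)))"
        using ab[THEN sets.sets_into_space] by auto
      also have "\<dots> \<in> sets (borel_of (prod_topology S T))"
        using ab proj by (intro sets.Int measurable_sets)
      finally show "a \<times> b \<in> sets (borel_of (prod_topology S T))" .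
    qed
    show "space (borel_of S) \<times> space (borel_of T) \<in> sets (borel_of (prod_topology S T))"
      using sets.top[of "borel_of (prod_topology S T)"] by simp
  qed
qed

section \<open>Tightness and inner regularity\<close>

text \<open>Ulam's theorem. For each radius 1/(n+1), finitely many closed balls around a countable
  dense set carry all but a geometrically small mass; their intersection over n is closed and
  totally bounded, hence compact by completeness.\<close>

lemma polish_tight:
  assumes T: "polish_space T" and fin: "finite_measure \<nu>" and sets: "sets \<nu> = sets (borel_of T)" and e: "e > 0"
  shows "\<exists>K. compactin T K \<and> measure \<nu> (topspace T - K) < e"
proof -
  interpret finite_measure \<nu> by fact
  obtain M d where Md: "Metric_space M d" "Metric_space.mcomplete M d" "T = Metric_space.mtopology M d"
    using T by (auto simp: polish_space_def completely_metrizable_space_def)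
  interpret Metric_space M d by fact
  obtain C where C: "countable C" "C \<subseteq> M" "mtopology closure_of C = M"
    using T second_countable_imp_separable_space[of T] by (auto simp: polish_space_def separable_space_def Md(3))
  have meas [measurable]: "closedin mtopology F \<Longrightarrow> F \<in> sets \<nu>" for F
    by (simp add: sets Md(3) closedin_borel_of)
  show ?thesis
  proof (cases "M = {}")
    case True
    then have "topspace T = {}" using topspace_mtopology Md(3) by simp
    then show ?thesis using e by (intro exI[of _ "{}"]) auto
  next
    case False
    then have "C \<noteq> {}" using C by auto
    define s where "s = from_nat_into C"
    have s: "range s = C" unfolding s_def using C(1) \<open>C \<noteq> {}\<close> by (rule range_from_nat_into[rotated])
    define V where "V n N = (\<Union>j<N. mcball (s j) (inverse (real (Suc n))))" for n N :: nat
    have closedV: "closedin mtopology (V n N)" for n N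
      unfolding V_def by (intro closedin_Union) auto
    \<comment> \<open>These errors add up to \<open>e / 2\<close>, which leaves room for the strict
      inequality at the end.\<close>
    have "\<exists>N. measure \<nu> (M - V n N) < e / 2 * (1/2) ^ Suc n" for n
    proof -
      have "x \<in> (\<Union>N. V n N)" if x: "x \<in> M" for x
      proof -
        have "x \<in> mtopology closure_of C" using C x by auto
        then obtain c where c: "c \<in> C" "c \<in> mball x (inverse (Suc n))"
          unfolding metric_closure_of by (auto simp del: in_mball dest!: spec[of _ "inverse (Suc n)"])
        obtain j where "c = s j" using c(1) s by auto
        then have "x \<in> V n (Suc j)" using c x unfolding V_def by (auto simp: commute intro!: bexI[of _ j])
        then show ?thesis by auto
      qed
      then have "(\<Inter>N. M - V n N) = {}" by auto
      moreover have "(\<lambda>N. measure \<nu> (M - V n N)) \<longlonglongrightarrow> measure \<nu> (\<Inter>N. M - V n N)"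
      proof (rule finite_Lim_measure_decseq)
        show "range (\<lambda>N. M - V n N) \<subseteq> sets \<nu>" using closedV by (auto intro!: sets.Diff)
        show "decseq (\<lambda>N. M - V n N)" by (auto simp: decseq_def V_def)
      qed
      ultimately have "(\<lambda>N. measure \<nu> (M - V n N)) \<longlonglongrightarrow> 0"
        by (simp only: measure_empty)
      then have "\<forall>\<^sub>F N in sequentially. measure \<nu> (M - V n N) < e / 2 * (1/2) ^ Suc n"
        using e by (intro order_tendstoD) auto
      then show ?thesis by (auto simp: eventually_sequentially)
    qed
    then obtain N where N: "\<And>n. measure \<nu> (M - V n (N n)) < e / 2 * (1/2) ^ Suc n" by metis
    define K where "K = (\<Inter>n. V n (N n))"
    have closedK: "closedin mtopology K" unfolding K_def using closedV by (intro closedin_Inter) auto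
    have KM: "K \<subseteq> M" using closedin_subset[OF closedK] by simp
    have "mtotally_bounded K"
      unfolding mtotally_bounded_def
    proof (intro allI impI)
      fix \<epsilon>::real assume \<epsilon>: "\<epsilon> > 0"
      obtain n::nat where n: "inverse (Suc n) < \<epsilon> / 2" using \<epsilon> reals_Archimedean[of "\<epsilon>/2"] by auto
      \<comment> \<open>Total boundedness asks for centres inside \<open>K\<close>. Balls that miss
        \<open>K\<close> are dropped and each remaining centre is moved to a point of
        \<open>K\<close>, which at most doubles the radius.\<close>
      define J where "J = {j\<in>{..<N n}. \<exists>x\<in>K. x \<in> mcball (s j) (inverse (Suc n))}"
      have "\<forall>j\<in>J. \<exists>x. x \<in> K \<and> x \<in> mcball (s j) (inverse (Suc n))" by (auto simp: J_def)
      then obtain p where p: "\<And>j. j \<in> J \<Longrightarrow> p j \<in> K \<and> p j \<in> mcball (s j) (inverse (Suc n))" by metis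
      have "K \<subseteq> (\<Union>x\<in>p ` J. mball x \<epsilon>)"
      proof
        fix x assume x: "x \<in> K"
        then have "x \<in> V n (N n)" by (auto simp: K_def)
        then obtain j where j: "j < N n" "x \<in> mcball (s j) (inverse (Suc n))" by (auto simp: V_def)
        then have jJ: "j \<in> J" using x by (auto simp: J_def)
        have "d (p j) x \<le> d (p j) (s j) + d (s j) x"
          using p[OF jJ] j by (intro triangle) auto
        also have "\<dots> < \<epsilon>" using p[OF jJ] j n by (auto simp: commute)
        finally have "x \<in> mball (p j) \<epsilon>" using p[OF jJ] x KM by auto
        then show "x \<in> (\<Union>x\<in>p ` J. mball x \<epsilon>)" using jJ by auto
      qed
      moreover have "finite (p ` J)" by (simp add: J_def)
      moreover have "p ` J \<subseteq> K" using p by auto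
      ultimately show "\<exists>K'. finite K' \<and> K' \<subseteq> K \<and> K \<subseteq> (\<Union>x\<in>K'. mball x \<epsilon>)" by blast
    qed
    then have "compactin mtopology K"
      using mtotally_bounded_eq_compact_closure_of[OF Md(2)] closedK by (simp add: closure_of_closedin)
    moreover have "measure \<nu> (M - K) < e"
    proof -
      have hs: "(\<lambda>n. e / 2 * (1/2) ^ Suc n) sums (e / 2 * 1)"
        by (intro sums_mult power_half_series)
      have sm: "summable (\<lambda>n. measure \<nu> (M - V n (N n)))"
        by (rule summable_comparison_test'[OF sums_summable[OF hs], of 0]) (use N in \<open>auto intro: less_imp_le\<close>)
      have "M - K = (\<Union>n. M - V n (N n))" by (auto simp: K_def)
      moreover have "measure \<nu> (\<Union>n. M - V n (N n)) \<le> (\<Sum>n. measure \<nu> (M - V n (N n)))"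
        using closedV by (intro finite_measure_subadditive_countably sm) (auto intro!: sets.Diff)
      ultimately have "measure \<nu> (M - K) \<le> (\<Sum>n. measure \<nu> (M - V n (N n)))" by (simp only:)
      also have "\<dots> \<le> (\<Sum>n. e / 2 * (1/2) ^ Suc n)"
        by (rule suminf_le[OF _ sm sums_summable[OF hs]]) (use N in \<open>auto intro: less_imp_le\<close>)
      also have "\<dots> = e / 2" using sums_unique[OF hs] by simp
      finally show ?thesis using e by simp
    qed
    ultimately show ?thesis by (auto simp: Md(3))
  qed
qed

text \<open>Good-sets argument: closed sets are regular by tightness, open sets because they are
  countable unions of closed sets in a metrizable space, and the sets regular together with their
  complements form a sigma-algebra.\<close>

lemma polish_inner_regular:
  assumes T: "polish_space T" and fin: "finite_measure \<nu>" and sets: "sets \<nu> = sets (borel_of T)"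
    and A: "A \<in> sets \<nu>" and e: "e > 0"
  shows "\<exists>K. compactin T K \<and> K \<subseteq> A \<and> measure \<nu> (A - K) < e"
proof -
  interpret finite_measure \<nu> by fact
  have H: "Hausdorff_space T" using T by (rule polish_imp_Hausdorff)
  have cpt [simp]: "compactin T K \<Longrightarrow> K \<in> sets \<nu>" for K
    using T by (simp add: sets compactin_borel_of)
  define IR where "IR A \<longleftrightarrow> (\<forall>e>0. \<exists>K. compactin T K \<and> K \<subseteq> A \<and> measure \<nu> (A - K) < e)" for A
  have IR_closed: "IR F" if F: "closedin T F" for F
    unfolding IR_def
  proof (intro allI impI)
    fix e::real assume "e > 0"
    then obtain K where K: "compactin T K" "measure \<nu> (topspace T - K) < e"
      using polish_tight[OF T fin sets] by blast
    have "measure \<nu> (F - F \<inter> K) \<le> measure \<nu> (topspace T - K)"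
      using F K closedin_subset[OF F] compactin_borel_of[OF T] openin_borel_of[OF openin_topspace, of T]
      by (intro finite_measure_mono) (auto simp: sets)
    then show "\<exists>K. compactin T K \<and> K \<subseteq> F \<and> measure \<nu> (F - K) < e"
      using K F by (intro exI[of _ "F \<inter> K"]) (auto intro: closed_Int_compactin)
  qed
  have IR_choose: "\<exists>K. (\<forall>n. compactin T (K n) \<and> K n \<subseteq> A n) \<and> measure \<nu> (\<Union>n. A n - K n) < e"
    if A: "\<And>n::nat. A n \<in> sets \<nu>" "\<And>n. IR (A n)" and e: "0 < e" for A and e :: real
  proof -
    have "\<exists>K. compactin T K \<and> K \<subseteq> A n \<and> measure \<nu> (A n - K) < e / 4 * (1/2) ^ Suc n" for n
      using A(2)[of n] e unfolding IR_def by (auto dest!: spec[of _ "e / 4 * (1/2) ^ Suc n"])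
    then obtain K where K: "\<And>n. compactin T (K n)" "\<And>n. K n \<subseteq> A n"
        "\<And>n. measure \<nu> (A n - K n) < e / 4 * (1/2) ^ Suc n" by metis
    have hs: "(\<lambda>n. e / 4 * (1/2) ^ Suc n) sums (e / 4 * 1)"
      by (intro sums_mult power_half_series)
    have sm: "summable (\<lambda>n. measure \<nu> (A n - K n))"
      by (rule summable_comparison_test'[OF sums_summable[OF hs], of 0]) (use K in \<open>auto intro: less_imp_le\<close>)
    have "measure \<nu> (\<Union>n. A n - K n) \<le> (\<Sum>n. measure \<nu> (A n - K n))"
      using A K by (intro finite_measure_subadditive_countably sm) auto
    also have "\<dots> \<le> (\<Sum>n. e / 4 * (1/2) ^ Suc n)"
      by (rule suminf_le[OF _ sm sums_summable[OF hs]]) (use K in \<open>auto intro: less_imp_le\<close>)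
    also have "\<dots> < e" using sums_unique[OF hs] e by simp
    finally have "measure \<nu> (\<Union>n. A n - K n) < e" .
    with K(1,2) show ?thesis by (intro exI[of _ K] conjI allI)
  qed
  have IR_UN: "IR (\<Union>n. A n)" if A: "\<And>n::nat. A n \<in> sets \<nu>" "\<And>n. IR (A n)" for A
    unfolding IR_def
  proof (intro allI impI)
    fix e::real assume "e > 0"
    from IR_choose[where A=A, OF A this] obtain K where
      "(\<forall>n. compactin T (K n) \<and> K n \<subseteq> A n) \<and> measure \<nu> (\<Union>n. A n - K n) < e"
      by (elim exE)
    then have K: "\<And>n. compactin T (K n)" "\<And>n. K n \<subseteq> A n" "measure \<nu> (\<Union>n. A n - K n) < e" by simp_all
    have Amem: "(\<Union>n. A n) \<in> sets \<nu>" using A by auto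
    have "measure \<nu> ((\<Union>n. A n) - (\<Union>n. K n)) \<le> measure \<nu> (\<Union>n. A n - K n)"
      using A K by (intro finite_measure_mono sets.countable_UN) auto
    with K(3) have lt: "measure \<nu> ((\<Union>n. A n) - (\<Union>n. K n)) < e" by simp
    \<comment> \<open>The union of all \<open>K n\<close> need not be compact, but finite unions
      are, and continuity from above makes one of them good enough.\<close>
    have "(\<lambda>N. measure \<nu> ((\<Union>n. A n) - (\<Union>n<N. K n))) \<longlonglongrightarrow> measure \<nu> (\<Inter>N. (\<Union>n. A n) - (\<Union>n<N. K n))"
      using K Amem by (intro finite_Lim_measure_decseq) (auto simp: decseq_def intro!: sets.Diff)
    also have "(\<Inter>N. (\<Union>n. A n) - (\<Union>n<N. K n)) = (\<Union>n. A n) - (\<Union>n. K n)"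
      by auto
    finally have "\<forall>\<^sub>F N in sequentially. measure \<nu> ((\<Union>n. A n) - (\<Union>n<N. K n)) < e"
      using lt by (rule order_tendstoD)
    then obtain N where "measure \<nu> ((\<Union>n. A n) - (\<Union>n<N. K n)) < e"
      by (auto simp: eventually_sequentially)
    moreover have "compactin T (\<Union>n<N. K n)" using K by (intro compactin_Union) auto
    ultimately show "\<exists>K. compactin T K \<and> K \<subseteq> (\<Union>n. A n) \<and> measure \<nu> ((\<Union>n. A n) - K) < e"
      using K(2) by (intro exI[of _ "\<Union>n<N. K n"]) auto
  qed
  have IR_INT: "IR (\<Inter>n. A n)" if A: "\<And>n::nat. A n \<in> sets \<nu>" "\<And>n. IR (A n)" for A
    unfolding IR_def
  proof (intro allI impI)
    fix e::real assume "e > 0"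
    from IR_choose[where A=A, OF A this] obtain K where
      "(\<forall>n. compactin T (K n) \<and> K n \<subseteq> A n) \<and> measure \<nu> (\<Union>n. A n - K n) < e"
      by (elim exE)
    then have K: "\<And>n. compactin T (K n)" "\<And>n. K n \<subseteq> A n" "measure \<nu> (\<Union>n. A n - K n) < e" by simp_all
    have "measure \<nu> ((\<Inter>n. A n) - (\<Inter>n. K n)) \<le> measure \<nu> (\<Union>n. A n - K n)"
      using A K by (intro finite_measure_mono sets.countable_UN) auto
    with K(3) have "measure \<nu> ((\<Inter>n. A n) - (\<Inter>n. K n)) < e" by simp
    moreover have "compactin T (\<Inter>n. K n)"
    proof (rule closed_compactin[OF K(1)[of 0]])
      show "closedin T (\<Inter>n. K n)" using K H by (intro closedin_Inter) (auto intro: compactin_imp_closedin)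
    qed auto
    ultimately show "\<exists>K. compactin T K \<and> K \<subseteq> (\<Inter>n. A n) \<and> measure \<nu> ((\<Inter>n. A n) - K) < e"
      using K(2) by (intro exI[of _ "\<Inter>n. K n"]) blast
  qed
  have IR_open: "IR U" if U: "openin T U" for U
  proof -
    have "metrizable_space T" using T by (simp add: polish_space_def completely_metrizable_imp_metrizable_space)
    then have "fsigma_in T U" using U by (simp add: open_imp_fsigma_in)
    then obtain F where F: "\<And>n::nat. closedin T (F n)" "(\<Union>n. F n) = U"
      unfolding fsigma_in_ascending by blast
    show ?thesis
      unfolding F(2)[symmetric] using F by (intro IR_UN IR_closed) (auto simp: sets closedin_borel_of)
  qed
  have "A \<in> sigma_sets (topspace T) {U. openin T U}" using A by (simp add: sets sets_borel_of)
  \<comment> \<open>The complement is carried through the induction: in the union step it becomes a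
    countable intersection of regular sets.\<close>
  then have "A \<in> sets \<nu> \<and> IR A \<and> IR (topspace T - A)"
  proof induction
    case (Basic a)
    then have "openin T a" "closedin T (topspace T - a)" by auto
    then show ?case by (auto simp: sets openin_borel_of intro: IR_open IR_closed)
  next
    case Empty
    then show ?case by (auto intro: IR_closed)
  next
    case (Compl a)
    then have "a \<subseteq> topspace T" using sets.sets_into_space[of a "borel_of T"] by (auto simp: sets)
    then have "topspace T - (topspace T - a) = a" by auto
    moreover have "topspace T - a \<in> sets \<nu>"
      using Compl sets.compl_sets[of a \<nu>] sets_eq_imp_space_eq[OF sets] by simp
    ultimately show ?case using Compl by simp
  next
    case (Union a)
    have sp: "topspace T \<in> sets \<nu>" by (simp add: sets openin_borel_of)
    have "topspace T - (\<Union>n. a n) = (\<Inter>n. topspace T - a n)" by auto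
    moreover have "IR (\<Inter>n. topspace T - a n)" using Union sp by (intro IR_INT) auto
    ultimately show ?case using Union by (auto intro: IR_UN)
  qed
  then show ?thesis using e by (auto simp: IR_def)
qed

section \<open>Limits of couplings\<close>

text \<open>The sets \<open>E\<close> such that \<open>E\<close> and its complement are approximable from inside, in content, by
  compact sets form an algebra containing the rectangles, because both marginals are tight. On this
  algebra \<open>p\<close> is continuous at the empty set by the finite intersection property, so that
  Caratheodory's theorem applies.\<close>

lemma content_extension:
  fixes p :: "('a \<times> 'b) set \<Rightarrow> real"
  assumes S: "polish_space S" and T: "polish_space T"
    and \<nu>: "finite_measure \<nu>" "sets \<nu> = sets (borel_of S)"
    and \<mu>: "finite_measure \<mu>" "sets \<mu> = sets (borel_of T)"
    and nonneg: "\<And>E. 0 \<le> p E"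
    and add: "\<And>E F. E \<in> sets (\<nu> \<Otimes>\<^sub>M \<mu>) \<Longrightarrow> F \<in> sets (\<nu> \<Otimes>\<^sub>M \<mu>) \<Longrightarrow> E \<inter> F = {} \<Longrightarrow> p (E \<union> F) = p E + p F"
    and marg1: "\<And>A. A \<in> sets \<nu> \<Longrightarrow> p (A \<times> space \<mu>) = measure \<nu> A"
    and marg2: "\<And>B. B \<in> sets \<mu> \<Longrightarrow> p (space \<nu> \<times> B) = measure \<mu> B"
  shows "\<exists>\<pi>. sets \<pi> = sets (\<nu> \<Otimes>\<^sub>M \<mu>) \<and>
    (\<forall>\<R>. finite \<R> \<longrightarrow> \<R> \<subseteq> {A \<times> B | A B. A \<in> sets \<nu> \<and> B \<in> sets \<mu>} \<longrightarrow> emeasure \<pi> (\<Union>\<R>) = ennreal (p (\<Union>\<R>)))"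
proof -
  let ?N = "\<nu> \<Otimes>\<^sub>M \<mu>"
  let ?T = "prod_topology S T"
  have sp: "space \<nu> = topspace S" "space \<mu> = topspace T"
    using sets_eq_imp_space_eq[OF \<nu>(2)] sets_eq_imp_space_eq[OF \<mu>(2)] by simp_all
  have setsN: "sets ?N = sets (borel_of ?T)"
    using S T \<nu>(2) \<mu>(2) by (subst sets_borel_of_prod_topology) (auto simp: polish_space_def intro: sets_pair_measure_cong)
  have H: "Hausdorff_space ?T" using S T by (simp add: polish_imp_Hausdorff Hausdorff_space_prod_topology)
  have cpt: "K \<in> sets ?N" if "compactin ?T K" for K
    using compactin_imp_closedin[OF H that] by (simp add: setsN closedin_borel_of)
  have p_empty [simp]: "p {} = 0" using add[of "{}" "{}"] by simp
  have p_mono: "p E \<le> p F" if "E \<in> sets ?N" "F \<in> sets ?N" "E \<subseteq> F" for E F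
  proof -
    have "p (E \<union> (F - E)) = p E + p (F - E)" using that by (intro add) auto
    moreover have "E \<union> (F - E) = F" using that by auto
    ultimately show ?thesis using nonneg[of "F - E"] by simp
  qed
  have p_sub: "p (E \<union> F) \<le> p E + p F" if "E \<in> sets ?N" "F \<in> sets ?N" for E F
  proof -
    have "p (E \<union> (F - E)) = p E + p (F - E)" using that by (intro add) auto
    moreover have "p (F - E) \<le> p F" using that by (intro p_mono) auto
    ultimately show ?thesis by simp
  qed
  have p_sub_UN: "p (\<Union>i\<le>n. E i) \<le> (\<Sum>i\<le>n. p (E i))" if "\<And>i. E i \<in> sets ?N" for E and n :: nat
  proof (induction n)
    case (Suc n)
    have "p (\<Union>i\<le>Suc n. E i) \<le> p (\<Union>i\<le>n. E i) + p (E (Suc n))"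
      using that p_sub[of "\<Union>i\<le>n. E i" "E (Suc n)"] by (simp add: atMost_Suc Un_commute)
    with Suc show ?case by simp
  qed simp
  define IR where "IR E \<longleftrightarrow> (\<forall>e>0. \<exists>K. compactin ?T K \<and> K \<subseteq> E \<and> p (E - K) < e)" for E
  have IR_Un: "IR (E \<union> F)" if EF: "E \<in> sets ?N" "F \<in> sets ?N" "IR E" "IR F" for E F
    unfolding IR_def
  proof (intro allI impI)
    fix e::real assume "e > 0"
    with EF obtain K L where KL: "compactin ?T K" "K \<subseteq> E" "p (E - K) < e / 2" "compactin ?T L" "L \<subseteq> F" "p (F - L) < e / 2"
      unfolding IR_def by (metis half_gt_zero)
    have "p (E \<union> F - (K \<union> L)) \<le> p ((E - K) \<union> (F - L))"
      using EF KL cpt by (intro p_mono) auto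
    also have "\<dots> \<le> p (E - K) + p (F - L)" using EF KL cpt by (intro p_sub) auto
    finally show "\<exists>K. compactin ?T K \<and> K \<subseteq> E \<union> F \<and> p (E \<union> F - K) < e"
      using KL by (intro exI[of _ "K \<union> L"]) (auto intro: compactin_Un)
  qed
  have IR_Int: "IR (E \<inter> F)" if EF: "E \<in> sets ?N" "F \<in> sets ?N" "IR E" "IR F" for E F
    unfolding IR_def
  proof (intro allI impI)
    fix e::real assume "e > 0"
    with EF obtain K L where KL: "compactin ?T K" "K \<subseteq> E" "p (E - K) < e / 2" "compactin ?T L" "L \<subseteq> F" "p (F - L) < e / 2"
      unfolding IR_def by (metis half_gt_zero)
    have "p (E \<inter> F - (K \<inter> L)) \<le> p ((E - K) \<union> (F - L))"
      using EF KL cpt by (intro p_mono) auto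
    also have "\<dots> \<le> p (E - K) + p (F - L)" using EF KL cpt by (intro p_sub) auto
    finally show "\<exists>K. compactin ?T K \<and> K \<subseteq> E \<inter> F \<and> p (E \<inter> F - K) < e"
      using KL H by (intro exI[of _ "K \<inter> L"]) (auto intro: compact_Int_closedin compactin_imp_closedin)
  qed
  define \<M> where "\<M> = {E \<in> sets ?N. IR E \<and> IR (space ?N - E)}"
  have rect: "IR (A \<times> B)" if AB: "A \<in> sets \<nu>" "B \<in> sets \<mu>" for A B
    unfolding IR_def
  proof (intro allI impI)
    fix e::real assume e: "e > 0"
    obtain K where K: "compactin S K" "K \<subseteq> A" "measure \<nu> (A - K) < e / 2"
      using polish_inner_regular[OF S \<nu> AB(1), of "e/2"] e by auto
    obtain L where L: "compactin T L" "L \<subseteq> B" "measure \<mu> (B - L) < e / 2"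
      using polish_inner_regular[OF T \<mu> AB(2), of "e/2"] e by auto
    have m: "A - K \<in> sets \<nu>" "B - L \<in> sets \<mu>"
      using AB K L S T by (auto simp: \<nu>(2) \<mu>(2) compactin_borel_of intro!: sets.Diff)
    \<comment> \<open>A point of \<open>A \<times> B\<close> outside \<open>K \<times> L\<close>
      fails in one coordinate, so only the marginals of \<open>p\<close> enter, and these are
      genuine measures.\<close>
    have "p (A \<times> B - K \<times> L) \<le> p ((A - K) \<times> space \<mu> \<union> space \<nu> \<times> (B - L))"
      using AB[THEN sets.sets_into_space] AB m cpt[of "K \<times> L"] K L
      by (intro p_mono) (auto simp: compactin_Times)
    also have "\<dots> \<le> p ((A - K) \<times> space \<mu>) + p (space \<nu> \<times> (B - L))"
      using m by (intro p_sub) auto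
    also have "\<dots> < e" using K L m by (simp add: marg1 marg2)
    finally show "\<exists>K. compactin ?T K \<and> K \<subseteq> A \<times> B \<and> p (A \<times> B - K) < e"
      using K L by (intro exI[of _ "K \<times> L"]) (auto simp: compactin_Times)
  qed
  have rectM: "A \<times> B \<in> \<M>" if AB: "A \<in> sets \<nu>" "B \<in> sets \<mu>" for A B
  proof -
    have "space ?N - A \<times> B = (space \<nu> - A) \<times> space \<mu> \<union> space \<nu> \<times> (space \<mu> - B)"
      using AB[THEN sets.sets_into_space] by (auto simp: space_pair_measure)
    also have "IR \<dots>" using AB by (intro IR_Un rect) auto
    finally show ?thesis using AB rect[OF AB] by (simp add: \<M>_def)
  qed
  have alg: "algebra (space ?N) \<M>"
    unfolding algebra_iff_Un
  proof (intro conjI ballI)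
    show "\<M> \<subseteq> Pow (space ?N)" using sets.sets_into_space by (auto simp: \<M>_def)
    show "{} \<in> \<M>" using rectM[of "{}" "{}"] by simp
    show "space ?N - E \<in> \<M>" if "E \<in> \<M>" for E
      using that sets.sets_into_space[of E ?N] by (auto simp: \<M>_def Diff_Diff_Int Int_absorb1)
    show "E \<union> F \<in> \<M>" if "E \<in> \<M>" "F \<in> \<M>" for E F
    proof -
      have "space ?N - (E \<union> F) = (space ?N - E) \<inter> (space ?N - F)" by auto
      then show ?thesis using that by (auto simp: \<M>_def intro!: IR_Un IR_Int)
    qed
  qed
  then interpret algebra "space ?N" \<M> .
  have "\<exists>\<mu>'. (\<forall>s \<in> \<M>. \<mu>' s = ennreal (p s)) \<and> measure_space (space ?N) (sigma_sets (space ?N) \<M>) \<mu>'"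
  proof (rule caratheodory_empty_continuous)
    show "positive \<M> (\<lambda>s. ennreal (p s))" by (simp add: positive_def)
    show "additive \<M> (\<lambda>s. ennreal (p s))"
      by (auto simp: additive_def \<M>_def add nonneg ennreal_plus)
    show "ennreal (p A) \<noteq> \<infinity>" for A by simp
    fix A :: "nat \<Rightarrow> _" assume A: "range A \<subseteq> \<M>" "decseq A" "(\<Inter>i. A i) = {}"
    have Am [simp]: "A n \<in> sets ?N" for n using A(1) by (auto simp: \<M>_def)
    have "(\<lambda>i. p (A i)) \<longlonglongrightarrow> 0"
    proof (rule decreasing_tendsto)
      show "\<forall>\<^sub>F n in sequentially. 0 \<le> p (A n)" by (simp add: nonneg)
      fix e :: real assume e: "0 < e"
      have "\<exists>K. compactin ?T K \<and> K \<subseteq> A n \<and> p (A n - K) < e / 2 * (1/2) ^ Suc n" for n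
      proof -
        have "IR (A n)" using A(1) by (auto simp: \<M>_def)
        moreover have "e / 2 * (1/2) ^ Suc n > 0" using e by simp
        ultimately show ?thesis unfolding IR_def by blast
      qed
      then obtain K where K: "\<And>n. compactin ?T (K n)" "\<And>n. K n \<subseteq> A n"
        "\<And>n. p (A n - K n) < e / 2 * (1/2) ^ Suc n" by metis
      \<comment> \<open>All \<open>K n\<close> lie in the sets \<open>A n\<close>, whose
        intersection is empty; were every finite intersection nonempty, compactness would give a
        common point.\<close>
      have "\<exists>N. (\<Inter>n\<le>N. K n) = {}"
      proof (rule ccontr)
        assume neg: "\<nexists>N. (\<Inter>n\<le>N. K n) = {}"
        have "(\<Inter>N. \<Inter>n\<le>N. K n) \<noteq> {}"
        proof (rule compact_space_imp_nest[of "subtopology ?T (K 0)" "\<lambda>N. \<Inter>n\<le>N. K n"])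
          show "\<And>N. closedin (subtopology ?T (K 0)) (\<Inter>n\<le>N. K n)"
            using K H by (intro closedin_subset_topspace closedin_Inter) (auto intro: compactin_imp_closedin)
        qed (use K(1) neg in \<open>auto simp: compactin_subspace decseq_def\<close>)
        moreover have "(\<Inter>N. \<Inter>n\<le>N. K n) \<subseteq> (\<Inter>n. A n)" using K(2) by blast
        ultimately show False using A(3) by auto
      qed
      then obtain N where N: "(\<Inter>n\<le>N. K n) = {}" by auto
      have "p (A n) < e" if "n \<ge> N" for n
      proof -
        \<comment> \<open>Every point misses some \<open>K i\<close> with \<open>i \<le> N\<close>,
          and for \<open>n \<ge> N\<close> it lies in \<open>A i\<close> because \<open>A\<close>
          decreases. The mass of \<open>A n\<close> is thus at most the sum of the approximation
          errors.\<close>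
        have "A n \<subseteq> (\<Union>i\<le>N. A i - K i)"
        proof
          fix x assume x: "x \<in> A n"
          obtain i where "i \<le> N" "x \<notin> K i" using N by blast
          moreover have "A n \<subseteq> A i" using A(2) \<open>i \<le> N\<close> that by (simp add: decseq_def)
          ultimately show "x \<in> (\<Union>i\<le>N. A i - K i)" using x by auto
        qed
        then have "p (A n) \<le> p (\<Union>i\<le>N. A i - K i)"
          using K(1) cpt by (intro p_mono sets.finite_UN sets.Diff) auto
        also have "\<dots> \<le> (\<Sum>i\<le>N. p (A i - K i))" using K(1) cpt by (intro p_sub_UN) auto
        also have "\<dots> \<le> (\<Sum>i\<le>N. e / 2 * (1/2) ^ Suc i)" using K(3) by (intro sum_mono) (simp add: less_imp_le)
        also have "\<dots> \<le> (\<Sum>i. e / 2 * (1/2) ^ Suc i)"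
          using e by (intro sum_le_suminf sums_summable[OF sums_mult[OF power_half_series]]) auto
        also have "\<dots> = e / 2" using sums_unique[OF sums_mult[OF power_half_series, of "e/2"]] by simp
        finally show ?thesis using e by simp
      qed
      then show "\<forall>\<^sub>F n in sequentially. p (A n) < e" by (auto simp: eventually_sequentially)
    qed
    then show "(\<lambda>i. ennreal (p (A i))) \<longlonglongrightarrow> 0"
      by (simp add: nonneg ennreal_0[symmetric] tendsto_ennreal_iff del: ennreal_0)
  qed
  then obtain \<mu>' where \<mu>': "\<And>s. s \<in> \<M> \<Longrightarrow> \<mu>' s = ennreal (p s)"
      "measure_space (space ?N) (sigma_sets (space ?N) \<M>) \<mu>'" by blast
  define \<pi> where "\<pi> = measure_of (space ?N) \<M> \<mu>'"
  have MP: "\<M> \<subseteq> Pow (space ?N)" by (rule space_closed)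
  have sets\<pi>: "sets \<pi> = sets ?N"
  proof -
    have "sets \<pi> = sigma_sets (space ?N) \<M>" unfolding \<pi>_def using MP by (rule sets_measure_of)
    also have "\<dots> = sets ?N"
    proof
      show "sigma_sets (space ?N) \<M> \<subseteq> sets ?N" by (rule sets.sigma_sets_subset) (auto simp: \<M>_def)
      show "sets ?N \<subseteq> sigma_sets (space ?N) \<M>"
        unfolding sets_pair_measure using rectM
        by (auto simp: space_pair_measure intro!: sigma_sets_mono')
    qed
    finally show ?thesis .
  qed
  have "emeasure \<pi> E = ennreal (p E)" if "E \<in> \<M>" for E
  proof -
    have "emeasure \<pi> E = \<mu>' E"
    proof (rule emeasure_measure_of[OF \<pi>_def MP])
      have "sets \<pi> = sigma_sets (space ?N) \<M>" unfolding \<pi>_def using MP by (rule sets_measure_of)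
      then show "positive (sets \<pi>) \<mu>'" "countably_additive (sets \<pi>) \<mu>'"
        using \<mu>'(2) by (simp_all add: measure_space_def)
      show "E \<in> sets \<pi>" using that sets\<pi> by (simp add: \<M>_def)
    qed
    then show ?thesis using \<mu>'(1) that by simp
  qed
  moreover have "\<Union>\<R> \<in> \<M>" if "finite \<R>" "\<R> \<subseteq> {A \<times> B | A B. A \<in> sets \<nu> \<and> B \<in> sets \<mu>}" for \<R>
    using that rectM by (intro finite_Union) auto
  ultimately show ?thesis using sets\<pi> by (intro exI[of _ \<pi>]) auto
qed

text \<open>Tychonoff's theorem replaces a diagonal argument: along the filter \<open>F\<close> all the sequences
  \<open>m \<mapsto> q m E\<close> converge at once, however many indices \<open>E\<close> there are.\<close>

lemma cluster_filter:
  fixes q :: "nat \<Rightarrow> 'c \<Rightarrow> real"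
  assumes q: "\<And>m E. 0 \<le> q m E \<and> q m E \<le> 1"
  shows "\<exists>p F. F \<noteq> bot \<and> F \<le> sequentially \<and> (\<forall>E. ((\<lambda>m. q m E) \<longlongrightarrow> p E) F)"
proof -
  have "compact (PiE UNIV (\<lambda>_::'c. {0..1::real}))"
    unfolding compactin_euclidean_iff[symmetric] euclidean_product_topology[symmetric]
    by (subst compactin_PiE) auto
  moreover have "eventually (\<lambda>x. x \<in> PiE UNIV (\<lambda>_::'c. {0..1::real})) (filtermap q sequentially)"
    using q by (simp add: eventually_filtermap PiE_iff)
  moreover have "filtermap q sequentially \<noteq> bot" by (simp add: filtermap_bot_iff)
  ultimately obtain p where p: "inf (nhds p) (filtermap q sequentially) \<noteq> bot"
    unfolding compact_filter by blast
  \<comment> \<open>The neighbourhoods of the cluster point \<open>p\<close>, pulled back to the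
    indices, meet every tail; this makes \<open>F\<close> proper while it still refines
    \<open>sequentially\<close>.\<close>
  define F where "F = inf (filtercomap q (nhds p)) sequentially"
  have "F \<noteq> bot"
  proof
    assume "F = bot"
    then have "eventually (\<lambda>_. False) F" by simp
    then obtain P Q where PQ: "eventually P (filtercomap q (nhds p))" "eventually Q sequentially" "\<And>m. P m \<Longrightarrow> Q m \<Longrightarrow> False"
      unfolding F_def eventually_inf by blast
    then obtain P' where P': "eventually P' (nhds p)" "\<And>m. P' (q m) \<Longrightarrow> P m"
      unfolding eventually_filtercomap by blast
    have "eventually (\<lambda>y. \<not> P' y) (filtermap q sequentially)"
      unfolding eventually_filtermap using PQ(2) by eventually_elim (use P' PQ(3) in blast)
    with P'(1) have "eventually (\<lambda>_. False) (inf (nhds p) (filtermap q sequentially))"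
      unfolding eventually_inf by blast
    with p show False by (simp add: eventually_False)
  qed
  moreover have "F \<le> sequentially" by (simp add: F_def)
  moreover have "((\<lambda>m. q m E) \<longlongrightarrow> p E) F" for E
  proof -
    have "filterlim q (nhds p) F"
      by (simp add: F_def filterlim_iff_le_filtercomap)
    moreover have "open ((\<lambda>f. f E) -` S)" if "open S" for S :: "real set"
      using continuous_map_product_projection[of E UNIV "\<lambda>_::'c. euclidean :: real topology"] that
      by (auto simp: euclidean_product_topology continuous_map_def vimage_def)
    ultimately show ?thesis
      by (intro topological_tendstoI) (auto dest!: topological_tendstoD[of q p F "(\<lambda>f. f E) -` _"])
  qed
  ultimately show ?thesis by blast
qed

section \<open>Layer-cake approximation from below\<close>

text \<open>A Riemann sum of step \<open>1 / 2^k\<close>, cut off at height \<open>k\<close>, for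
  the layer-cake formula. Strict superlevel sets are used because a lower semicontinuous function
  makes them open.\<close>

definition dyadic_layer :: "nat \<Rightarrow> ennreal \<Rightarrow> ennreal" where
  "dyadic_layer k u = (\<Sum>l\<in>{1..k * 2^k}. ennreal (1 / 2^k) * indicator {ennreal (real l / 2^k)<..} u)"

lemma dyadic_layer_eq:
  "dyadic_layer k u = ennreal (1 / 2^k) * of_nat (card {l\<in>{1..k * 2^k}. ennreal (real l / 2^k) < u})"
proof -
  have "dyadic_layer k u = ennreal (1 / 2^k) * (\<Sum>l\<in>{1..k * 2^k}. indicator {l. ennreal (real l / 2^k) < u} l)"
    unfolding dyadic_layer_def sum_distrib_left
    by (intro sum.cong refl arg_cong2[where f="(*)"]) (simp add: indicator_def)
  also have "(\<Sum>l\<in>{1..k * 2^k}. indicator {l. ennreal (real l / 2^k) < u} l) =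
     (of_nat (card ({1..k * 2^k} \<inter> {l. ennreal (real l / 2^k) < u})) :: ennreal)"
    by (simp add: indicator_def)
  finally show ?thesis by (simp only: Int_def mem_Collect_eq)
qed

lemma dyadic_layer_le: "dyadic_layer k u \<le> u"
proof (cases u)
  case (real x)
  let ?A = "{l\<in>{1..k * 2^k}. ennreal (real l / 2^k) < u}"
  have "?A \<subseteq> {1..nat \<lfloor>x * 2^k\<rfloor>}"
  proof
    fix l assume l: "l \<in> ?A"
    then have "real l / 2^k < x" using real by (simp add: ennreal_less_iff)
    then have "real l < x * 2^k" by (simp add: field_simps)
    then have "int l \<le> \<lfloor>x * 2^k\<rfloor>" by (simp add: le_floor_iff)
    then show "l \<in> {1..nat \<lfloor>x * 2^k\<rfloor>}" using l by auto
  qed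
  then have "card ?A \<le> card {1..nat \<lfloor>x * 2^k\<rfloor>}" by (intro card_mono) auto
  then have "real (card ?A) \<le> x * 2^k"
    using real by (simp add: nat_le_iff le_floor_iff) (smt (verit) le_nat_floor mult_nonneg_nonneg of_int_floor_le of_nat_floor of_nat_le_iff zero_le_power)
  then have "1 / 2^k * real (card ?A) \<le> x" by (simp add: field_simps)
  then have "ennreal (1 / 2^k * real (card ?A)) \<le> ennreal x" by (rule ennreal_leI)
  then show ?thesis unfolding dyadic_layer_eq
    by (simp add: ennreal_mult'' ennreal_of_nat_eq_real_of_nat real del: times_divide_eq_left)
qed simp

text \<open>All levels up to the integer part of \<open>x * 2^k\<close> lie below \<open>u\<close>,
  and \<open>x < k\<close> keeps them under the cut-off. Rounding down loses at most one step
  \<open>1 / 2^k\<close>.\<close>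

lemma dyadic_layer_ge:
  assumes "x < k" "0 \<le> x" "ennreal x < u"
  shows "ennreal (x - 1 / 2^k) \<le> dyadic_layer k u"
proof -
  let ?A = "{l\<in>{1..k * 2^k}. ennreal (real l / 2^k) < u}"
  have "{1..nat \<lfloor>x * 2^k\<rfloor>} \<subseteq> ?A"
  proof
    fix l assume l: "l \<in> {1..nat \<lfloor>x * 2^k\<rfloor>}"
    then have "int l \<le> \<lfloor>x * 2^k\<rfloor>" using assms by auto
    then have lx: "real l \<le> x * 2^k" by (simp add: le_floor_iff)
    then have "ennreal (real l / 2^k) \<le> ennreal x" by (intro ennreal_leI) (simp add: field_simps)
    also have "\<dots> < u" by fact
    finally have "ennreal (real l / 2^k) < u" .
    moreover have "real l \<le> real (k * 2^k)"
      using order.trans[OF lx mult_right_mono[of x "real k" "2^k"]] assms(1) by simp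
    then have "l \<le> k * 2^k" by (simp only: of_nat_le_iff)
    ultimately show "l \<in> ?A" using l by auto
  qed
  then have "card {1..nat \<lfloor>x * 2^k\<rfloor>} \<le> card ?A" by (intro card_mono) auto
  then have "nat \<lfloor>x * 2^k\<rfloor> \<le> card ?A" by simp
  then have "\<lfloor>x * 2^k\<rfloor> \<le> int (card ?A)" by linarith
  then have "x * 2^k - 1 \<le> real (card ?A)" by linarith
  then have "(x * 2^k - 1) / 2^k \<le> real (card ?A) / 2^k" by (rule divide_right_mono) simp
  then have "x - 1 / 2^k \<le> 1 / 2^k * real (card ?A)" by (simp add: diff_divide_distrib)
  then have "ennreal (x - 1 / 2^k) \<le> ennreal (1 / 2^k * real (card ?A))" by (rule ennreal_leI)
  then show ?thesis unfolding dyadic_layer_eq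
    by (simp add: ennreal_mult'' ennreal_of_nat_eq_real_of_nat del: times_divide_eq_left)
qed

text \<open>Tested on reals \<open>x\<close> strictly below \<open>u\<close>, so that infinite
  \<open>u\<close> is no special case. \<open>dyadic_layer_le\<close> serves along the approximating
  measures; this half serves in the limit, through Fatou's lemma and without monotonicity in
  \<open>k\<close>.\<close>

lemma le_liminf_dyadic_layer: "u \<le> liminf (\<lambda>k. dyadic_layer k u)"
proof (rule ccontr)
  assume "\<not> u \<le> liminf (\<lambda>k. dyadic_layer k u)"
  then have "liminf (\<lambda>k. dyadic_layer k u) < u" by simp
  then obtain y where y: "liminf (\<lambda>k. dyadic_layer k u) < y" "y < u" using dense by blast
  then obtain x where x: "y = ennreal x" "0 \<le> x" by (cases y) auto
  have "(\<lambda>k. ennreal (x - 1 / 2^k)) \<longlonglongrightarrow> ennreal (x - 0)"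
  proof (intro tendsto_ennrealI tendsto_intros)
    show "(\<lambda>k. 1 / 2 ^ k) \<longlonglongrightarrow> (0::real)" by (rule LIMSEQ_divide_realpow_zero) simp
  qed
  then have "ennreal x = liminf (\<lambda>k. ennreal (x - 1 / 2^k))"
    by (simp add: lim_imp_Liminf)
  also have "\<dots> \<le> liminf (\<lambda>k. dyadic_layer k u)"
  proof (rule Liminf_mono)
    obtain K :: nat where "x < K" using reals_Archimedean2 by blast
    then show "\<forall>\<^sub>F k in sequentially. ennreal (x - 1 / 2 ^ k) \<le> dyadic_layer k u"
      using x y by (intro eventually_sequentiallyI[of K] dyadic_layer_ge) auto
  qed
  finally show False using y x by simp
qed

text \<open>Lower semicontinuity of the transport cost under setwise convergence of the first marginal.
  The limit of the couplings is taken as a finitely additive content; only on open sets is it compared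
  with its countably additive extension, which suffices for a lower semicontinuous cost.\<close>

lemma coupling_limit:
  assumes T: "polish_space T"
    and lsc: "\<And>a. openin (prod_topology T T) {z \<in> topspace (prod_topology T T). a < c z}"
    and \<nu>: "\<nu> \<in> M1 T" and \<mu>: "\<mu> \<in> M1 T"
    and approx: "\<And>e. e > 0 \<Longrightarrow> \<exists>\<pi>\<in>M1 (prod_topology T T).
        (\<forall>A\<in>sets (borel_of T). \<bar>measure \<pi> (A \<times> topspace T) - measure \<nu> A\<bar> \<le> e) \<and>
        (\<forall>B\<in>sets (borel_of T). measure \<pi> (topspace T \<times> B) = measure \<mu> B) \<and> (\<integral>\<^sup>+z. c z \<partial>\<pi>) \<le> b"
  shows "\<exists>\<pi>\<in>couplings T \<nu> \<mu>. (\<integral>\<^sup>+z. c z \<partial>\<pi>) \<le> b"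
proof -
  let ?T = "prod_topology T T"
  have sc: "second_countable T" using T by (simp add: polish_space_def)
  have \<nu>s: "prob_space \<nu>" "sets \<nu> = sets (borel_of T)" and \<mu>s: "prob_space \<mu>" "sets \<mu> = sets (borel_of T)"
    using \<nu> \<mu> by (auto simp: M1_def)
  have sp: "space \<nu> = topspace T" "space \<mu> = topspace T"
    using sets_eq_imp_space_eq[OF \<nu>s(2)] sets_eq_imp_space_eq[OF \<mu>s(2)] by simp_all
  interpret N: prob_space \<nu> by fact
  interpret M: prob_space \<mu> by fact
  have setsT: "sets (\<nu> \<Otimes>\<^sub>M \<mu>) = sets (borel_of ?T)"
    using sc \<nu>s(2) \<mu>s(2) by (subst sets_borel_of_prod_topology) (auto intro: sets_pair_measure_cong)
  have "\<exists>\<pi>\<in>M1 ?T.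
        (\<forall>A\<in>sets (borel_of T). \<bar>measure \<pi> (A \<times> topspace T) - measure \<nu> A\<bar> \<le> 1 / real (Suc m)) \<and>
        (\<forall>B\<in>sets (borel_of T). measure \<pi> (topspace T \<times> B) = measure \<mu> B) \<and> (\<integral>\<^sup>+z. c z \<partial>\<pi>) \<le> b" for m
    by (rule approx) simp
  then obtain P where P: "\<And>m. P m \<in> M1 ?T"
      "\<And>m A. A \<in> sets (borel_of T) \<Longrightarrow> \<bar>measure (P m) (A \<times> topspace T) - measure \<nu> A\<bar> \<le> 1 / real (Suc m)"
      "\<And>m B. B \<in> sets (borel_of T) \<Longrightarrow> measure (P m) (topspace T \<times> B) = measure \<mu> B"
      "\<And>m. (\<integral>\<^sup>+z. c z \<partial>P m) \<le> b" by metis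
  have Pp: "prob_space (P m)" "sets (P m) = sets (borel_of ?T)" for m
    using P(1)[of m] by (auto simp: M1_def)
  \<comment> \<open>All sets \<open>E\<close> serve as indices, measurable or not. Hence
    \<open>p\<close> is nonnegative everywhere and inherits finite additivity on the
    sigma-algebra.\<close>
  have "\<exists>p F. F \<noteq> bot \<and> F \<le> sequentially \<and> (\<forall>E. ((\<lambda>m. measure (P m) E) \<longlongrightarrow> p E) F)"
    (is "\<exists>p F. ?Q p F") by (rule cluster_filter) (simp add: prob_space.prob_le_1[OF Pp(1)])
  then obtain p F where F': "?Q p F" by (elim exE)
  then have F: "F \<noteq> bot" "F \<le> sequentially" "\<And>E. ((\<lambda>m. measure (P m) E) \<longlongrightarrow> p E) F" by simp_all
  have marg1: "p (A \<times> topspace T) = measure \<nu> A" if A: "A \<in> sets (borel_of T)" for A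
  proof -
    have "(\<lambda>m. measure (P m) (A \<times> topspace T) - measure \<nu> A) \<longlonglongrightarrow> 0"
    proof (rule Lim_null_comparison)
      show "\<forall>\<^sub>F m in sequentially. norm (measure (P m) (A \<times> topspace T) - measure \<nu> A) \<le> 1 / real (Suc m)"
        using P(2)[OF A] by simp
      show "(\<lambda>m. 1 / real (Suc m)) \<longlonglongrightarrow> 0"
        using LIMSEQ_inverse_real_of_nat by (simp add: inverse_eq_divide)
    qed
    then have "((\<lambda>m. measure (P m) (A \<times> topspace T) - measure \<nu> A) \<longlongrightarrow> 0) F"
      using F(2) by (rule tendsto_mono[rotated])
    then have "((\<lambda>m. measure (P m) (A \<times> topspace T)) \<longlongrightarrow> measure \<nu> A) F"
      by (simp add: LIM_zero_iff)
    with F(1,3) show ?thesis by (metis tendsto_unique)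
  qed
  have marg2: "p (topspace T \<times> B) = measure \<mu> B" if B: "B \<in> sets (borel_of T)" for B
    using tendsto_unique[OF F(1) F(3)[of "topspace T \<times> B"]] P(3)[OF B] by simp
  have "\<exists>\<pi>. sets \<pi> = sets (\<nu> \<Otimes>\<^sub>M \<mu>) \<and>
    (\<forall>\<R>. finite \<R> \<longrightarrow> \<R> \<subseteq> {A \<times> B | A B. A \<in> sets \<nu> \<and> B \<in> sets \<mu>} \<longrightarrow> emeasure \<pi> (\<Union>\<R>) = ennreal (p (\<Union>\<R>)))"
    (is "\<exists>\<pi>. ?R \<pi>")
  proof (rule content_extension[OF T T _ \<nu>s(2) _ \<mu>s(2)])
    show "0 \<le> p E" for E by (rule tendsto_lowerbound[OF F(3) _ F(1)]) simp
    fix E E' assume E: "E \<in> sets (\<nu> \<Otimes>\<^sub>M \<mu>)" "E' \<in> sets (\<nu> \<Otimes>\<^sub>M \<mu>)" "E \<inter> E' = {}"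
    have "measure (P m) (E \<union> E') = measure (P m) E + measure (P m) E'" for m
    proof -
      interpret prob_space "P m" by (rule Pp)
      show ?thesis using E by (intro finite_measure_Union) (auto simp: Pp(2) setsT)
    qed
    then have "((\<lambda>m. measure (P m) (E \<union> E')) \<longlongrightarrow> p E + p E') F"
      using F(3) by (simp add: tendsto_add)
    with F(1,3) show "p (E \<union> E') = p E + p E'" by (metis tendsto_unique)
  qed (use marg1 marg2 in \<open>auto simp: sp \<nu>s(2) \<mu>s(2) N.finite_measure_axioms M.finite_measure_axioms\<close>)
  then obtain \<pi> where \<pi>': "?R \<pi>"
    by (elim exE)
  then have \<pi>: "sets \<pi> = sets (borel_of ?T)"
      "\<And>\<R>. finite \<R> \<Longrightarrow> \<R> \<subseteq> {A \<times> B | A B. A \<in> sets (borel_of T) \<and> B \<in> sets (borel_of T)} \<Longrightarrow>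
        emeasure \<pi> (\<Union>\<R>) = ennreal (p (\<Union>\<R>))"
    unfolding setsT \<nu>s(2) \<mu>s(2) by simp_all
  have sp\<pi>: "space \<pi> = topspace T \<times> topspace T" using sets_eq_imp_space_eq[OF \<pi>(1)] by simp
  have \<pi>rect: "emeasure \<pi> (A \<times> B) = ennreal (p (A \<times> B))"
    if "A \<in> sets (borel_of T)" "B \<in> sets (borel_of T)" for A B
    using \<pi>(2)[of "{A \<times> B}"] that by auto
  have top: "topspace T \<in> sets (borel_of T)" by (simp add: openin_borel_of)
  have prob\<pi>: "prob_space \<pi>"
  proof
    have "p (topspace T \<times> topspace T) = 1" using marg1[OF top] N.prob_space by (simp add: sp)
    then show "emeasure \<pi> (space \<pi>) = 1" by (simp add: sp\<pi> \<pi>rect top)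
  qed
  have m\<pi>: "fst \<in> \<pi> \<rightarrow>\<^sub>M borel_of T" "snd \<in> \<pi> \<rightarrow>\<^sub>M borel_of T"
    using borel_of_continuous_map[OF continuous_map_fst, of T T] borel_of_continuous_map[OF continuous_map_snd, of T T]
    by (simp_all cong: measurable_cong_sets add: \<pi>(1))
  have "distr \<pi> (borel_of T) fst = \<nu>"
  proof (rule measure_eqI)
    fix A assume "A \<in> sets (distr \<pi> (borel_of T) fst)"
    then have A: "A \<in> sets (borel_of T)" by simp
    have "fst -` A \<inter> space \<pi> = A \<times> topspace T"
      using sets.sets_into_space[OF A] by (auto simp: sp\<pi>)
    then show "emeasure (distr \<pi> (borel_of T) fst) A = emeasure \<nu> A"
      using A m\<pi> by (simp add: emeasure_distr \<pi>rect top marg1 N.emeasure_eq_measure)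
  qed (simp add: \<nu>s)
  moreover have "distr \<pi> (borel_of T) snd = \<mu>"
  proof (rule measure_eqI)
    fix A assume "A \<in> sets (distr \<pi> (borel_of T) snd)"
    then have A: "A \<in> sets (borel_of T)" by simp
    have "snd -` A \<inter> space \<pi> = topspace T \<times> A"
      using sets.sets_into_space[OF A] by (auto simp: sp\<pi>)
    then show "emeasure (distr \<pi> (borel_of T) snd) A = emeasure \<mu> A"
      using A m\<pi> by (simp add: emeasure_distr \<pi>rect top marg2 M.emeasure_eq_measure)
  qed (simp add: \<mu>s)
  ultimately have coup: "\<pi> \<in> couplings T \<nu> \<mu>"
    using prob\<pi> \<pi>(1) by (simp add: couplings_def M1_def)
  interpret \<pi>: prob_space \<pi> by fact
  \<comment> \<open>\<open>U\<close> is an increasing union of finite unions of rectangles, where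
    \<open>\<pi>\<close> and \<open>p\<close> agree, and \<open>p\<close> is monotone. Equality can
    fail: couplings of Lebesgue measure with itself on graphs approaching the diagonal give its
    complement full content, but their limit gives it no mass.\<close>
  have open_le: "emeasure \<pi> U \<le> ennreal (p U)" if U: "openin ?T U" for U
  proof -
    obtain \<R> where \<R>: "countable \<R>" "\<R> \<subseteq> {A \<times> B | A B. openin T A \<and> openin T B}" "U = \<Union>\<R>"
      using openin_prod_topology_countable_Union[OF sc sc U] by blast
    have \<R>': "\<R> \<subseteq> {A \<times> B | A B. A \<in> sets (borel_of T) \<and> B \<in> sets (borel_of T)}"
      using \<R>(2) openin_borel_of by (smt (verit) Collect_mono order_trans)
    then have meas: "R \<in> sets \<pi>" if "R \<in> \<R>" for R
      using that sc by (auto simp: \<pi>(1) sets_borel_of_prod_topology)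
    \<comment> \<open>\<open>from_nat_into\<close> enumerates a nonempty set only; an empty family
      is represented by the empty union.\<close>
    define V where "V k = \<Union>(if \<R> = {} then {} else from_nat_into \<R> ` {..<k})" for k :: nat
    have Vk: "V k = \<Union>\<S> \<Longrightarrow> finite \<S> \<Longrightarrow> \<S> \<subseteq> \<R> \<Longrightarrow> emeasure \<pi> (V k) \<le> ennreal (p U)" for k \<S>
    proof -
      assume S: "V k = \<Union>\<S>" "finite \<S>" "\<S> \<subseteq> \<R>"
      have "p (\<Union>\<S>) \<le> p U"
      proof (rule tendsto_le[OF F(1) F(3) F(3)], rule always_eventually, rule allI)
        fix m
        interpret prob_space "P m" by (rule Pp)
        have "U \<in> sets (P m)" using U by (simp add: Pp openin_borel_of)
        then show "measure (P m) (\<Union>\<S>) \<le> measure (P m) U"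
          using S \<R>(3) by (intro finite_measure_mono) auto
      qed
      moreover have "emeasure \<pi> (\<Union>\<S>) = ennreal (p (\<Union>\<S>))"
        using S \<R>' by (intro \<pi>(2)) auto
      ultimately show "emeasure \<pi> (V k) \<le> ennreal (p U)" by (simp add: S ennreal_leI)
    qed
    have fin: "emeasure \<pi> (V k) \<le> ennreal (p U)" for k
    proof (rule Vk[OF V_def])
      show "(if \<R> = {} then {} else from_nat_into \<R> ` {..<k}) \<subseteq> \<R>"
        by (cases "\<R> = {}") (simp_all add: image_subset_iff from_nat_into)
    qed simp
    have "U = (\<Union>k. V k)"
    proof (cases "\<R> = {}")
      case False
      then have "\<R> = range (from_nat_into \<R>)" using \<R>(1) by (simp add: range_from_nat_into)
      then show ?thesis unfolding \<R>(3) V_def using False by auto (metis lessI lessThan_iff rangeE)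
    qed (simp add: V_def \<R>(3))
    moreover have "emeasure \<pi> (\<Union>k. V k) = (SUP k. emeasure \<pi> (V k))"
    proof (rule SUP_emeasure_incseq[symmetric])
      show "range V \<subseteq> sets \<pi>" using meas from_nat_into[of \<R>] by (auto simp: V_def)
      show "incseq V" by (auto simp: V_def incseq_def)
    qed
    ultimately show ?thesis using fin by (auto intro: SUP_least)
  qed
  have cm: "c \<in> borel_measurable (borel_of ?T)"
  proof (rule borel_measurableI_greater)
    show "{z \<in> space (borel_of ?T). a < c z} \<in> sets (borel_of ?T)" for a
      using openin_borel_of[OF lsc[of a]] by simp
  qed
  have layer_int: "(\<integral>\<^sup>+z. dyadic_layer k (c z) \<partial>Q) =
      (\<Sum>l\<in>{1..k * 2^k}. ennreal (1 / 2^k) * emeasure Q {z \<in> topspace ?T. ennreal (real l / 2^k) < c z})"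
    if Q: "sets Q = sets (borel_of ?T)" for Q k
  proof -
    have spQ: "space Q = topspace ?T" using sets_eq_imp_space_eq[OF Q] by simp
    have [measurable]: "c \<in> borel_measurable Q" using cm Q by (simp cong: measurable_cong_sets)
    have "(\<integral>\<^sup>+z. dyadic_layer k (c z) \<partial>Q) =
      (\<Sum>l\<in>{1..k * 2^k}. ennreal (1 / 2^k) * (\<integral>\<^sup>+z. indicator {ennreal (real l / 2^k)<..} (c z) \<partial>Q))"
      unfolding dyadic_layer_def
      by (subst nn_integral_sum, measurable) (intro sum.cong refl nn_integral_cmult, measurable)
    moreover have "(\<integral>\<^sup>+z. indicator {a<..} (c z) \<partial>Q) = emeasure Q {z \<in> topspace ?T. a < c z}" for a
    proof -
      have "(\<integral>\<^sup>+z. indicator {a<..} (c z) \<partial>Q) = (\<integral>\<^sup>+z. indicator {z \<in> topspace ?T. a < c z} z \<partial>Q)"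
        by (intro nn_integral_cong) (auto simp: spQ indicator_def)
      also have "\<dots> = emeasure Q {z \<in> topspace ?T. a < c z}"
        using openin_borel_of[OF lsc[of a]] by (intro nn_integral_indicator) (simp add: Q)
      finally show ?thesis .
    qed
    ultimately show ?thesis by (simp only:)
  qed
  \<comment> \<open>For fixed \<open>k\<close> the integral is a finite sum over open superlevel
    sets, so \<open>open_le\<close> and the limit along \<open>F\<close> apply term by term. Only
    afterwards does \<open>k\<close> tend to infinity.\<close>
  have layer_le: "(\<integral>\<^sup>+z. dyadic_layer k (c z) \<partial>\<pi>) \<le> b" for k
  proof -
    let ?U = "\<lambda>l. {z \<in> topspace ?T. ennreal (real l / 2^k) < c z}"
    let ?S = "\<lambda>q. \<Sum>l\<in>{1..k * 2^k}. 1 / 2^k * q (?U l) :: real"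
    have eq: "(\<Sum>l\<in>{1..k * 2^k}. ennreal (1 / 2^k) * ennreal (q (?U l))) = ennreal (?S q)" if "\<And>E. q E \<ge> 0" for q
      using that by (subst sum_ennreal[symmetric]) (auto intro!: sum.cong simp: ennreal_mult'' simp del: times_divide_eq_left)
    have pos: "p E \<ge> 0" for E by (rule tendsto_lowerbound[OF F(3) _ F(1)]) simp
    have "(\<integral>\<^sup>+z. dyadic_layer k (c z) \<partial>\<pi>) \<le> (\<Sum>l\<in>{1..k * 2^k}. ennreal (1 / 2^k) * ennreal (p (?U l)))"
      unfolding layer_int[OF \<pi>(1)] by (intro sum_mono mult_left_mono open_le lsc) auto
    also have "\<dots> = ennreal (?S p)" by (rule eq) (rule pos)
    also have "ennreal (?S p) \<le> b"
    proof (rule tendsto_upperbound[OF _ _ F(1)])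
      show "((\<lambda>m. ennreal (?S (measure (P m)))) \<longlongrightarrow> ennreal (?S p)) F"
        by (intro tendsto_ennrealI tendsto_intros F(3))
      have "ennreal (?S (measure (P m))) \<le> b" for m
      proof -
        interpret prob_space "P m" by (rule Pp)
        have "ennreal (?S (measure (P m))) = (\<integral>\<^sup>+z. dyadic_layer k (c z) \<partial>P m)"
          unfolding layer_int[OF Pp(2)] emeasure_eq_measure by (rule eq[symmetric]) simp
        also have "\<dots> \<le> (\<integral>\<^sup>+z. c z \<partial>P m)" by (intro nn_integral_mono dyadic_layer_le)
        also have "\<dots> \<le> b" by (rule P)
        finally show ?thesis .
      qed
      then show "\<forall>\<^sub>F m in F. ennreal (?S (measure (P m))) \<le> b" by simp
    qed
    finally show ?thesis .
  qed
  have "(\<integral>\<^sup>+z. c z \<partial>\<pi>) \<le> liminf (\<lambda>k. \<integral>\<^sup>+z. dyadic_layer k (c z) \<partial>\<pi>)"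
  proof -
    have [measurable]: "c \<in> borel_measurable \<pi>" using cm \<pi>(1) by (simp cong: measurable_cong_sets)
    have "(\<integral>\<^sup>+z. c z \<partial>\<pi>) \<le> (\<integral>\<^sup>+z. liminf (\<lambda>k. dyadic_layer k (c z)) \<partial>\<pi>)"
      by (intro nn_integral_mono le_liminf_dyadic_layer)
    also have "\<dots> \<le> liminf (\<lambda>k. \<integral>\<^sup>+z. dyadic_layer k (c z) \<partial>\<pi>)"
      by (rule nn_integral_liminf) (simp add: dyadic_layer_def)
    finally show ?thesis .
  qed
  also have "liminf (\<lambda>k. \<integral>\<^sup>+z. dyadic_layer k (c z) \<partial>\<pi>) \<le> b"
    using layer_le by (intro Liminf_le always_eventually allI) simp_all
  finally have "(\<integral>\<^sup>+z. c z \<partial>\<pi>) \<le> b" .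
  with coup show ?thesis by blast
qed

section \<open>Finitely many representatives of a family of densities\<close>

text \<open>For integrable \<open>f\<close> this says that the map sending x to the section of
  \<open>f\<close> at x, with values in L1(N), is an L1-limit of maps with finitely many values:
  \<open>\<kappa>\<close> labels the cells, \<open>s k\<close> is the value on cell
  \<open>k\<close>, and the bound \<open>K\<close> makes the labels finite in number.\<close>

definition fiberwise_approx :: "'a measure \<Rightarrow> 'b measure \<Rightarrow> ('a \<times> 'b \<Rightarrow> real) \<Rightarrow> bool" where
  "fiberwise_approx M N f \<longleftrightarrow> (\<forall>\<delta>>0. \<exists>(\<kappa> :: 'a \<Rightarrow> nat) K s. \<kappa> \<in> M \<rightarrow>\<^sub>M count_space UNIV \<and> (\<forall>x. \<kappa> x \<le> K) \<and>
     (\<forall>k. s k \<in> borel_measurable N) \<and>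
     (\<integral>\<^sup>+z. ennreal \<bar>f z - s (\<kappa> (fst z)) (snd z)\<bar> \<partial>(M \<Otimes>\<^sub>M N)) < ennreal \<delta>)"

lemma measurable_fiberwise [measurable (raw)]:
  assumes [measurable]: "\<kappa> \<in> M \<rightarrow>\<^sub>M count_space UNIV" "\<And>k::nat. s k \<in> borel_measurable N"
  shows "(\<lambda>z. s (\<kappa> (fst z)) (snd z) :: real) \<in> borel_measurable (M \<Otimes>\<^sub>M N)"
  by (rule measurable_compose_countable[where f="\<lambda>k z. s k (snd z)" and g="\<lambda>z. \<kappa> (fst z)"]) measurable

lemma fiberwise_approx_add:
  assumes fg: "fiberwise_approx M N f" "fiberwise_approx M N g"
    and [measurable]: "f \<in> borel_measurable (M \<Otimes>\<^sub>M N)" "g \<in> borel_measurable (M \<Otimes>\<^sub>M N)"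
  shows "fiberwise_approx M N (\<lambda>z. f z + g z)"
  unfolding fiberwise_approx_def
proof (intro allI impI)
  fix \<delta> :: real assume "\<delta> > 0"
  then have d: "\<delta> / 2 > 0" by simp
  obtain \<kappa>1 K1 s1 where [measurable]: "\<kappa>1 \<in> M \<rightarrow>\<^sub>M count_space UNIV" and 1: "\<forall>x. \<kappa>1 x \<le> (K1::nat)"
    and [measurable]: "\<And>k. s1 k \<in> borel_measurable N"
    and i1: "(\<integral>\<^sup>+z. ennreal \<bar>f z - s1 (\<kappa>1 (fst z)) (snd z)\<bar> \<partial>(M \<Otimes>\<^sub>M N)) < ennreal (\<delta> / 2)"
    using fg(1)[unfolded fiberwise_approx_def, rule_format, OF d] by auto
  obtain \<kappa>2 K2 s2 where [measurable]: "\<kappa>2 \<in> M \<rightarrow>\<^sub>M count_space UNIV" and 2: "\<forall>x. \<kappa>2 x \<le> (K2::nat)"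
    and [measurable]: "\<And>k. s2 k \<in> borel_measurable N"
    and i2: "(\<integral>\<^sup>+z. ennreal \<bar>g z - s2 (\<kappa>2 (fst z)) (snd z)\<bar> \<partial>(M \<Otimes>\<^sub>M N)) < ennreal (\<delta> / 2)"
    using fg(2)[unfolded fiberwise_approx_def, rule_format, OF d] by auto
  \<comment> \<open>Common refinement of the two partitions: the new label encodes the pair of old
    ones.\<close>
  define \<kappa> where "\<kappa> x = prod_encode (\<kappa>1 x, \<kappa>2 x)" for x
  define s where "s k y = s1 (fst (prod_decode k)) y + s2 (snd (prod_decode k)) y" for k y
  have [measurable]: "\<kappa> \<in> M \<rightarrow>\<^sub>M count_space UNIV" "\<And>k. s k \<in> borel_measurable N"
    unfolding \<kappa>_def s_def by measurable
  have "finite (prod_encode ` ({..K1} \<times> {..K2}))" by auto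
  then obtain K where K: "\<forall>k\<in>prod_encode ` ({..K1} \<times> {..K2}). k \<le> K"
    by (auto simp: finite_nat_set_iff_bounded_le)
  then have "\<forall>x. \<kappa> x \<le> K" using 1 2 by (auto simp: \<kappa>_def)
  moreover have "(\<integral>\<^sup>+z. ennreal \<bar>f z + g z - s (\<kappa> (fst z)) (snd z)\<bar> \<partial>(M \<Otimes>\<^sub>M N))
    \<le> (\<integral>\<^sup>+z. ennreal \<bar>f z - s1 (\<kappa>1 (fst z)) (snd z)\<bar> + ennreal \<bar>g z - s2 (\<kappa>2 (fst z)) (snd z)\<bar> \<partial>(M \<Otimes>\<^sub>M N))"
    by (intro nn_integral_mono) (auto simp: s_def \<kappa>_def simp flip: ennreal_plus intro!: ennreal_leI)
  moreover have "\<dots> = (\<integral>\<^sup>+z. ennreal \<bar>f z - s1 (\<kappa>1 (fst z)) (snd z)\<bar> \<partial>(M \<Otimes>\<^sub>M N))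
     + (\<integral>\<^sup>+z. ennreal \<bar>g z - s2 (\<kappa>2 (fst z)) (snd z)\<bar> \<partial>(M \<Otimes>\<^sub>M N))"
    by (rule nn_integral_add) measurable
  moreover have "\<dots> < ennreal (\<delta> / 2) + ennreal (\<delta> / 2)" using i1 i2 by (rule add_strict_mono)
  moreover have "ennreal (\<delta> / 2) + ennreal (\<delta> / 2) = ennreal \<delta>"
    using d by (simp flip: ennreal_plus)
  ultimately show "\<exists>\<kappa> K s. \<kappa> \<in> M \<rightarrow>\<^sub>M count_space UNIV \<and> (\<forall>x. \<kappa> x \<le> (K::nat)) \<and>
     (\<forall>k. s k \<in> borel_measurable N) \<and>
     (\<integral>\<^sup>+z. ennreal \<bar>f z + g z - s (\<kappa> (fst z)) (snd z)\<bar> \<partial>(M \<Otimes>\<^sub>M N)) < ennreal \<delta>"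
    by (intro exI[of _ \<kappa>] exI[of _ K] exI[of _ s]) auto
qed

lemma fiberwise_approx_limit:
  assumes [measurable]: "f \<in> borel_measurable (M \<Otimes>\<^sub>M N)"
    and app: "\<And>\<delta>. \<delta> > 0 \<Longrightarrow> \<exists>g\<in>borel_measurable (M \<Otimes>\<^sub>M N). fiberwise_approx M N g \<and>
       (\<integral>\<^sup>+z. ennreal \<bar>f z - g z\<bar> \<partial>(M \<Otimes>\<^sub>M N)) < ennreal \<delta>"
  shows "fiberwise_approx M N f"
  unfolding fiberwise_approx_def
proof (intro allI impI)
  fix \<delta> :: real assume "\<delta> > 0"
  then have d: "\<delta> / 2 > 0" by simp
  obtain g where [measurable]: "g \<in> borel_measurable (M \<Otimes>\<^sub>M N)" and g: "fiberwise_approx M N g"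
      "(\<integral>\<^sup>+z. ennreal \<bar>f z - g z\<bar> \<partial>(M \<Otimes>\<^sub>M N)) < ennreal (\<delta> / 2)"
    using app[OF d] by auto
  obtain \<kappa> K s where [measurable]: "\<kappa> \<in> M \<rightarrow>\<^sub>M count_space UNIV" and 1: "\<forall>x. \<kappa> x \<le> (K::nat)"
    and [measurable]: "\<And>k. s k \<in> borel_measurable N"
    and i1: "(\<integral>\<^sup>+z. ennreal \<bar>g z - s (\<kappa> (fst z)) (snd z)\<bar> \<partial>(M \<Otimes>\<^sub>M N)) < ennreal (\<delta> / 2)"
    using g(1)[unfolded fiberwise_approx_def, rule_format, OF d] by auto
  have "(\<integral>\<^sup>+z. ennreal \<bar>f z - s (\<kappa> (fst z)) (snd z)\<bar> \<partial>(M \<Otimes>\<^sub>M N))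
    \<le> (\<integral>\<^sup>+z. ennreal \<bar>f z - g z\<bar> + ennreal \<bar>g z - s (\<kappa> (fst z)) (snd z)\<bar> \<partial>(M \<Otimes>\<^sub>M N))"
    by (intro nn_integral_mono) (auto simp flip: ennreal_plus intro!: ennreal_leI)
  also have "\<dots> = (\<integral>\<^sup>+z. ennreal \<bar>f z - g z\<bar> \<partial>(M \<Otimes>\<^sub>M N))
     + (\<integral>\<^sup>+z. ennreal \<bar>g z - s (\<kappa> (fst z)) (snd z)\<bar> \<partial>(M \<Otimes>\<^sub>M N))"
    by (rule nn_integral_add) measurable
  also have "\<dots> < ennreal (\<delta> / 2) + ennreal (\<delta> / 2)" using g(2) i1 by (rule add_strict_mono)
  also have "\<dots> = ennreal \<delta>" using d by (simp flip: ennreal_plus)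
  finally show "\<exists>\<kappa> K s. \<kappa> \<in> M \<rightarrow>\<^sub>M count_space UNIV \<and> (\<forall>x. \<kappa> x \<le> (K::nat)) \<and>
     (\<forall>k. s k \<in> borel_measurable N) \<and>
     (\<integral>\<^sup>+z. ennreal \<bar>f z - s (\<kappa> (fst z)) (snd z)\<bar> \<partial>(M \<Otimes>\<^sub>M N)) < ennreal \<delta>"
    using 1 by (intro exI[of _ \<kappa>] exI[of _ K] exI[of _ s]) auto
qed

lemma fiberwise_approx_scale:
  assumes f: "fiberwise_approx M N f" and [measurable]: "f \<in> borel_measurable (M \<Otimes>\<^sub>M N)"
  shows "fiberwise_approx M N (\<lambda>z. c * f z)"
  unfolding fiberwise_approx_def
proof (intro allI impI)
  fix \<delta> :: real assume d: "\<delta> > 0"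
  \<comment> \<open>The summand 1 in the denominator covers \<open>c = 0\<close>.\<close>
  then have d': "\<delta> / (\<bar>c\<bar> + 1) > 0" by (intro divide_pos_pos) auto
  obtain \<kappa> K s where [measurable]: "\<kappa> \<in> M \<rightarrow>\<^sub>M count_space UNIV" and 1: "\<forall>x. \<kappa> x \<le> (K::nat)"
    and [measurable]: "\<And>k. s k \<in> borel_measurable N"
    and i1: "(\<integral>\<^sup>+z. ennreal \<bar>f z - s (\<kappa> (fst z)) (snd z)\<bar> \<partial>(M \<Otimes>\<^sub>M N)) < ennreal (\<delta> / (\<bar>c\<bar> + 1))"
    using f[unfolded fiberwise_approx_def, rule_format, OF d'] by auto
  have "(\<integral>\<^sup>+z. ennreal \<bar>c * f z - c * s (\<kappa> (fst z)) (snd z)\<bar> \<partial>(M \<Otimes>\<^sub>M N))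
    = (\<integral>\<^sup>+z. ennreal \<bar>c\<bar> * ennreal \<bar>f z - s (\<kappa> (fst z)) (snd z)\<bar> \<partial>(M \<Otimes>\<^sub>M N))"
    by (intro nn_integral_cong) (simp add: abs_mult flip: right_diff_distrib ennreal_mult)
  also have "\<dots> = ennreal \<bar>c\<bar> * (\<integral>\<^sup>+z. ennreal \<bar>f z - s (\<kappa> (fst z)) (snd z)\<bar> \<partial>(M \<Otimes>\<^sub>M N))"
    by (rule nn_integral_cmult) measurable
  also have "\<dots> \<le> ennreal \<bar>c\<bar> * ennreal (\<delta> / (\<bar>c\<bar> + 1))"
    using i1 by (intro mult_left_mono) auto
  also have "\<dots> = ennreal (\<bar>c\<bar> * (\<delta> / (\<bar>c\<bar> + 1)))" using d' by (intro ennreal_mult[symmetric]) auto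
  also have "\<dots> < ennreal \<delta>" using d by (intro ennreal_lessI) (auto simp: field_simps)
  finally show "\<exists>\<kappa> K s. \<kappa> \<in> M \<rightarrow>\<^sub>M count_space UNIV \<and> (\<forall>x. \<kappa> x \<le> (K::nat)) \<and>
     (\<forall>k. s k \<in> borel_measurable N) \<and>
     (\<integral>\<^sup>+z. ennreal \<bar>c * f z - s (\<kappa> (fst z)) (snd z)\<bar> \<partial>(M \<Otimes>\<^sub>M N)) < ennreal \<delta>"
    using 1 by (intro exI[of _ \<kappa>] exI[of _ K] exI[of _ "\<lambda>k y. c * s k y"]) auto
qed

text \<open>A rectangle needs only two labels. By closure under sums, multiples and L1-limits, the
  good sets form a Dynkin system, and rectangles are stable under intersection.\<close>

lemma fiberwise_approx_indicator:
  assumes "finite_measure M" "finite_measure N" and A: "A \<in> sets (M \<Otimes>\<^sub>M N)"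
  shows "fiberwise_approx M N (indicator A)"
proof -
  interpret M: finite_measure M by fact
  interpret N: finite_measure N by fact
  interpret MN: pair_sigma_finite M N ..
  interpret P: finite_measure "M \<Otimes>\<^sub>M N" using assms by (simp add: finite_measure_pair_measure)
  have rect: "fiberwise_approx M N (indicator (a \<times> b))" if [measurable]: "a \<in> sets M" "b \<in> sets N" for a b
    unfolding fiberwise_approx_def
  proof (intro allI impI exI[of _ "\<lambda>x. if x \<in> a then 1 else 0 :: nat"] exI[of _ 1]
          exI[of _ "\<lambda>k y. if k = 0 then 0 else indicator b y"] conjI)
    fix \<delta> :: real assume "\<delta> > 0"
    have "(\<integral>\<^sup>+z. ennreal \<bar>indicator (a \<times> b) z - (if (if fst z \<in> a then 1 else 0 :: nat) = 0 then 0
        else indicator b (snd z))\<bar> \<partial>(M \<Otimes>\<^sub>M N)) = (\<integral>\<^sup>+z. 0 \<partial>(M \<Otimes>\<^sub>M N))"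
      by (intro nn_integral_cong) (auto simp: indicator_def)
    then show "(\<integral>\<^sup>+z. ennreal \<bar>indicator (a \<times> b) z - (if (if fst z \<in> a then 1 else 0 :: nat) = 0 then 0
        else indicator b (snd z))\<bar> \<partial>(M \<Otimes>\<^sub>M N)) < ennreal \<delta>"
      using \<open>\<delta> > 0\<close> by simp
  qed auto
  have "A \<in> sigma_sets (space M \<times> space N) {a \<times> b | a b. a \<in> sets M \<and> b \<in> sets N}"
    using A by (simp add: sets_pair_measure)
  with Int_stable_pair_measure_generator[of M N] pair_measure_closed[of M N] show ?thesis
  proof (induction rule: sigma_sets_induct_disjoint)
    case (basic A)
    then show ?case using rect by auto
  next
    case empty
    show ?case using rect[of "{}" "{}"] by (simp only: Sigma_empty1 sets.empty_sets)
  next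
    case (compl A)
    then have [measurable]: "A \<in> sets (M \<Otimes>\<^sub>M N)" by (simp add: sets_pair_measure)
    have "fiberwise_approx M N (\<lambda>z. indicator (space M \<times> space N) z + (-1) * indicator A z)"
      using compl by (intro fiberwise_approx_add fiberwise_approx_scale rect) auto
    moreover have "(\<lambda>z. indicator (space M \<times> space N) z + (-1) * indicator A z :: real) = indicator (space M \<times> space N - A)"
      using sets.sets_into_space[of A "M \<Otimes>\<^sub>M N"] by (auto simp: indicator_def space_pair_measure fun_eq_iff)
    ultimately show ?case by simp
  next
    case (union A)
    then have Am [measurable]: "\<And>i. A i \<in> sets (M \<Otimes>\<^sub>M N)" by (auto simp: sets_pair_measure)
    have fin: "fiberwise_approx M N (indicator (\<Union>i<n. A i))" for n :: nat
    proof (induction n)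
      case 0
      show ?case using rect[of "{}" "{}"] by (simp only: Sigma_empty1 sets.empty_sets lessThan_0 UN_empty)
    next
      case (Suc n)
      have "(\<Union>i<n. A i) \<inter> A n = {}"
        using union(1) unfolding disjoint_family_on_def
        by (metis (no_types, lifting) UNIV_I UN_iff disjoint_iff lessThan_iff less_irrefl)
      then have "(\<lambda>z. indicator (\<Union>i<n. A i) z + indicator (A n) z :: real) = indicator (\<Union>i<Suc n. A i)"
        by (auto simp: indicator_def fun_eq_iff less_Suc_eq)
      then show ?case using Suc union fiberwise_approx_add[of M N "indicator (\<Union>i<n. A i)" "indicator (A n)"] by simp
    qed
    show ?case
    proof (rule fiberwise_approx_limit)
      fix \<delta> :: real assume d: "\<delta> > 0"
      have "(\<lambda>n. measure (M \<Otimes>\<^sub>M N) ((\<Union>i. A i) - (\<Union>i<n. A i))) \<longlonglongrightarrow> measure (M \<Otimes>\<^sub>M N) (\<Inter>n. (\<Union>i. A i) - (\<Union>i<n. A i))"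
        by (intro P.finite_Lim_measure_decseq) (auto simp: decseq_def)
      moreover have "(\<Inter>n. (\<Union>i. A i) - (\<Union>i<n. A i)) = {}" by auto
      ultimately have "(\<lambda>n. measure (M \<Otimes>\<^sub>M N) ((\<Union>i. A i) - (\<Union>i<n. A i))) \<longlonglongrightarrow> 0"
        by (simp only: measure_empty)
      then have "\<forall>\<^sub>F n in sequentially. measure (M \<Otimes>\<^sub>M N) ((\<Union>i. A i) - (\<Union>i<n. A i)) < \<delta>"
        using d by (rule order_tendstoD)
      then obtain n where n: "measure (M \<Otimes>\<^sub>M N) ((\<Union>i. A i) - (\<Union>i<n. A i)) < \<delta>"
        by (auto simp: eventually_sequentially)
      have "(\<integral>\<^sup>+z. ennreal \<bar>indicator (\<Union>i. A i) z - indicator (\<Union>i<n. A i) z\<bar> \<partial>(M \<Otimes>\<^sub>M N)) =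
         (\<integral>\<^sup>+z. indicator ((\<Union>i. A i) - (\<Union>i<n. A i)) z \<partial>(M \<Otimes>\<^sub>M N))"
        by (intro nn_integral_cong) (auto simp: indicator_def)
      also have "\<dots> < ennreal \<delta>"
        using n d by (subst nn_integral_indicator) (auto simp: P.emeasure_eq_measure intro!: ennreal_lessI)
      finally show "\<exists>g\<in>borel_measurable (M \<Otimes>\<^sub>M N). fiberwise_approx M N g \<and>
          (\<integral>\<^sup>+z. ennreal \<bar>indicator (\<Union>i. A i) z - g z\<bar> \<partial>(M \<Otimes>\<^sub>M N)) < ennreal \<delta>"
        using fin[of n] by (intro bexI[of _ "indicator (\<Union>i<n. A i)"]) auto
    qed auto
  qed
qed

lemma fiberwise_approx_integrable:
  assumes "finite_measure M" "finite_measure N" and f: "integrable (M \<Otimes>\<^sub>M N) f"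
  shows "fiberwise_approx M N f"
  using f
proof (induction rule: integrable_induct)
  case (base A c)
  then have "fiberwise_approx M N (\<lambda>z. c * indicator A z)"
    by (intro fiberwise_approx_scale fiberwise_approx_indicator assms) auto
  then show ?case by (simp add: mult.commute)
next
  case (add f g)
  then show ?case by (intro fiberwise_approx_add) auto
next
  case (lim f s)
  show ?case
  proof (rule fiberwise_approx_limit)
    show "f \<in> borel_measurable (M \<Otimes>\<^sub>M N)" using lim by auto
    fix \<delta> :: real assume d: "\<delta> > 0"
    have "(\<lambda>i. \<integral>\<^sup>+z. ennreal (norm (f z - s i z)) \<partial>(M \<Otimes>\<^sub>M N)) \<longlonglongrightarrow> 0"
    proof (rule nn_integral_dominated_convergence_norm[where w="\<lambda>z. 2 * norm (f z)"])
      show "(\<integral>\<^sup>+z. ennreal (2 * norm (f z)) \<partial>(M \<Otimes>\<^sub>M N)) < \<infinity>"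
      proof -
        have [measurable]: "f \<in> borel_measurable (M \<Otimes>\<^sub>M N)" using lim(4) by auto
        have "(\<integral>\<^sup>+z. ennreal (2 * norm (f z)) \<partial>(M \<Otimes>\<^sub>M N)) = 2 * (\<integral>\<^sup>+z. ennreal (norm (f z)) \<partial>(M \<Otimes>\<^sub>M N))"
          by (subst nn_integral_cmult[symmetric]) (auto simp: ennreal_mult)
        then show ?thesis
          using lim(4) unfolding integrable_iff_bounded by (simp add: ennreal_mult_less_top)
      qed
    qed (use lim in auto)
    then have "\<forall>\<^sub>F i in sequentially. (\<integral>\<^sup>+z. ennreal (norm (f z - s i z)) \<partial>(M \<Otimes>\<^sub>M N)) < ennreal \<delta>"
      using d by (intro order_tendstoD) auto
    then obtain i where "(\<integral>\<^sup>+z. ennreal (norm (f z - s i z)) \<partial>(M \<Otimes>\<^sub>M N)) < ennreal \<delta>"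
      by (auto simp: eventually_sequentially)
    then show "\<exists>g\<in>borel_measurable (M \<Otimes>\<^sub>M N). fiberwise_approx M N g \<and>
       (\<integral>\<^sup>+z. ennreal \<bar>f z - g z\<bar> \<partial>(M \<Otimes>\<^sub>M N)) < ennreal \<delta>"
      using lim by (intro bexI[of _ "s i"]) auto
  qed
qed

text \<open>A substitute for measurable selection. Conditional densities are replaced by finitely many
  representatives, chosen on each cell so that \<open>J\<close> is almost minimal there; hence \<open>J\<close> may be any function,
  measurable or not, and its lower integral is enough. The label \<open>0\<close> marks the small set of bad points,
  where the density \<open>1\<close> is used because its transport cost vanishes.\<close>

lemma representative_selection:
  fixes J :: "'a \<Rightarrow> ennreal" and f :: "'a \<times> 'b \<Rightarrow> real"
  assumes P: "prob_space P" and N: "prob_space N"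
    and f [measurable]: "f \<in> borel_measurable (P \<Otimes>\<^sub>M N)" and f0: "\<And>z. 0 \<le> f z"
    and good: "AE x in P. x \<in> G" "\<And>x. x \<in> G \<Longrightarrow> x \<in> space P \<and> (\<integral>\<^sup>+y. ennreal (f (x, y)) \<partial>N) = 1"
    and J: "(\<integral>\<^sup>+x. J x \<partial>P) \<le> j" and \<delta>: "0 < \<delta>" and e: "0 < e"
  shows "\<exists>(\<kappa> :: 'a \<Rightarrow> nat) K r. \<kappa> \<in> P \<rightarrow>\<^sub>M count_space UNIV \<and> (\<forall>x. \<kappa> x \<le> K) \<and> (\<forall>k. r k \<in> G) \<and>
    (\<integral>\<^sup>+z. ennreal \<bar>f z - (if \<kappa> (fst z) = 0 then 1 else f (r (\<kappa> (fst z)), snd z))\<bar> \<partial>(P \<Otimes>\<^sub>M N)) \<le> ennreal e \<and>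
    (\<Sum>k\<in>{1..K}. emeasure P (\<kappa> -` {k} \<inter> space P) * J (r k)) \<le> j + ennreal \<delta>"
proof -
  interpret P: prob_space P by fact
  interpret N: prob_space N by fact
  interpret PN: pair_sigma_finite P N ..
  \<comment> \<open>A fallback representative, used for label 0 and for empty cells, since
    \<open>r k\<close> is to lie in \<open>G\<close> for every \<open>k\<close>.\<close>
  obtain x0 where x0: "x0 \<in> G"
  proof -
    have "\<exists>x. x \<in> G"
    proof (rule ccontr)
      assume "\<nexists>x. x \<in> G"
      then have "AE x in P. False" using good(1) by simp
      then show False by simp
    qed
    then show ?thesis using that by blast
  qed
  \<comment> \<open>\<open>G\<close> itself may fail to be measurable; the measurable null set
    \<open>Z\<close> around its complement is used in the definition of the labels instead.\<close>
  obtain Z where Z: "Z \<in> null_sets P" "{x\<in>space P. x \<notin> G} \<subseteq> Z"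
    using good(1) by (auto simp: eventually_ae_filter)
  have Zm [measurable]: "Z \<in> sets P" using Z by auto
  have GZ: "x \<in> G" if "x \<in> space P" "x \<notin> Z" for x using that Z(2) by auto
  have AEn: "AE x in P. (\<integral>\<^sup>+y. ennreal (f (x, y)) \<partial>N) = 1" using good by (auto elim: eventually_mono)
  have int_f: "(\<integral>\<^sup>+z. ennreal (f z) \<partial>(P \<Otimes>\<^sub>M N)) = 1"
  proof -
    have "(\<integral>\<^sup>+z. ennreal (f z) \<partial>(P \<Otimes>\<^sub>M N)) = (\<integral>\<^sup>+x. (\<integral>\<^sup>+y. ennreal (f (x, y)) \<partial>N) \<partial>P)"
      by (subst N.nn_integral_fst[symmetric]) auto
    also have "\<dots> = (\<integral>\<^sup>+x. 1 \<partial>P)" using AEn by (rule nn_integral_cong_AE)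
    finally show ?thesis by (simp add: P.emeasure_space_1)
  qed
  have "integrable (P \<Otimes>\<^sub>M N) f"
    using int_f f0 by (simp add: integrable_iff_bounded)
  then have fa: "fiberwise_approx P N f"
    by (intro fiberwise_approx_integrable P.finite_measure_axioms N.finite_measure_axioms)
  \<comment> \<open>Markov's inequality turns the L1 error \<open>\<theta> * \<theta>\<close> into a
    fibre error at most \<open>\<theta>\<close> off a set of mass at most \<open>\<theta>\<close>.
    Good fibres contribute at most \<open>2 * \<theta>\<close>, bad ones at most twice their mass,
    in all \<open>4 * \<theta> = e\<close>.\<close>
  define \<theta> where "\<theta> = e / 4"
  have \<theta>: "\<theta> > 0" "\<theta> * \<theta> > 0" using e by (auto simp: \<theta>_def)
  obtain \<kappa>0 K0 s where [measurable]: "\<kappa>0 \<in> P \<rightarrow>\<^sub>M count_space UNIV" and K0: "\<forall>x. \<kappa>0 x \<le> (K0::nat)"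
    and [measurable]: "\<And>k. s k \<in> borel_measurable N"
    and i1: "(\<integral>\<^sup>+z. ennreal \<bar>f z - s (\<kappa>0 (fst z)) (snd z)\<bar> \<partial>(P \<Otimes>\<^sub>M N)) < ennreal (\<theta> * \<theta>)"
    using fa[unfolded fiberwise_approx_def, rule_format, OF \<theta>(2)] by auto
  define D where "D x = (\<integral>\<^sup>+y. ennreal \<bar>f (x, y) - s (\<kappa>0 x) y\<bar> \<partial>N)" for x
  have "(\<lambda>z. ennreal \<bar>f z - s (\<kappa>0 (fst z)) (snd z)\<bar>) \<in> borel_measurable (P \<Otimes>\<^sub>M N)" by measurable
  then have Dm [measurable]: "D \<in> borel_measurable P"
    unfolding D_def using N.borel_measurable_nn_integral_fst[of "\<lambda>z. ennreal \<bar>f z - s (\<kappa>0 (fst z)) (snd z)\<bar>" P] by simp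
  have intD: "(\<integral>\<^sup>+x. D x \<partial>P) < ennreal (\<theta> * \<theta>)"
    unfolding D_def using i1 by (subst (asm) N.nn_integral_fst[symmetric]) auto
  define \<kappa> where "\<kappa> x = (if x \<in> Z \<or> D x > ennreal \<theta> then 0 else Suc (\<kappa>0 x))" for x
  have \<kappa>m [measurable]: "\<kappa> \<in> P \<rightarrow>\<^sub>M count_space UNIV" unfolding \<kappa>_def by measurable
  define K where "K = Suc K0"
  have \<kappa>K: "\<forall>x. \<kappa> x \<le> K" using K0 by (simp add: \<kappa>_def K_def)
  define B where "B k = \<kappa> -` {k} \<inter> space P" for k
  have Bm [measurable]: "B k \<in> sets P" for k unfolding B_def by measurable
  \<comment> \<open>The simple function with value \<open>m k\<close> on the cells
    \<open>B k\<close> with \<open>k \<ge> 1\<close> lies below \<open>J\<close>, so its integral is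
    at most the lower integral of \<open>J\<close>.\<close>
  define m where "m k = (INF x\<in>B k. J x)" for k
  have "\<exists>r. r \<in> G \<and> (k \<ge> 1 \<longrightarrow> B k \<noteq> {} \<longrightarrow> r \<in> B k \<and> J r \<le> m k + ennreal \<delta>)" for k
  proof (cases "k \<ge> 1 \<and> B k \<noteq> {}")
    case True
    have "\<exists>r\<in>B k. J r \<le> m k + ennreal \<delta>"
    proof (cases "m k = \<infinity>")
      case False
      then have "m k < m k + ennreal \<delta>" using \<delta> by (simp add: less_top)
      then show ?thesis unfolding m_def by (auto simp: INF_less_iff intro: less_imp_le)
    qed (use True in auto)
    then obtain r where r: "r \<in> B k" "J r \<le> m k + ennreal \<delta>" by blast
    then have "r \<in> G" using True GZ by (auto simp: B_def \<kappa>_def split: if_splits)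
    with r show ?thesis by blast
  qed (use x0 in auto)
  then obtain r where r: "\<And>k. r k \<in> G" "\<And>k. k \<ge> 1 \<Longrightarrow> B k \<noteq> {} \<Longrightarrow> r k \<in> B k \<and> J (r k) \<le> m k + ennreal \<delta>"
    by metis
  have "(\<Sum>k\<in>{1..K}. emeasure P (B k) * J (r k)) \<le> (\<Sum>k\<in>{1..K}. m k * emeasure P (B k)) + (\<Sum>k\<in>{1..K}. emeasure P (B k) * ennreal \<delta>)"
    unfolding sum.distrib[symmetric]
  proof (rule sum_mono)
    fix k assume k: "k \<in> {1..K}"
    show "emeasure P (B k) * J (r k) \<le> m k * emeasure P (B k) + emeasure P (B k) * ennreal \<delta>"
    proof (cases "B k = {}")
      case False
      then have "J (r k) \<le> m k + ennreal \<delta>" using r(2) k by simp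
      then have "emeasure P (B k) * J (r k) \<le> emeasure P (B k) * (m k + ennreal \<delta>)" by (rule mult_left_mono) simp
      then show ?thesis by (simp add: distrib_left mult.commute)
    qed simp
  qed
  also have "(\<Sum>k\<in>{1..K}. m k * emeasure P (B k)) \<le> j"
  proof -
    have "(\<Sum>k\<in>{1..K}. m k * emeasure P (B k)) = (\<integral>\<^sup>+x. (\<Sum>k\<in>{1..K}. m k * indicator (B k) x) \<partial>P)"
      by (subst nn_integral_sum) (auto simp: nn_integral_cmult_indicator)
    also have "\<dots> \<le> (\<integral>\<^sup>+x. J x \<partial>P)"
    proof (rule nn_integral_mono)
      fix x assume x: "x \<in> space P"
      have "(\<Sum>k\<in>{1..K}. m k * indicator (B k) x) = (\<Sum>k\<in>{1..K}. if k = \<kappa> x then m k else 0)"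
        using x by (intro sum.cong) (auto simp: B_def indicator_def)
      also have "\<dots> \<le> m (\<kappa> x)" by (simp add: sum.delta)
      also have "\<dots> \<le> J x" using x by (auto simp: m_def B_def intro!: INF_lower)
      finally show "(\<Sum>k\<in>{1..K}. m k * indicator (B k) x) \<le> J x" .
    qed
    finally show ?thesis using J by simp
  qed
  also have "(\<Sum>k\<in>{1..K}. emeasure P (B k) * ennreal \<delta>) \<le> ennreal \<delta>"
  proof -
    have "(\<Sum>k\<in>{1..K}. emeasure P (B k)) = emeasure P (\<Union>k\<in>{1..K}. B k)"
      by (intro sum_emeasure) (auto simp: disjoint_family_on_def B_def)
    also have "\<dots> \<le> 1" by (rule P.emeasure_le_1)
    finally have "(\<Sum>k\<in>{1..K}. emeasure P (B k)) * ennreal \<delta> \<le> 1 * ennreal \<delta>" by (rule mult_right_mono) simp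
    then show ?thesis by (simp add: sum_distrib_right)
  qed
  finally have cost: "(\<Sum>k\<in>{1..K}. emeasure P (B k) * J (r k)) \<le> j + ennreal \<delta>" by (simp add: add_mono)
  define h where "h k y = (if k = 0 then 1 else f (r k, y))" for k y
  have rsp: "r k \<in> space P" "(\<integral>\<^sup>+y. ennreal (f (r k, y)) \<partial>N) = 1" for k using r(1) good(2) by auto
  have fsec [measurable]: "(\<lambda>y. f (x, y)) \<in> borel_measurable N" if "x \<in> space P" for x
    using that by measurable
  have hm [measurable]: "h k \<in> borel_measurable N" for k
    unfolding h_def using fsec[OF rsp(1)] by (cases "k = 0") auto
  have "AE x in P. (\<integral>\<^sup>+y. ennreal \<bar>f (x, y) - h (\<kappa> x) y\<bar> \<partial>N) \<le> ennreal (2 * \<theta>) + 2 * indicator {x\<in>space P. D x > ennreal \<theta>} x"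
    using AEn AE_not_in[OF Z(1)] AE_space
  proof eventually_elim
    case (elim x)
    note [measurable] = fsec[OF elim(3)]
    show ?case
    proof (cases "D x > ennreal \<theta>")
      case True
      then have "\<kappa> x = 0" by (simp add: \<kappa>_def)
      then have "(\<integral>\<^sup>+y. ennreal \<bar>f (x, y) - h (\<kappa> x) y\<bar> \<partial>N) \<le> (\<integral>\<^sup>+y. ennreal (f (x, y)) + 1 \<partial>N)"
        using f0 by (intro nn_integral_mono)
          (auto simp: h_def abs_if ennreal_1[symmetric] simp flip: ennreal_plus simp del: ennreal_1 intro!: ennreal_leI)
      also have "\<dots> = 1 + 1" using elim by (subst nn_integral_add) (auto simp: N.emeasure_space_1)
      also have "\<dots> \<le> ennreal (2 * \<theta>) + 2 * indicator {x\<in>space P. D x > ennreal \<theta>} x"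
        using True elim by (simp add: one_add_one)
      finally show ?thesis .
    next
      case False
      let ?k = "\<kappa> x"
      have k: "?k = Suc (\<kappa>0 x)" using False elim by (simp add: \<kappa>_def)
      \<comment> \<open>The point \<open>x\<close> and the representative of its cell share the
        label of \<open>\<kappa>0\<close>; both fibres are within \<open>\<theta>\<close> of the
        same \<open>s (\<kappa>0 x)\<close>, hence within \<open>2 * \<theta>\<close> of each
        other.\<close>
      have "x \<in> B ?k" using elim by (auto simp: B_def)
      then have rB: "r ?k \<in> B ?k" using r(2)[of ?k] k by auto
      then have "\<kappa> (r ?k) = Suc (\<kappa>0 x)" using k by (auto simp: B_def)
      then have rr: "\<kappa>0 (r ?k) = \<kappa>0 x" "D (r ?k) \<le> ennreal \<theta>" by (auto simp: \<kappa>_def split: if_splits)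
      note [measurable] = fsec[OF rsp(1)]
      have "(\<integral>\<^sup>+y. ennreal \<bar>f (x, y) - h ?k y\<bar> \<partial>N) \<le>
          (\<integral>\<^sup>+y. ennreal \<bar>f (x, y) - s (\<kappa>0 x) y\<bar> + ennreal \<bar>f (r ?k, y) - s (\<kappa>0 (r ?k)) y\<bar> \<partial>N)"
        using k rr(1) by (intro nn_integral_mono) (auto simp: h_def simp flip: ennreal_plus intro!: ennreal_leI)
      also have "\<dots> = D x + D (r ?k)"
        unfolding D_def by (rule nn_integral_add) measurable
      also have "\<dots> \<le> ennreal \<theta> + ennreal \<theta>" using False rr(2) by (intro add_mono) auto
      also have "\<dots> = ennreal (2 * \<theta>)" using \<theta> by (simp flip: ennreal_plus)
      finally show ?thesis using False by simp
    qed
  qed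
  then have "(\<integral>\<^sup>+x. (\<integral>\<^sup>+y. ennreal \<bar>f (x, y) - h (\<kappa> x) y\<bar> \<partial>N) \<partial>P) \<le>
      (\<integral>\<^sup>+x. ennreal (2 * \<theta>) + 2 * indicator {x\<in>space P. D x > ennreal \<theta>} x \<partial>P)"
    by (rule nn_integral_mono_AE)
  also have "\<dots> = ennreal (2 * \<theta>) + 2 * emeasure P {x\<in>space P. D x > ennreal \<theta>}"
    by (subst nn_integral_add) (auto simp: P.emeasure_space_1 nn_integral_cmult_indicator)
  also have "emeasure P {x\<in>space P. D x > ennreal \<theta>} \<le> ennreal \<theta>"
  proof -
    have "ennreal \<theta> * emeasure P {x\<in>space P. D x > ennreal \<theta>} = (\<integral>\<^sup>+x. ennreal \<theta> * indicator {x\<in>space P. D x > ennreal \<theta>} x \<partial>P)"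
      by (subst nn_integral_cmult_indicator) auto
    also have "\<dots> \<le> (\<integral>\<^sup>+x. D x \<partial>P)" by (intro nn_integral_mono) (auto simp: indicator_def)
    also have "\<dots> \<le> ennreal \<theta> * ennreal \<theta>" using intD \<theta> by (simp add: ennreal_mult less_imp_le)
    finally show ?thesis using \<theta> by (simp add: ennreal_mult_le_mult_iff)
  qed
  finally have "(\<integral>\<^sup>+x. (\<integral>\<^sup>+y. ennreal \<bar>f (x, y) - h (\<kappa> x) y\<bar> \<partial>N) \<partial>P) \<le> ennreal (2 * \<theta>) + 2 * ennreal \<theta>"
    by (simp add: add_left_mono mult_left_mono)
  also have "2 * ennreal \<theta> = ennreal (2 * \<theta>)" using \<theta> by (simp add: ennreal_mult)
  also have "ennreal (2 * \<theta>) + ennreal (2 * \<theta>) = ennreal e"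
    using \<theta> by (subst ennreal_plus[symmetric]) (auto simp: \<theta>_def)
  also have "(\<integral>\<^sup>+x. (\<integral>\<^sup>+y. ennreal \<bar>f (x, y) - h (\<kappa> x) y\<bar> \<partial>N) \<partial>P) =
      (\<integral>\<^sup>+z. ennreal \<bar>f z - h (\<kappa> (fst z)) (snd z)\<bar> \<partial>(P \<Otimes>\<^sub>M N))"
    by (subst N.nn_integral_fst[symmetric]) auto
  finally have "(\<integral>\<^sup>+z. ennreal \<bar>f z - h (\<kappa> (fst z)) (snd z)\<bar> \<partial>(P \<Otimes>\<^sub>M N)) \<le> ennreal e" .
  then show ?thesis
    using \<kappa>m \<kappa>K r(1) cost unfolding h_def B_def by (intro exI[of _ \<kappa>] exI[of _ K] exI[of _ r]) simp
qed

section \<open>Gluing couplings\<close>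

text \<open>\<open>\<Lambda>\<close> is the law of \<open>G (z, w)\<close> when
  \<open>(z, k)\<close> has density \<open>a k z\<close> with respect to \<open>Q\<close> times
  counting measure and \<open>w\<close> has law \<open>\<pi> k\<close> given the label. Binding over
  the finite space of labels simply adds up \<open>K + 1\<close> subprobabilities.\<close>

lemma mixture_measure:
  fixes a :: "nat \<Rightarrow> 'a \<Rightarrow> ennreal"
  assumes a [measurable]: "\<And>k. k \<le> K \<Longrightarrow> a k \<in> borel_measurable Q"
    and mass: "(\<Sum>k\<le>K. \<integral>\<^sup>+z. a k z \<partial>Q) = 1"
    and \<pi>: "\<And>k. k \<le> K \<Longrightarrow> prob_space (\<pi> k)" "\<And>k. k \<le> K \<Longrightarrow> sets (\<pi> k) = sets C"
    and G [measurable]: "G \<in> Q \<Otimes>\<^sub>M C \<rightarrow>\<^sub>M D"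
  shows "\<exists>\<Lambda>. prob_space \<Lambda> \<and> sets \<Lambda> = sets D \<and>
    (\<forall>F\<in>borel_measurable D. (\<integral>\<^sup>+d. F d \<partial>\<Lambda>) = (\<Sum>k\<le>K. \<integral>\<^sup>+z. a k z * (\<integral>\<^sup>+w. F (G (z, w)) \<partial>\<pi> k) \<partial>Q))"
proof -
  define L where "L k = distr (density Q (a k) \<Otimes>\<^sub>M \<pi> k) D G" for k
  have int_L: "(\<integral>\<^sup>+d. F d \<partial>L k) = (\<integral>\<^sup>+z. a k z * (\<integral>\<^sup>+w. F (G (z, w)) \<partial>\<pi> k) \<partial>Q)"
    if [measurable]: "F \<in> borel_measurable D" and k: "k \<le> K" for F k
  proof -
    interpret prob_space "\<pi> k" by (rule \<pi>(1)[OF k])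
    note [measurable_cong] = \<pi>(2)[OF k]
    note [measurable] = a[OF k]
    have "(\<integral>\<^sup>+d. F d \<partial>L k) = (\<integral>\<^sup>+p. F (G p) \<partial>(density Q (a k) \<Otimes>\<^sub>M \<pi> k))"
      unfolding L_def by (rule nn_integral_distr) measurable
    also have "\<dots> = (\<integral>\<^sup>+z. (\<integral>\<^sup>+w. F (G (z, w)) \<partial>\<pi> k) \<partial>density Q (a k))"
      by (rule nn_integral_fst[symmetric]) measurable
    also have "\<dots> = (\<integral>\<^sup>+z. a k z * (\<integral>\<^sup>+w. F (G (z, w)) \<partial>\<pi> k) \<partial>Q)"
      by (rule nn_integral_density) measurable
    finally show ?thesis .
  qed
  have int1: "(\<integral>\<^sup>+d. 1 \<partial>L k) = (\<integral>\<^sup>+z. a k z \<partial>Q)" if k: "k \<le> K" for k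
  proof -
    interpret prob_space "\<pi> k" by (rule \<pi>(1)[OF k])
    show ?thesis using int_L[of "\<lambda>_. 1" k] k by (simp add: emeasure_space_1)
  qed
  have ne: "space D \<noteq> {}"
  proof
    assume "space D = {}"
    then have "(\<integral>\<^sup>+d. 1 \<partial>L k) = 0" for k by (simp add: L_def nn_integral_empty)
    then have "(\<Sum>k\<le>K. \<integral>\<^sup>+z. a k z \<partial>Q) = 0" using int1 by (intro sum.neutral) auto
    with mass show False by simp
  qed
  have Lm: "L \<in> count_space {..K} \<rightarrow>\<^sub>M subprob_algebra D"
    unfolding measurable_count_space_eq1
  proof (intro funcsetI)
    fix k assume k: "k \<in> {..K}"
    have "emeasure (L k) (space (L k)) = (\<integral>\<^sup>+z. a k z \<partial>Q)" using int1[of k] k by simp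
    also have "\<dots> \<le> (\<Sum>k\<le>K. \<integral>\<^sup>+z. a k z \<partial>Q)" using k by (intro member_le_sum) auto
    finally have "emeasure (L k) (space (L k)) \<le> 1" by (simp add: mass)
    then show "L k \<in> space (subprob_algebra D)"
      using ne by (auto simp: space_subprob_algebra L_def intro!: subprob_spaceI)
  qed
  define \<Lambda> where "\<Lambda> = count_space {..K} \<bind> L"
  have sets: "sets \<Lambda> = sets D" unfolding \<Lambda>_def by (rule sets_bind_measurable[OF Lm]) simp
  have int: "(\<integral>\<^sup>+d. F d \<partial>\<Lambda>) = (\<Sum>k\<le>K. \<integral>\<^sup>+z. a k z * (\<integral>\<^sup>+w. F (G (z, w)) \<partial>\<pi> k) \<partial>Q)"
    if "F \<in> borel_measurable D" for F
    unfolding \<Lambda>_def using that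
    by (subst nn_integral_bind[OF that Lm]) (simp add: nn_integral_count_space_finite int_L)
  have "prob_space \<Lambda>"
  proof
    have "emeasure \<Lambda> (space \<Lambda>) = (\<integral>\<^sup>+d. 1 \<partial>\<Lambda>)" by simp
    also have "\<dots> = (\<Sum>k\<le>K. \<integral>\<^sup>+z. a k z \<partial>Q)"
      using \<pi>(1) by (subst int) (auto intro!: sum.cong simp: prob_space.emeasure_space_1)
    finally show "emeasure \<Lambda> (space \<Lambda>) = 1" by (simp add: mass)
  qed
  with sets int show ?thesis by blast
qed

text \<open>\<open>a k\<close> is the conditional probability of \<open>\<kappa> = k\<close> given \<open>\<xi>\<close>.\<close>

lemma conditional_weights:
  assumes P: "prob_space P" and \<xi> [measurable]: "\<xi> \<in> P \<rightarrow>\<^sub>M M"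
    and \<kappa> [measurable]: "\<kappa> \<in> P \<rightarrow>\<^sub>M count_space UNIV" and K: "\<And>x. \<kappa> x \<le> (K::nat)"
  shows "\<exists>a. (\<forall>k. a k \<in> borel_measurable M) \<and>
    (AE x in distr P M \<xi>. (\<Sum>k\<le>K. a k x) = 1) \<and>
    (\<forall>k. \<forall>g\<in>borel_measurable M. (\<integral>\<^sup>+x. a k x * g x \<partial>distr P M \<xi>) = (\<integral>\<^sup>+\<omega>. g (\<xi> \<omega>) * indicator (\<kappa> -` {k}) \<omega> \<partial>P))"
proof -
  interpret P: prob_space P by fact
  let ?N = "distr P M \<xi>"
  interpret N: prob_space ?N by (rule P.prob_space_distr) fact
  define Nk where "Nk k = distr (density P (indicator (\<kappa> -` {k} \<inter> space P))) M \<xi>" for k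
  define a where "a k = RN_deriv ?N (Nk k)" for k
  have Bk [measurable]: "\<kappa> -` {k} \<inter> space P \<in> sets P" for k using \<kappa> by simp
  have am [measurable]: "a k \<in> borel_measurable M" for k
    unfolding a_def using borel_measurable_RN_deriv[of ?N "Nk k"] by simp
  have em: "emeasure (Nk k) A = (\<integral>\<^sup>+\<omega>. indicator A (\<xi> \<omega>) * indicator (\<kappa> -` {k} \<inter> space P) \<omega> \<partial>P)" if [measurable]: "A \<in> sets M" for k A
  proof -
    have "emeasure (Nk k) A = (\<integral>\<^sup>+x. indicator A x \<partial>Nk k)" by (simp add: Nk_def)
    also have "\<dots> = (\<integral>\<^sup>+\<omega>. indicator A (\<xi> \<omega>) \<partial>density P (indicator (\<kappa> -` {k} \<inter> space P)))"
      unfolding Nk_def by (rule nn_integral_distr) auto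
    also have "\<dots> = (\<integral>\<^sup>+\<omega>. indicator A (\<xi> \<omega>) * indicator (\<kappa> -` {k} \<inter> space P) \<omega> \<partial>P)"
      by (subst nn_integral_density) (auto simp: mult.commute)
    finally show ?thesis .
  qed
  have ac: "absolutely_continuous ?N (Nk k)" for k
    unfolding absolutely_continuous_def
  proof
    fix A assume "A \<in> null_sets ?N"
    then have A [measurable]: "A \<in> sets M" and A0: "emeasure ?N A = 0" by auto
    have "emeasure (Nk k) A \<le> (\<integral>\<^sup>+\<omega>. indicator A (\<xi> \<omega>) \<partial>P)"
      unfolding em[OF A] by (intro nn_integral_mono) (auto simp: indicator_def)
    also have "\<dots> = (\<integral>\<^sup>+x. indicator A x \<partial>?N)" by (rule nn_integral_distr[symmetric]) auto
    also have "\<dots> = 0" using A0 by simp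
    finally show "A \<in> null_sets (Nk k)" using A by (auto simp: Nk_def)
  qed
  have dens: "density ?N (a k) = Nk k" for k
    unfolding a_def using ac by (intro N.density_RN_deriv) (auto simp: Nk_def)
  have int: "(\<integral>\<^sup>+x. a k x * g x \<partial>?N) = (\<integral>\<^sup>+\<omega>. g (\<xi> \<omega>) * indicator (\<kappa> -` {k}) \<omega> \<partial>P)"
    if [measurable]: "g \<in> borel_measurable M" for g k
  proof -
    have "(\<integral>\<^sup>+x. a k x * g x \<partial>?N) = (\<integral>\<^sup>+x. g x \<partial>density ?N (a k))"
      by (rule nn_integral_density[symmetric]) auto
    also have "\<dots> = (\<integral>\<^sup>+x. g x \<partial>Nk k)" by (simp add: dens)
    also have "\<dots> = (\<integral>\<^sup>+\<omega>. g (\<xi> \<omega>) \<partial>density P (indicator (\<kappa> -` {k} \<inter> space P)))"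
      unfolding Nk_def by (rule nn_integral_distr) auto
    also have "\<dots> = (\<integral>\<^sup>+\<omega>. indicator (\<kappa> -` {k} \<inter> space P) \<omega> * g (\<xi> \<omega>) \<partial>P)"
      by (rule nn_integral_density) auto
    also have "\<dots> = (\<integral>\<^sup>+\<omega>. g (\<xi> \<omega>) * indicator (\<kappa> -` {k}) \<omega> \<partial>P)"
      by (intro nn_integral_cong) (auto simp: indicator_def)
    finally show ?thesis .
  qed
  \<comment> \<open>The cells of \<open>\<kappa>\<close> partition the space, so the measures
    \<open>Nk k\<close> add up to \<open>?N\<close>; uniqueness of densities then shows that the
    weights sum to 1 almost everywhere.\<close>
  have "density ?N (\<lambda>x. \<Sum>k\<le>K. a k x) = density ?N (\<lambda>_. 1)"
  proof (rule measure_eqI)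
    fix A assume "A \<in> sets (density ?N (\<lambda>x. \<Sum>k\<le>K. a k x))"
    then have [measurable]: "A \<in> sets M" by simp
    have "emeasure (density ?N (\<lambda>x. \<Sum>k\<le>K. a k x)) A = (\<integral>\<^sup>+x. (\<Sum>k\<le>K. a k x * indicator A x) \<partial>?N)"
      by (subst emeasure_density) (auto simp: sum_distrib_right)
    also have "\<dots> = (\<Sum>k\<le>K. \<integral>\<^sup>+\<omega>. indicator A (\<xi> \<omega>) * indicator (\<kappa> -` {k}) \<omega> \<partial>P)"
      by (subst nn_integral_sum) (auto simp: int)
    also have "\<dots> = (\<integral>\<^sup>+\<omega>. (\<Sum>k\<le>K. indicator A (\<xi> \<omega>) * indicator (\<kappa> -` {k} \<inter> space P) \<omega>) \<partial>P)"
      by (subst nn_integral_sum) (auto intro!: sum.cong nn_integral_cong simp: indicator_def)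
    also have "\<dots> = (\<integral>\<^sup>+\<omega>. indicator A (\<xi> \<omega>) \<partial>P)"
    proof (rule nn_integral_cong)
      fix \<omega> assume "\<omega> \<in> space P"
      then have "(\<Sum>k\<le>K. indicator A (\<xi> \<omega>) * indicator (\<kappa> -` {k} \<inter> space P) \<omega> :: ennreal) =
          (\<Sum>k\<le>K. if k = \<kappa> \<omega> then indicator A (\<xi> \<omega>) else 0)"
        by (intro sum.cong) (auto simp: indicator_def)
      then show "(\<Sum>k\<le>K. indicator A (\<xi> \<omega>) * indicator (\<kappa> -` {k} \<inter> space P) \<omega> :: ennreal) = indicator A (\<xi> \<omega>)"
        using K by (simp add: sum.delta)
    qed
    also have "\<dots> = (\<integral>\<^sup>+x. indicator A x \<partial>?N)" by (rule nn_integral_distr[symmetric]) auto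
    also have "\<dots> = emeasure (density ?N (\<lambda>_. 1)) A" by (subst emeasure_density) auto
    finally show "emeasure (density ?N (\<lambda>x. \<Sum>k\<le>K. a k x)) A = emeasure (density ?N (\<lambda>_. 1)) A" .
  qed simp
  then have "AE x in ?N. (\<Sum>k\<le>K. a k x) = 1"
    by (subst (asm) N.density_unique_iff) auto
  with am int show ?thesis by (intro exI[of _ a]) blast
qed

text \<open>Given \<open>(x, y)\<close> with law \<open>\<Gamma>\<close>, a label \<open>k\<close>
  is drawn with the conditional probability of \<open>\<kappa> = k\<close> given
  \<open>\<xi> = x\<close>, then \<open>(u, v)\<close> with law \<open>\<pi> k\<close>, and
  \<open>u\<close>, \<open>v\<close> are attached at \<open>i\<close>. The label sees only
  \<open>x\<close>, so the pair of \<open>x\<close> and label is distributed as \<open>\<xi>\<close>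
  and \<open>\<kappa>\<close> under \<open>P\<close>; this gives the first marginal. The law of
  \<open>v\<close> is \<open>\<mu> i\<close> whatever \<open>x\<close>, \<open>y\<close> and the
  label are, so the second marginal is again a product.\<close>

lemma glued_coupling:
  fixes \<mu> :: "nat \<Rightarrow> 'a measure"
  assumes I: "finite I" "i \<notin> I" and \<mu>: "\<And>j. prob_space (\<mu> j)"
    and \<Gamma>: "prob_space \<Gamma>" "sets \<Gamma> = sets (PiM I \<mu> \<Otimes>\<^sub>M PiM I \<mu>)"
      "distr \<Gamma> (PiM I \<mu>) fst = distr P (PiM I \<mu>) \<xi>" "distr \<Gamma> (PiM I \<mu>) snd = PiM I \<mu>"
    and P: "prob_space P" and \<xi> [measurable]: "\<xi> \<in> P \<rightarrow>\<^sub>M PiM I \<mu>"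
    and \<kappa> [measurable]: "\<kappa> \<in> P \<rightarrow>\<^sub>M count_space UNIV" and K: "\<And>x. \<kappa> x \<le> (K::nat)"
    and \<pi>: "\<And>k. prob_space (\<pi> k)" "\<And>k. sets (\<pi> k) = sets (\<mu> i \<Otimes>\<^sub>M \<mu> i)" "\<And>k. distr (\<pi> k) (\<mu> i) snd = \<mu> i"
    and c1: "c1 \<in> borel_measurable (PiM I \<mu> \<Otimes>\<^sub>M PiM I \<mu>)" and c2: "c2 \<in> borel_measurable (\<mu> i \<Otimes>\<^sub>M \<mu> i)"
    and c: "c \<in> borel_measurable (PiM (insert i I) \<mu> \<Otimes>\<^sub>M PiM (insert i I) \<mu>)"
      "\<And>x y u v. x \<in> space (PiM I \<mu>) \<Longrightarrow> y \<in> space (PiM I \<mu>) \<Longrightarrow> c (x(i := u), y(i := v)) = c1 (x, y) + c2 (u, v)"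
  shows "\<exists>\<Lambda>. prob_space \<Lambda> \<and> sets \<Lambda> = sets (PiM (insert i I) \<mu> \<Otimes>\<^sub>M PiM (insert i I) \<mu>) \<and>
    (\<forall>A\<in>sets (PiM (insert i I) \<mu>). emeasure \<Lambda> (A \<times> space (PiM (insert i I) \<mu>)) =
       (\<integral>\<^sup>+\<omega>. (\<integral>\<^sup>+y. indicator A ((\<xi> \<omega>)(i := y)) \<partial>distr (\<pi> (\<kappa> \<omega>)) (\<mu> i) fst) \<partial>P)) \<and>
    (\<forall>B\<in>sets (PiM (insert i I) \<mu>). emeasure \<Lambda> (space (PiM (insert i I) \<mu>) \<times> B) = emeasure (PiM (insert i I) \<mu>) B) \<and>
    (\<integral>\<^sup>+z. c z \<partial>\<Lambda>) = (\<integral>\<^sup>+z. c1 z \<partial>\<Gamma>) + (\<Sum>k\<le>K. emeasure P (\<kappa> -` {k} \<inter> space P) * (\<integral>\<^sup>+w. c2 w \<partial>\<pi> k))"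
proof -
  let ?I = "PiM I \<mu>" and ?N = "PiM (insert i I) \<mu>"
  interpret P: prob_space P by fact
  interpret \<Gamma>: prob_space \<Gamma> by fact
  interpret product_sigma_finite \<mu>
    by (simp add: product_sigma_finite_def \<mu> prob_space_imp_sigma_finite)
  note [measurable_cong] = \<Gamma>(2)
  obtain a where a': "(\<forall>k. a k \<in> borel_measurable ?I) \<and>
    (AE x in distr P ?I \<xi>. (\<Sum>k\<le>K. a k x) = 1) \<and>
    (\<forall>k. \<forall>g\<in>borel_measurable ?I. (\<integral>\<^sup>+x. a k x * g x \<partial>distr P ?I \<xi>) = (\<integral>\<^sup>+\<omega>. g (\<xi> \<omega>) * indicator (\<kappa> -` {k}) \<omega> \<partial>P))"
    using conditional_weights[OF P \<xi> \<kappa> K] by (elim exE)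
  then have a [measurable]: "\<And>k. a k \<in> borel_measurable ?I"
    and asum: "AE x in distr P ?I \<xi>. (\<Sum>k\<le>K. a k x) = 1"
    and aint: "\<And>k g. g \<in> borel_measurable ?I \<Longrightarrow> (\<integral>\<^sup>+x. a k x * g x \<partial>distr P ?I \<xi>) = (\<integral>\<^sup>+\<omega>. g (\<xi> \<omega>) * indicator (\<kappa> -` {k}) \<omega> \<partial>P)"
    by blast+
  have fst_int: "(\<integral>\<^sup>+z. a k (fst z) * g (fst z) \<partial>\<Gamma>) = (\<integral>\<^sup>+\<omega>. g (\<xi> \<omega>) * indicator (\<kappa> -` {k}) \<omega> \<partial>P)"
    if [measurable]: "g \<in> borel_measurable ?I" for g k
  proof -
    have "(\<integral>\<^sup>+z. a k (fst z) * g (fst z) \<partial>\<Gamma>) = (\<integral>\<^sup>+x. a k x * g x \<partial>distr \<Gamma> ?I fst)"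
      by (rule nn_integral_distr[symmetric]) measurable
    then show ?thesis by (simp add: \<Gamma>(3) aint)
  qed
  have asum\<Gamma>: "AE z in \<Gamma>. (\<Sum>k\<le>K. a k (fst z)) = 1"
    using asum unfolding \<Gamma>(3)[symmetric] by (rule AE_distrD[rotated]) measurable
  have ak: "(\<integral>\<^sup>+z. a k (fst z) \<partial>\<Gamma>) = emeasure P (\<kappa> -` {k} \<inter> space P)" for k
  proof -
    have "(\<integral>\<^sup>+z. a k (fst z) \<partial>\<Gamma>) = (\<integral>\<^sup>+\<omega>. indicator (\<kappa> -` {k}) \<omega> \<partial>P)"
      using fst_int[of "\<lambda>_. 1" k] by simp
    also have "\<dots> = (\<integral>\<^sup>+\<omega>. indicator (\<kappa> -` {k} \<inter> space P) \<omega> \<partial>P)"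
      by (intro nn_integral_cong) (auto simp: indicator_def)
    finally show ?thesis by simp
  qed
  have sum_a: "(\<Sum>k\<le>K. \<integral>\<^sup>+z. a k (fst z) * g z \<partial>\<Gamma>) = (\<integral>\<^sup>+z. g z \<partial>\<Gamma>)" if [measurable]: "g \<in> borel_measurable \<Gamma>" for g
  proof -
    have "(\<Sum>k\<le>K. \<integral>\<^sup>+z. a k (fst z) * g z \<partial>\<Gamma>) = (\<integral>\<^sup>+z. (\<Sum>k\<le>K. a k (fst z)) * g z \<partial>\<Gamma>)"
      by (subst nn_integral_sum[symmetric]) (auto simp: sum_distrib_right)
    also have "\<dots> = (\<integral>\<^sup>+z. g z \<partial>\<Gamma>)"
      using asum\<Gamma> by (intro nn_integral_cong_AE) (auto elim: eventually_mono)
    finally show ?thesis .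
  qed
  define G where "G p = ((fst (fst p))(i := fst (snd p)), (snd (fst p))(i := snd (snd p)))" for p :: "((nat \<Rightarrow> 'a) \<times> (nat \<Rightarrow> 'a)) \<times> 'a \<times> 'a"
  have upd [measurable]: "(\<lambda>p. (f p)(i := g p)) \<in> Q \<rightarrow>\<^sub>M ?N" if "f \<in> Q \<rightarrow>\<^sub>M ?I" "g \<in> Q \<rightarrow>\<^sub>M \<mu> i" for f g and Q :: "'c measure"
    using that by (intro measurable_fun_upd[where J=I]) auto
  have upd1 [measurable]: "(\<lambda>y. x(i := y)) \<in> \<mu> i \<rightarrow>\<^sub>M ?N" if "x \<in> space ?I" for x
    using that by (intro measurable_fun_upd[where J=I]) auto
  have Gm [measurable]: "G \<in> \<Gamma> \<Otimes>\<^sub>M (\<mu> i \<Otimes>\<^sub>M \<mu> i) \<rightarrow>\<^sub>M ?N \<Otimes>\<^sub>M ?N"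
    unfolding G_def
    by (intro measurable_Pair measurable_fun_upd[where J=I]) (auto, measurable)
  have "\<exists>\<Lambda>. prob_space \<Lambda> \<and> sets \<Lambda> = sets (?N \<Otimes>\<^sub>M ?N) \<and>
    (\<forall>F\<in>borel_measurable (?N \<Otimes>\<^sub>M ?N). (\<integral>\<^sup>+d. F d \<partial>\<Lambda>) = (\<Sum>k\<le>K. \<integral>\<^sup>+z. a k (fst z) * (\<integral>\<^sup>+w. F (G (z, w)) \<partial>\<pi> k) \<partial>\<Gamma>))"
    (is "\<exists>\<Lambda>. ?R \<Lambda>")
  proof (rule mixture_measure[OF _ _ \<pi>(1) \<pi>(2) Gm])
    show "(\<lambda>z. a k (fst z)) \<in> borel_measurable \<Gamma>" for k by measurable
    show "(\<Sum>k\<le>K. \<integral>\<^sup>+z. a k (fst z) \<partial>\<Gamma>) = 1"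
      using sum_a[of "\<lambda>_. 1"] by (simp add: \<Gamma>.emeasure_space_1)
  qed
  then obtain \<Lambda> where \<Lambda>': "?R \<Lambda>"
    by (elim exE)
  note \<Lambda> = conjunct1[OF \<Lambda>'] conjunct1[OF conjunct2[OF \<Lambda>']] bspec[OF conjunct2[OF conjunct2[OF \<Lambda>']]]
  have "space \<Gamma> = space ?I \<times> space ?I"
    using sets_eq_imp_space_eq[OF \<Gamma>(2)] by (simp only: space_pair_measure)
  then have sp\<Gamma>: "fst z \<in> space ?I" "snd z \<in> space ?I" if "z \<in> space \<Gamma>" for z
    using that by (simp_all only: mem_Times_iff)
  have sp\<pi>: "space (\<pi> k) = space (\<mu> i) \<times> space (\<mu> i)" for k
    using sets_eq_imp_space_eq[OF \<pi>(2)[of k]] by (simp only: space_pair_measure)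
  have updsp: "x(i := y) \<in> space ?N" if "x \<in> space ?I" "y \<in> space (\<mu> i)" for x y
    using measurable_space[OF upd1[OF that(1)] that(2)] .
  have marg1: "emeasure \<Lambda> (A \<times> space ?N) = (\<integral>\<^sup>+\<omega>. (\<integral>\<^sup>+y. indicator A ((\<xi> \<omega>)(i := y)) \<partial>distr (\<pi> (\<kappa> \<omega>)) (\<mu> i) fst) \<partial>P)"
    if A [measurable]: "A \<in> sets ?N" for A
  proof -
    define g where "g k x = (\<integral>\<^sup>+y. indicator A (x(i := y)) \<partial>distr (\<pi> k) (\<mu> i) fst)" for k x
    have gm [measurable]: "g k \<in> borel_measurable ?I" for k
    proof -
      note [measurable_cong] = \<pi>(2)[of k]
      interpret prob_space "\<pi> k" by (rule \<pi>(1))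
      interpret d: prob_space "distr (\<pi> k) (\<mu> i) fst" by (rule prob_space_distr) measurable
      have "(\<lambda>p. indicator A ((fst p)(i := snd p)) :: ennreal) \<in> borel_measurable (?I \<Otimes>\<^sub>M distr (\<pi> k) (\<mu> i) fst)"
        by measurable
      from d.borel_measurable_nn_integral_fst[OF this] show ?thesis unfolding g_def by simp
    qed
    have "emeasure \<Lambda> (A \<times> space ?N) = (\<integral>\<^sup>+z. indicator (A \<times> space ?N) z \<partial>\<Lambda>)"
      by (simp add: \<Lambda>(2))
    also have "\<dots> = (\<Sum>k\<le>K. \<integral>\<^sup>+z. a k (fst z) * (\<integral>\<^sup>+w. indicator (A \<times> space ?N) (G (z, w)) \<partial>\<pi> k) \<partial>\<Gamma>)"
      by (rule \<Lambda>(3)) measurable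
    also have "\<dots> = (\<Sum>k\<le>K. \<integral>\<^sup>+z. a k (fst z) * g k (fst z) \<partial>\<Gamma>)"
    proof (intro sum.cong refl nn_integral_cong arg_cong2[where f="(*)"])
      fix k z assume z: "z \<in> space \<Gamma>"
      note [measurable_cong] = \<pi>(2)[of k]
      note [measurable] = upd1[OF sp\<Gamma>(1)[OF z]]
      have "g k (fst z) = (\<integral>\<^sup>+w. indicator A ((fst z)(i := fst w)) \<partial>\<pi> k)"
        unfolding g_def by (rule nn_integral_distr) measurable
      also have "\<dots> = (\<integral>\<^sup>+w. indicator (A \<times> space ?N) (G (z, w)) \<partial>\<pi> k)"
        using updsp[OF sp\<Gamma>(2)[OF z]] by (intro nn_integral_cong) (auto simp: G_def sp\<pi> indicator_def)
      finally show "(\<integral>\<^sup>+w. indicator (A \<times> space ?N) (G (z, w)) \<partial>\<pi> k) = g k (fst z)" ..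
    qed
    also have "\<dots> = (\<Sum>k\<le>K. \<integral>\<^sup>+\<omega>. g k (\<xi> \<omega>) * indicator (\<kappa> -` {k}) \<omega> \<partial>P)"
      by (simp add: fst_int)
    also have "\<dots> = (\<integral>\<^sup>+\<omega>. (\<Sum>k\<le>K. g k (\<xi> \<omega>) * indicator (\<kappa> -` {k} \<inter> space P) \<omega>) \<partial>P)"
      by (subst nn_integral_sum) (auto intro!: sum.cong nn_integral_cong simp: indicator_def)
    also have "\<dots> = (\<integral>\<^sup>+\<omega>. g (\<kappa> \<omega>) (\<xi> \<omega>) \<partial>P)"
    proof (rule nn_integral_cong)
      fix \<omega> assume "\<omega> \<in> space P"
      then have "(\<Sum>k\<le>K. g k (\<xi> \<omega>) * indicator (\<kappa> -` {k} \<inter> space P) \<omega>) = (\<Sum>k\<le>K. if k = \<kappa> \<omega> then g k (\<xi> \<omega>) else 0)"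
        by (intro sum.cong) (auto simp: indicator_def)
      then show "(\<Sum>k\<le>K. g k (\<xi> \<omega>) * indicator (\<kappa> -` {k} \<inter> space P) \<omega>) = g (\<kappa> \<omega>) (\<xi> \<omega>)"
        using K by (simp add: sum.delta)
    qed
    finally show ?thesis by (simp add: g_def)
  qed
  \<comment> \<open>The inner integral no longer depends on \<open>k\<close>, so the weights
    disappear by \<open>sum_a\<close>.\<close>
  have marg2: "emeasure \<Lambda> (space ?N \<times> B) = emeasure ?N B" if B [measurable]: "B \<in> sets ?N" for B
  proof -
    define g where "g y = (\<integral>\<^sup>+v. indicator B (y(i := v)) \<partial>\<mu> i)" for y
    have gm [measurable]: "g \<in> borel_measurable ?I"
    proof -
      have "(\<lambda>p. indicator B ((fst p)(i := snd p)) :: ennreal) \<in> borel_measurable (?I \<Otimes>\<^sub>M \<mu> i)"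
        by measurable
      from sigma_finite_measure.borel_measurable_nn_integral_fst[OF prob_space_imp_sigma_finite[OF \<mu>] this] show ?thesis unfolding g_def by simp
    qed
    have "emeasure \<Lambda> (space ?N \<times> B) = (\<integral>\<^sup>+z. indicator (space ?N \<times> B) z \<partial>\<Lambda>)"
      by (simp add: \<Lambda>(2))
    also have "\<dots> = (\<Sum>k\<le>K. \<integral>\<^sup>+z. a k (fst z) * (\<integral>\<^sup>+w. indicator (space ?N \<times> B) (G (z, w)) \<partial>\<pi> k) \<partial>\<Gamma>)"
      by (rule \<Lambda>(3)) measurable
    also have "\<dots> = (\<Sum>k\<le>K. \<integral>\<^sup>+z. a k (fst z) * g (snd z) \<partial>\<Gamma>)"
    proof (intro sum.cong refl nn_integral_cong arg_cong2[where f="(*)"])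
      fix k z assume z: "z \<in> space \<Gamma>"
      note [measurable_cong] = \<pi>(2)[of k]
      note [measurable] = upd1[OF sp\<Gamma>(2)[OF z]]
      have "g (snd z) = (\<integral>\<^sup>+v. indicator B ((snd z)(i := v)) \<partial>distr (\<pi> k) (\<mu> i) snd)"
        unfolding g_def \<pi>(3) ..
      also have "\<dots> = (\<integral>\<^sup>+w. indicator B ((snd z)(i := snd w)) \<partial>\<pi> k)"
        by (rule nn_integral_distr) measurable
      also have "\<dots> = (\<integral>\<^sup>+w. indicator (space ?N \<times> B) (G (z, w)) \<partial>\<pi> k)"
        using updsp[OF sp\<Gamma>(1)[OF z]] by (intro nn_integral_cong) (auto simp: G_def sp\<pi> indicator_def)
      finally show "(\<integral>\<^sup>+w. indicator (space ?N \<times> B) (G (z, w)) \<partial>\<pi> k) = g (snd z)" ..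
    qed
    also have "\<dots> = (\<integral>\<^sup>+z. g (snd z) \<partial>\<Gamma>)" by (rule sum_a) measurable
    also have "\<dots> = (\<integral>\<^sup>+y. g y \<partial>distr \<Gamma> ?I snd)"
      by (rule nn_integral_distr[symmetric]) measurable
    also have "\<dots> = (\<integral>\<^sup>+y. indicator B y \<partial>?N)"
      unfolding g_def \<Gamma>(4) by (rule product_nn_integral_insert[symmetric]) (use I in auto)
    finally show ?thesis by simp
  qed
  have cost: "(\<integral>\<^sup>+z. c z \<partial>\<Lambda>) = (\<integral>\<^sup>+z. c1 z \<partial>\<Gamma>) + (\<Sum>k\<le>K. emeasure P (\<kappa> -` {k} \<inter> space P) * (\<integral>\<^sup>+w. c2 w \<partial>\<pi> k))"
  proof -
    note [measurable] = c1 c2 c(1)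
    have "(\<integral>\<^sup>+z. c z \<partial>\<Lambda>) = (\<Sum>k\<le>K. \<integral>\<^sup>+z. a k (fst z) * (\<integral>\<^sup>+w. c (G (z, w)) \<partial>\<pi> k) \<partial>\<Gamma>)"
      by (rule \<Lambda>(3)) measurable
    also have "\<dots> = (\<Sum>k\<le>K. \<integral>\<^sup>+z. a k (fst z) * c1 z + a k (fst z) * (\<integral>\<^sup>+w. c2 w \<partial>\<pi> k) \<partial>\<Gamma>)"
    proof (intro sum.cong refl nn_integral_cong)
      fix k z assume z: "z \<in> space \<Gamma>"
      note [measurable_cong] = \<pi>(2)[of k]
      interpret p: prob_space "\<pi> k" by (rule \<pi>(1))
      have "(\<integral>\<^sup>+w. c (G (z, w)) \<partial>\<pi> k) = (\<integral>\<^sup>+w. c1 z + c2 w \<partial>\<pi> k)"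
        using c(2)[OF sp\<Gamma>[OF z]] by (intro nn_integral_cong) (simp add: G_def)
      also have "\<dots> = c1 z + (\<integral>\<^sup>+w. c2 w \<partial>\<pi> k)"
        by (subst nn_integral_add) (auto simp: p.emeasure_space_1)
      finally show "a k (fst z) * (\<integral>\<^sup>+w. c (G (z, w)) \<partial>\<pi> k) = a k (fst z) * c1 z + a k (fst z) * (\<integral>\<^sup>+w. c2 w \<partial>\<pi> k)"
        by (simp add: distrib_left)
    qed
    also have "\<dots> = (\<Sum>k\<le>K. (\<integral>\<^sup>+z. a k (fst z) * c1 z \<partial>\<Gamma>) + (\<integral>\<^sup>+z. a k (fst z) \<partial>\<Gamma>) * (\<integral>\<^sup>+w. c2 w \<partial>\<pi> k))"
      by (intro sum.cong refl) (simp add: nn_integral_add nn_integral_multc)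
    also have "\<dots> = (\<integral>\<^sup>+z. c1 z \<partial>\<Gamma>) + (\<Sum>k\<le>K. emeasure P (\<kappa> -` {k} \<inter> space P) * (\<integral>\<^sup>+w. c2 w \<partial>\<pi> k))"
      by (simp add: sum.distrib sum_a ak)
    finally show ?thesis .
  qed
  from \<Lambda>(1,2) marg1 marg2 cost show ?thesis by (intro exI[of _ \<Lambda>] conjI ballI)
qed

section \<open>Rate functions\<close>

lemma Lim_at_top_mono:
  fixes \<alpha> :: "real \<Rightarrow> ennreal"
  assumes "mono_on {0..} \<alpha>"
  shows "Lim at_top \<alpha> = (SUP s\<in>{0..}. \<alpha> s)"
proof (rule tendsto_Lim)
  show "(\<alpha> \<longlongrightarrow> (SUP s\<in>{0..}. \<alpha> s)) at_top"
  proof (rule order_tendstoI)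
    fix a assume "a < (SUP s\<in>{0..}. \<alpha> s)"
    then obtain s where s: "s \<ge> 0" "a < \<alpha> s" by (auto simp: less_SUP_iff)
    have "a < \<alpha> r" if "r \<ge> s" for r
      using s that monotone_onD[OF assms, of s r] by (auto intro: less_le_trans)
    then show "\<forall>\<^sub>F r in at_top. a < \<alpha> r" by (auto simp: eventually_at_top_linorder)
  next
    fix a assume a: "(SUP s\<in>{0..}. \<alpha> s) < a"
    have "\<alpha> r < a" if "r \<ge> 0" for r
      using that a by (auto intro: le_less_trans[OF SUP_upper])
    then show "\<forall>\<^sub>F r in at_top. \<alpha> r < a" by (auto simp: eventually_at_top_linorder)
  qed
qed simp

lemma extend_infinity_ge:
  assumes \<alpha>: "mono_on {0..} \<alpha>" and s: "0 \<le> s" "ennreal s \<le> t"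
  shows "\<alpha> s \<le> extend_infinity \<alpha> t"
proof (cases t)
  case (real r)
  then have "\<alpha> s \<le> \<alpha> r" using s by (intro monotone_onD[OF \<alpha>]) auto
  then show ?thesis using real by (simp add: extend_infinity_def)
next
  case top
  then show ?thesis using s by (auto simp: extend_infinity_def Lim_at_top_mono[OF \<alpha>] intro!: SUP_upper)
qed

text \<open>Left continuity at a positive real, and the definition of the extension at
  \<open>\<infinity>\<close>, both reduce the bound to arguments strictly below \<open>r\<close>. At
  \<open>r = 0\<close> there are none, and \<open>\<alpha> 0 = 0\<close> is used.\<close>

lemma extend_infinity_le:
  assumes \<alpha>: "rate_function \<alpha>" and J: "\<And>s. 0 \<le> s \<Longrightarrow> ennreal s < r \<Longrightarrow> \<alpha> s \<le> J"
  shows "extend_infinity \<alpha> r \<le> J"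
proof (cases r)
  case (real t)
  show ?thesis
  proof (cases "t = 0")
    case False
    then have t: "t > 0" using real by simp
    have "(\<alpha> \<longlongrightarrow> \<alpha> t) (at_left t)"
      using \<alpha> t by (auto simp: rate_function_def continuous_within)
    moreover have "\<forall>\<^sub>F s in at_left t. \<alpha> s \<le> J"
      unfolding eventually_at_left_field using t
      by (intro exI[of _ 0]) (auto intro!: J simp: real ennreal_less_iff)
    ultimately have "\<alpha> t \<le> J" by (intro tendsto_upperbound) auto
    then show ?thesis using real by (simp add: extend_infinity_def)
  qed (use \<alpha> real in \<open>auto simp: extend_infinity_def rate_function_def\<close>)
next
  case top
  then show ?thesis using \<alpha> J
    by (auto simp: extend_infinity_def rate_function_def Lim_at_top_mono intro!: SUP_least)
qed

lemma rate_function_scale: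
  assumes \<alpha>: "rate_function \<alpha>" and "0 \<le> s" "0 \<le> u" "u \<le> 1"
  shows "\<alpha> (u * s) \<le> ennreal u * \<alpha> s"
proof -
  have "\<alpha> ((1 - u) * 0 + u * s) \<le> ennreal (1 - u) * \<alpha> 0 + ennreal u * \<alpha> s"
    using assms by (auto simp: rate_function_def)
  then show ?thesis using \<alpha> by (simp add: rate_function_def)
qed

text \<open>The missing mass may be thought of as sitting at 0, where \<open>\<alpha>\<close>
  vanishes. The induction splits off one point of weight \<open>q\<close> and divides the other
  weights by \<open>1 - q\<close>, which keeps their total at most 1.\<close>

lemma rate_function_Jensen:
  assumes \<alpha>: "rate_function \<alpha>" and "finite K"
    and "\<And>k. k \<in> K \<Longrightarrow> 0 \<le> p k" "\<And>k. k \<in> K \<Longrightarrow> 0 \<le> t k" "(\<Sum>k\<in>K. p k) \<le> 1"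
  shows "\<alpha> (\<Sum>k\<in>K. p k * t k) \<le> (\<Sum>k\<in>K. ennreal (p k) * \<alpha> (t k))"
  using assms(2-)
proof (induction arbitrary: p)
  case empty
  then show ?case using \<alpha> by (simp add: rate_function_def)
next
  case (insert k K)
  define q where "q = p k"
  have q: "0 \<le> q" "q \<le> 1" "(\<Sum>k\<in>K. p k) \<le> 1 - q"
    using insert sum_nonneg[of K p] by (auto simp: q_def)
  show ?case
  proof (cases "q = 1")
    case True
    then have "(\<Sum>k\<in>K. p k) = 0" using q(3) insert.prems(1) by (intro antisym sum_nonneg) auto
    then have "\<forall>k\<in>K. p k = 0" using insert by (subst (asm) sum_nonneg_eq_0_iff) auto
    then have "(\<Sum>k\<in>K. p k * t k) = 0" by simp
    then show ?thesis using insert True by (simp add: q_def)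
  next
    case False
    then have q1: "q < 1" using q by simp
    define y where "y = (\<Sum>k\<in>K. p k / (1 - q) * t k)"
    have "\<alpha> y \<le> (\<Sum>k\<in>K. ennreal (p k / (1 - q)) * \<alpha> (t k))"
      unfolding y_def using insert q q1
      by (intro insert.IH) (auto simp: sum_divide_distrib[symmetric])
    then have "ennreal (1 - q) * \<alpha> y \<le> ennreal (1 - q) * (\<Sum>k\<in>K. ennreal (p k / (1 - q)) * \<alpha> (t k))"
      by (rule mult_left_mono) simp
    also have "\<dots> = (\<Sum>k\<in>K. ennreal (p k) * \<alpha> (t k))"
      unfolding sum_distrib_left using q1 insert.prems(1)
      by (intro sum.cong) (auto simp: mult.assoc[symmetric] simp flip: ennreal_mult)
    finally have 1: "ennreal (1 - q) * \<alpha> y \<le> (\<Sum>k\<in>K. ennreal (p k) * \<alpha> (t k))" .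
    have y0: "0 \<le> y" unfolding y_def using insert.prems q1 by (intro sum_nonneg) auto
    have conv: "\<And>x y t. 0 \<le> x \<Longrightarrow> 0 \<le> y \<Longrightarrow> t \<in> {0..1} \<Longrightarrow>
        \<alpha> ((1 - t) * x + t * y) \<le> ennreal (1 - t) * \<alpha> x + ennreal t * \<alpha> y"
      using \<alpha> by (auto simp: rate_function_def)
    have "(\<Sum>k\<in>K. p k * t k) = (1 - q) * y"
      unfolding y_def sum_distrib_left using q1 by (intro sum.cong) auto
    then have "\<alpha> (\<Sum>k\<in>insert k K. p k * t k) = \<alpha> ((1 - q) * y + q * t k)"
      using insert by (simp add: q_def add.commute)
    also have "\<dots> \<le> ennreal (1 - q) * \<alpha> y + ennreal q * \<alpha> (t k)"
      using q y0 insert.prems by (intro conv) auto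
    also have "\<dots> \<le> (\<Sum>k\<in>K. ennreal (p k) * \<alpha> (t k)) + ennreal q * \<alpha> (t k)"
      using 1 by (rule add_right_mono)
    finally show ?thesis using insert by (simp add: q_def add.commute)
  qed
qed

text \<open>Convexity and \<open>\<alpha> 0 = 0\<close> give
  \<open>\<alpha> (k * s) \<ge> k * \<alpha> s\<close>. So either \<open>\<alpha>\<close> vanishes
  on the half-line, or a finite value of the extended function excludes an infinite
  argument.\<close>

lemma rate_function_Lim_at_top:
  assumes \<alpha>: "rate_function \<alpha>" and s: "0 \<le> s" "\<alpha> s \<noteq> 0"
  shows "Lim at_top \<alpha> = \<infinity>"
proof -
  have mono: "mono_on {0..} \<alpha>" using \<alpha> by (simp add: rate_function_def)
  have "of_nat k * \<alpha> s \<le> Lim at_top \<alpha>" if k: "k > 0" for k :: nat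
  proof -
    have "\<alpha> (1 / real k * (real k * s)) \<le> ennreal (1 / real k) * \<alpha> (real k * s)"
      using s k by (intro rate_function_scale[OF \<alpha>]) auto
    then have "\<alpha> s \<le> ennreal (1 / real k) * \<alpha> (real k * s)" using k by simp
    then have "of_nat k * \<alpha> s \<le> of_nat k * (ennreal (1 / real k) * \<alpha> (real k * s))"
      by (rule mult_left_mono) simp
    also have "of_nat k * (ennreal (1 / real k) * \<alpha> (real k * s)) = \<alpha> (real k * s)"
      using k by (simp add: ennreal_of_nat_eq_real_of_nat mult.assoc[symmetric] flip: ennreal_mult)
    also have "\<dots> \<le> Lim at_top \<alpha>"
      using s by (auto simp: Lim_at_top_mono[OF mono] intro!: SUP_upper)
    finally show ?thesis .
  qed
  then have "(SUP k::nat. of_nat k * \<alpha> s) \<le> Lim at_top \<alpha>"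
    by (intro SUP_least) (metis gr0I mult_zero_left of_nat_0 zero_le)
  moreover have "(SUP k::nat. of_nat k * \<alpha> s) = \<infinity>"
    using s(2) by (subst SUP_mult_right_ennreal[symmetric]) (simp add: ennreal_SUP_of_nat_eq_top ennreal_top_mult)
  ultimately show ?thesis by (simp add: top_unique)
qed

text \<open>If all \<open>r i\<close> are finite, they are shrunk proportionally until their sum is
  exactly \<open>T\<close>. If some \<open>r i\<close> is infinite, either \<open>J i\<close> is
  infinite too or \<open>\<alpha> i\<close> vanishes, and then the infimum convolution is 0.\<close>

lemma inf_convolution_extend_le:
  assumes n: "n \<ge> 1" and \<alpha>: "\<And>i. i \<in> {1..n} \<Longrightarrow> rate_function (\<alpha> i)"
    and J: "\<And>i. i \<in> {1..n} \<Longrightarrow> extend_infinity (\<alpha> i) (r i) \<le> J i"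
    and T: "T \<le> (\<Sum>i\<in>{1..n}. r i)"
  shows "extend_infinity (inf_convolution n \<alpha>) T \<le> (\<Sum>i\<in>{1..n}. J i)"
proof (cases "\<exists>i\<in>{1..n}. r i = \<infinity>")
  case False
  define x where "x i = enn2real (r i)" for i
  have x: "r i = ennreal (x i)" "0 \<le> x i" if "i \<in> {1..n}" for i
    using False that by (auto simp: x_def less_top)
  have "(\<Sum>i\<in>{1..n}. r i) = (\<Sum>i\<in>{1..n}. ennreal (x i))" using x by (intro sum.cong) auto
  also have "\<dots> = ennreal (\<Sum>i\<in>{1..n}. x i)" using x by (intro sum_ennreal) auto
  finally have sum: "(\<Sum>i\<in>{1..n}. r i) = ennreal (\<Sum>i\<in>{1..n}. x i)" .
  define R where "R = (\<Sum>i\<in>{1..n}. x i)"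
  have R0: "0 \<le> R" using x unfolding R_def by (intro sum_nonneg) auto
  obtain t where t: "T = ennreal t" "0 \<le> t" "t \<le> R"
    using T R0 unfolding sum R_def[symmetric] by (cases T) (auto simp: top_unique)
  \<comment> \<open>The factor \<open>t / R\<close> is at most 1, so monotonicity of each
    \<open>\<alpha> i\<close> absorbs the shrinking. If \<open>R = 0\<close> then
    \<open>t = 0\<close>, and zero shares do.\<close>
  define \<rho> where "\<rho> i = (if R = 0 then 0 else x i * (t / R))" for i
  have \<rho>0: "0 \<le> \<rho> i" "\<rho> i \<le> x i" if "i \<in> {1..n}" for i
    using x[OF that] t R0 mult_left_mono[of "t / R" 1 "x i"] by (auto simp: \<rho>_def)
  have "(\<Sum>i\<in>{1..n}. \<rho> i) = t"
  proof (cases "R = 0")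
    case False
    have "(\<Sum>i\<in>{1..n}. \<rho> i) = R * (t / R)"
      unfolding R_def sum_distrib_right using False by (intro sum.cong) (auto simp: \<rho>_def R_def)
    then show ?thesis using False by simp
  qed (use t in \<open>simp add: \<rho>_def\<close>)
  then have "inf_convolution n \<alpha> t \<le> (\<Sum>i\<in>{1..n}. \<alpha> i (\<rho> i))"
    unfolding inf_convolution_def using \<rho>0 by (intro INF_lower) auto
  also have "\<dots> \<le> (\<Sum>i\<in>{1..n}. J i)"
  proof (rule sum_mono)
    fix i assume i: "i \<in> {1..n}"
    have "\<alpha> i (\<rho> i) \<le> extend_infinity (\<alpha> i) (r i)"
      using \<alpha>[OF i] \<rho>0[OF i] x[OF i] by (intro extend_infinity_ge) (auto simp: rate_function_def ennreal_leI)
    then show "\<alpha> i (\<rho> i) \<le> J i" using J[OF i] by (rule order_trans)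
  qed
  finally show ?thesis using t by (simp add: extend_infinity_def)
next
  case True
  then obtain i where i: "i \<in> {1..n}" "r i = \<infinity>" by blast
  show ?thesis
  proof (cases "J i = \<infinity>")
    case True
    moreover have "J i \<le> (\<Sum>i\<in>{1..n}. J i)" using i by (intro member_le_sum) auto
    ultimately have "\<infinity> \<le> (\<Sum>i\<in>{1..n}. J i)" by (simp only:)
    then show ?thesis by (simp only: infinity_ennreal_def top_unique top_greatest)
  next
    case False
    have "Lim at_top (\<alpha> i) \<noteq> \<infinity>"
      using J[OF i(1)] False i(2) by (auto simp: extend_infinity_def top_unique)
    \<comment> \<open>Once \<open>\<alpha> i\<close> vanishes, the whole of \<open>t\<close> can be
      placed on coordinate \<open>i\<close> at no expense.\<close>
    then have zero: "\<alpha> i s = 0" if "0 \<le> s" for s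
      using rate_function_Lim_at_top[OF \<alpha>[OF i(1)] that] by auto
    have inf0: "inf_convolution n \<alpha> t = 0" if t: "0 \<le> t" for t
    proof -
      have "inf_convolution n \<alpha> t \<le> (\<Sum>k\<in>{1..n}. \<alpha> k (if k = i then t else 0))"
        unfolding inf_convolution_def using i t by (intro INF_lower) auto
      also have "\<dots> = 0"
        using zero t \<alpha> by (intro sum.neutral) (auto simp: rate_function_def)
      finally show ?thesis by simp
    qed
    have "(inf_convolution n \<alpha> \<longlongrightarrow> 0) at_top"
      using inf0 by (intro tendsto_eventually) (auto simp: eventually_at_top_linorder)
    then have "Lim at_top (inf_convolution n \<alpha>) = 0" by (intro tendsto_Lim) auto
    then have "extend_infinity (inf_convolution n \<alpha>) T = 0" using inf0 by (simp add: extend_infinity_def)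
    then show ?thesis by simp
  qed
qed

section \<open>Information and lower semicontinuous costs\<close>

text \<open>Simple minorants of \<open>u\<close> and \<open>v\<close> add up to a simple minorant of
  the sum; no measurability is involved. This is the inequality that assembles the bounds for single
  coordinates into \<open>sum_form_integral\<close>.\<close>

lemma nn_integral_superadditive:
  fixes u v :: "'a \<Rightarrow> ennreal"
  shows "(\<integral>\<^sup>+x. u x \<partial>M) + (\<integral>\<^sup>+x. v x \<partial>M) \<le> (\<integral>\<^sup>+x. u x + v x \<partial>M)"
proof -
  have ne: "{g. simple_function M g \<and> g \<le> w} \<noteq> {}" for w :: "'a \<Rightarrow> ennreal"
    by (auto intro!: exI[of _ "\<lambda>_. 0"] simp: le_fun_def)
  have le: "integral\<^sup>S M s + integral\<^sup>S M t \<le> (\<integral>\<^sup>+x. u x + v x \<partial>M)"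
    if "simple_function M s" "s \<le> u" "simple_function M t" "t \<le> v" for s t
  proof -
    have "integral\<^sup>S M s + integral\<^sup>S M t = (\<integral>\<^sup>+x. s x + t x \<partial>M)"
      using that by (simp add: nn_integral_eq_simple_integral[symmetric] nn_integral_add borel_measurable_simple_function)
    also have "\<dots> \<le> (\<integral>\<^sup>+x. u x + v x \<partial>M)"
      using that by (intro nn_integral_mono add_mono) (auto simp: le_fun_def)
    finally show ?thesis .
  qed
  show ?thesis
    unfolding nn_integral_def[of M u] nn_integral_def[of M v] ennreal_SUP_add_left[OF ne, symmetric]
  proof (rule SUP_least)
    fix s assume s: "s \<in> {g. simple_function M g \<and> g \<le> u}"
    show "integral\<^sup>S M s + (SUP t\<in>{g. simple_function M g \<and> g \<le> v}. integral\<^sup>S M t) \<le> (\<integral>\<^sup>+x. u x + v x \<partial>M)"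
    proof -
      have "integral\<^sup>S M s + (SUP t\<in>{g. simple_function M g \<and> g \<le> v}. integral\<^sup>S M t) =
          (SUP t\<in>{g. simple_function M g \<and> g \<le> v}. integral\<^sup>S M s + integral\<^sup>S M t)"
        using ennreal_SUP_add_left[OF ne, of "integral\<^sup>S M" "integral\<^sup>S M s" v] by (simp add: add.commute)
      then show ?thesis using s le by (simp only:) (auto intro!: SUP_least)
    qed
  qed
qed

lemma nn_integral_superadditive_sum:
  fixes u :: "'i \<Rightarrow> 'a \<Rightarrow> ennreal"
  assumes "finite I"
  shows "(\<Sum>i\<in>I. \<integral>\<^sup>+x. u i x \<partial>M) \<le> (\<integral>\<^sup>+x. (\<Sum>i\<in>I. u i x) \<partial>M)"
  using assms
proof induction
  case (insert i I)
  then have "(\<Sum>i\<in>insert i I. \<integral>\<^sup>+x. u i x \<partial>M) \<le> (\<integral>\<^sup>+x. u i x \<partial>M) + (\<integral>\<^sup>+x. (\<Sum>i\<in>I. u i x) \<partial>M)"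
    by (simp add: add_left_mono)
  also have "\<dots> \<le> (\<integral>\<^sup>+x. u i x + (\<Sum>i\<in>I. u i x) \<partial>M)" by (rule nn_integral_superadditive)
  finally show ?case using insert by simp
qed simp

text \<open>The density formula is applied to simple minorants of \<open>J\<close>, which suffices
  because the lower integral against the density is to be bounded from above.\<close>

lemma nn_integral_density_le:
  assumes [measurable]: "h \<in> borel_measurable M"
  shows "(\<integral>\<^sup>+x. J x \<partial>density M h) \<le> (\<integral>\<^sup>+x. h x * J x \<partial>M)"
  unfolding nn_integral_def[of "density M h" J]
proof (rule SUP_least)
  fix s assume "s \<in> {g. simple_function (density M h) g \<and> g \<le> J}"
  then have s: "simple_function (density M h) s" "s \<le> J" by auto
  have [measurable]: "s \<in> borel_measurable M"
    using borel_measurable_simple_function[OF s(1)] by simp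
  have "integral\<^sup>S (density M h) s = (\<integral>\<^sup>+x. s x \<partial>density M h)"
    using s(1) by (rule nn_integral_eq_simple_integral[symmetric])
  also have "\<dots> = (\<integral>\<^sup>+x. h x * s x \<partial>M)" by (rule nn_integral_density) auto
  also have "\<dots> \<le> (\<integral>\<^sup>+x. h x * J x \<partial>M)"
    using s(2) by (intro nn_integral_mono mult_left_mono) (auto simp: le_fun_def)
  finally show "integral\<^sup>S (density M h) s \<le> (\<integral>\<^sup>+x. h x * J x \<partial>M)" .
qed

text \<open>The square root of the density is \<open>g\<close> divided by the square root of
  \<open>Z\<close>, and a quadratic form is homogeneous of degree 2. The Radon-Nikodym derivative is
  determined only almost everywhere, so stability of the form under such changes is used as
  well.\<close>

lemma fisher_dv_information_normalized:
  assumes M: "sigma_finite_measure M" and E: "dirichlet_form M D E"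
    and g: "g \<in> D" "\<And>x. 0 \<le> g x" and Z: "0 < Z"
  shows "fisher_dv_information M D (\<lambda>g. E g g) (density M (\<lambda>x. ennreal ((g x)\<^sup>2 / Z))) = ennreal (E g g / Z)"
proof -
  interpret sigma_finite_measure M by fact
  note d = E[unfolded dirichlet_form_def]
  note DL2 = d[THEN conjunct1]
    and lin' = d[THEN conjunct2, THEN conjunct1]
    and ae' = d[THEN conjunct2, THEN conjunct2, THEN conjunct2, THEN conjunct1]
    and sym' = d[THEN conjunct2, THEN conjunct2, THEN conjunct2, THEN conjunct2, THEN conjunct1]
    and bil' = d[THEN conjunct2, THEN conjunct2, THEN conjunct2, THEN conjunct2, THEN conjunct2, THEN conjunct1]
  note lin = lin'[rule_format] and ae = ae'[rule_format] and sym = sym'[rule_format] and bil = bil'[rule_format]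
  have [measurable]: "g \<in> borel_measurable M" using g(1) DL2 by (auto simp: L2_def)
  define h where "h = (\<lambda>x. ennreal ((g x)\<^sup>2 / Z))"
  have [measurable]: "h \<in> borel_measurable M" unfolding h_def by measurable
  let ?f = "RN_deriv M (density M h)"
  have fM [measurable]: "?f \<in> borel_measurable M" by simp
  have f_h: "AE x in M. h x = ?f x"
    by (rule RN_deriv_unique) auto
  have dens: "density M h = density M ?f"
    using f_h by (intro density_cong) auto
  define s where "s = (\<lambda>x. sqrt (enn2real (?f x)))"
  have sm: "s \<in> borel_measurable M" unfolding s_def by measurable
  \<comment> \<open>The term \<open>0 * g x\<close> brings the multiple of \<open>g\<close> into the
    shape of the two-term linear combinations under which \<open>D\<close> is closed.\<close>
  define w where "w = (\<lambda>x. (1 / sqrt Z) * g x + 0 * g x)"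
  have wD: "w \<in> D" unfolding w_def using g(1) by (intro lin)
  have "AE x in M. w x = s x"
    using f_h
  proof eventually_elim
    case (elim x)
    have "enn2real (h x) = (g x)\<^sup>2 / Z" using Z by (simp add: h_def)
    then have "enn2real (?f x) = (g x)\<^sup>2 / Z" by (simp only: elim)
    then show ?case using g(2)[of x] by (simp add: s_def w_def real_sqrt_divide)
  qed
  from ae[OF wD sm this] have s: "s \<in> D" "\<And>u. u \<in> D \<Longrightarrow> E s u = E w u" by auto
  have wl: "E w u = 1 / sqrt Z * E g u" if "u \<in> D" for u
    unfolding w_def using bil[OF g(1) g(1) that, of "1 / sqrt Z" 0] by simp
  \<comment> \<open>Linearity and invariance under a.e. equality are given for the first argument;
    symmetry carries them over to the second.\<close>
  have "E s s = E w s" using s by simp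
  also have "\<dots> = E s w" using sym wD s by simp
  also have "\<dots> = E w w" using s wD by simp
  also have "\<dots> = 1 / sqrt Z * E g w" using wl wD by simp
  also have "\<dots> = 1 / sqrt Z * E w g" using sym wD g by simp
  also have "\<dots> = 1 / sqrt Z * (1 / sqrt Z * E g g)" using wl g by simp
  also have "\<dots> = E g g / Z" using Z by (simp add: field_simps)
  finally have "E s s = E g g / Z" .
  then show ?thesis
    using s(1) dens unfolding fisher_dv_information_def h_def[symmetric] s_def by (simp add: Let_def)
qed

section \<open>Lower semicontinuity of sums of costs\<close>

definition lsc_on :: "'a topology \<Rightarrow> ('a \<Rightarrow> ennreal) \<Rightarrow> bool" where
  "lsc_on T f \<longleftrightarrow> (\<forall>a. openin T {x \<in> topspace T. a < f x})"

text \<open>A summand equal to 0 has no element below it; the first two alternatives cover that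
  case. Read as a union over \<open>b\<close>, \<open>b'\<close>, the right side exhibits superlevel
  sets of a sum as open.\<close>

lemma ennreal_less_add_iff:
  fixes a u v :: ennreal
  shows "a < u + v \<longleftrightarrow> a < u \<or> a < v \<or> (\<exists>b b'. b < u \<and> b' < v \<and> a < b + b')"
proof
  assume a: "a < u + v"
  show "a < u \<or> a < v \<or> (\<exists>b b'. b < u \<and> b' < v \<and> a < b + b')"
  proof (rule ccontr)
    assume neg: "\<not> ?thesis"
    then have au: "u \<le> a" "v \<le> a" and none: "\<And>b b'. b < u \<Longrightarrow> b' < v \<Longrightarrow> b + b' \<le> a"
      by (meson not_less)+
    have atop: "a < \<top>" using a by (metis less_top order_less_le_trans top_greatest)
    obtain z where z: "a = ennreal z" "0 \<le> z" using atop by (cases a) auto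
    obtain x where x: "u = ennreal x" "0 \<le> x" using au z by (cases u) (auto simp: top_unique)
    obtain y where y: "v = ennreal y" "0 \<le> y" using au z by (cases v) (auto simp: top_unique)
    have "x \<le> z" "y \<le> z" using au x y z by auto
    moreover have "z < x + y" using a x y z by (simp add: ennreal_less_iff flip: ennreal_plus)
    ultimately have xy: "0 < x" "0 < y" by auto
    \<comment> \<open>Lowering both summands by \<open>e\<close> keeps them positive and, since
      \<open>3 * e\<close> is at most the excess \<open>x + y - z\<close>, leaves their sum above
      \<open>z\<close>.\<close>
    define e where "e = min (min (x / 2) (y / 2)) ((x + y - z) / 3)"
    have e: "0 < e" "e \<le> x / 2" "e \<le> y / 2" "3 * e \<le> x + y - z"
      using xy \<open>z < x + y\<close> by (auto simp: e_def min_def)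
    have "ennreal (x - e) + ennreal (y - e) \<le> a"
      using e xy by (intro none) (auto simp: x y ennreal_less_iff)
    then have "x - e + (y - e) \<le> z" using e xy z by (simp flip: ennreal_plus)
    with e show False by auto
  qed
next
  have le: "u \<le> u + v" "v \<le> u + v" by (simp_all add: add_increasing add_increasing2)
  assume "a < u \<or> a < v \<or> (\<exists>b b'. b < u \<and> b' < v \<and> a < b + b')"
  then show "a < u + v"
  proof (elim disjE exE conjE)
    fix b b' assume "b < u" "b' < v" "a < b + b'"
    then show "a < u + v" by (meson add_mono less_imp_le order_less_le_trans)
  qed (use le in \<open>auto intro: order_less_le_trans\<close>)
qed

lemma lsc_on_add:
  assumes u: "lsc_on T u" and v: "lsc_on T v"
  shows "lsc_on T (\<lambda>x. u x + v x)"
  unfolding lsc_on_def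
proof
  fix a
  let ?L = "\<lambda>w a. {x \<in> topspace T. a < w x}"
  have "{x \<in> topspace T. a < u x + v x} = ?L u a \<union> ?L v a \<union> (\<Union>(b, b')\<in>{(b, b'). a < b + b'}. ?L u b \<inter> ?L v b')"
    by (subst ennreal_less_add_iff) blast
  also have "openin T \<dots>"
    using u v by (intro openin_Un openin_Union) (auto simp: lsc_on_def)
  finally show "openin T {x \<in> topspace T. a < u x + v x}" .
qed

lemma lsc_on_sum:
  assumes "finite I" "\<And>i. i \<in> I \<Longrightarrow> lsc_on T (u i)"
  shows "lsc_on T (\<lambda>x. \<Sum>i\<in>I. u i x)"
  using assms
proof induction
  case empty
  show ?case by (simp add: lsc_on_def)
next
  case (insert i I)
  then show ?case using lsc_on_add[of T "u i" "\<lambda>x. \<Sum>i\<in>I. u i x"] by simp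
qed

lemma lsc_on_compose:
  assumes u: "lsc_on S u" and f: "continuous_map T S f"
  shows "lsc_on T (\<lambda>x. u (f x))"
  unfolding lsc_on_def
proof
  fix a
  have "openin T {x \<in> topspace T. f x \<in> {y \<in> topspace S. a < u y}}"
    using u by (intro openin_continuous_map_preimage[OF f]) (simp add: lsc_on_def)
  also have "{x \<in> topspace T. f x \<in> {y \<in> topspace S. a < u y}} = {x \<in> topspace T. a < u (f x)}"
    using continuous_map_image_subset_topspace[OF f] by auto
  finally show "openin T {x \<in> topspace T. a < u (f x)}" .
qed

lemma cost_function_lsc: "cost_function T c \<Longrightarrow> lsc_on (prod_topology T T) (\<lambda>p. c (fst p) (snd p))"
  by (simp add: cost_function_def lsc_on_def)

lemma lsc_on_sum_cost:
  assumes c: "\<And>i. i \<in> {1..k} \<Longrightarrow> cost_function (T i) (c i)"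
  shows "lsc_on (prod_topology (product_topology T {1..k}) (product_topology T {1..k})) (\<lambda>p. sum_cost k c (fst p) (snd p))"
  unfolding sum_cost_def
proof (rule lsc_on_sum)
  fix i assume i: "i \<in> {1..k}"
  let ?T = "product_topology T {1..k}"
  have "continuous_map (prod_topology ?T ?T) (prod_topology (T i) (T i)) (\<lambda>p. (fst p i, snd p i))"
    using continuous_map_product_projection[OF i, of T]
    by (intro continuous_map_pairedI continuous_map_compose[unfolded o_def, OF continuous_map_fst]
          continuous_map_compose[unfolded o_def, OF continuous_map_snd])
  from lsc_on_compose[OF cost_function_lsc[OF c[OF i]] this]
  show "lsc_on (prod_topology ?T ?T) (\<lambda>p. c i (fst p i) (snd p i))" by simp
qed simp

lemma transport_cost_le:
  assumes "\<pi> \<in> couplings T \<nu> \<mu>" "(\<integral>\<^sup>+p. c (fst p) (snd p) \<partial>\<pi>) \<le> b"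
  shows "transport_cost T c \<nu> \<mu> \<le> b"
  using assms unfolding transport_cost_def by (meson INF_lower order_trans)

lemma transport_cost_approx:
  assumes "transport_cost T c \<nu> \<mu> < \<infinity>" "0 < (\<delta>::real)"
  shows "\<exists>\<pi>\<in>couplings T \<nu> \<mu>. (\<integral>\<^sup>+p. c (fst p) (snd p) \<partial>\<pi>) \<le> transport_cost T c \<nu> \<mu> + ennreal \<delta>"
proof -
  have "transport_cost T c \<nu> \<mu> < transport_cost T c \<nu> \<mu> + ennreal \<delta>"
    using assms by simp
  then show ?thesis unfolding transport_cost_def by (auto simp: INF_less_iff intro: less_imp_le)
qed

section \<open>One step of the Marton coupling\<close>

lemma M1_D:
  assumes "\<nu> \<in> M1 T"
  shows "prob_space \<nu>" "sets \<nu> = sets (borel_of T)" "space \<nu> = topspace T"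
  using assms sets_eq_imp_space_eq[of \<nu> "borel_of T"] by (auto simp: M1_def)

text \<open>Passage from \<open>borel_of\<close> to the sets of a given measure \<open>N\<close>, in
  practice \<open>\<mu> i\<close> or a product measure, for which the measure-theoretic
  constructions are stated.\<close>

lemma couplings_D:
  assumes T: "second_countable T" and N: "sets N = sets (borel_of T)" and \<pi>: "\<pi> \<in> couplings T \<nu> \<mu>"
  shows "prob_space \<pi>" "sets \<pi> = sets (N \<Otimes>\<^sub>M N)" "distr \<pi> N fst = \<nu>" "distr \<pi> N snd = \<mu>"
proof -
  have \<pi>': "prob_space \<pi>" "sets \<pi> = sets (borel_of (prod_topology T T))"
      "distr \<pi> (borel_of T) fst = \<nu>" "distr \<pi> (borel_of T) snd = \<mu>"
    using \<pi> by (auto simp: couplings_def M1_def)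
  show "prob_space \<pi>" by (rule \<pi>')
  show "sets \<pi> = sets (N \<Otimes>\<^sub>M N)"
    unfolding \<pi>'(2) sets_borel_of_prod_topology[OF T T] by (intro sets_pair_measure_cong N[symmetric])
  show "distr \<pi> N fst = \<nu>" "distr \<pi> N snd = \<mu>"
    using \<pi>'(3,4) distr_cong[OF refl N, of \<pi> fst fst] distr_cong[OF refl N, of \<pi> snd snd] by simp_all
qed

text \<open>The coupling attached to label 0: with density 1 and vanishing cost on the diagonal, bad
  points are transported for free.\<close>

lemma diagonal_coupling:
  assumes "prob_space \<mu>" and c: "\<And>x. x \<in> space \<mu> \<Longrightarrow> c x x = (0::ennreal)"
    and [measurable]: "(\<lambda>p. c (fst p) (snd p)) \<in> borel_measurable (\<mu> \<Otimes>\<^sub>M \<mu>)"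
  shows "\<exists>\<pi>. prob_space \<pi> \<and> sets \<pi> = sets (\<mu> \<Otimes>\<^sub>M \<mu>) \<and> distr \<pi> \<mu> fst = \<mu> \<and> distr \<pi> \<mu> snd = \<mu> \<and>
    (\<integral>\<^sup>+p. c (fst p) (snd p) \<partial>\<pi>) = 0"
proof (intro exI[of _ "distr \<mu> (\<mu> \<Otimes>\<^sub>M \<mu>) (\<lambda>x. (x, x))"] conjI)
  interpret prob_space \<mu> by fact
  show "prob_space (distr \<mu> (\<mu> \<Otimes>\<^sub>M \<mu>) (\<lambda>x. (x, x)))" by (rule prob_space_distr) measurable
  show "distr (distr \<mu> (\<mu> \<Otimes>\<^sub>M \<mu>) (\<lambda>x. (x, x))) \<mu> fst = \<mu>" "distr (distr \<mu> (\<mu> \<Otimes>\<^sub>M \<mu>) (\<lambda>x. (x, x))) \<mu> snd = \<mu>"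
    by (subst distr_distr; simp add: o_def distr_id2)+
  have "(\<integral>\<^sup>+p. c (fst p) (snd p) \<partial>distr \<mu> (\<mu> \<Otimes>\<^sub>M \<mu>) (\<lambda>x. (x, x))) = (\<integral>\<^sup>+x. c x x \<partial>\<mu>)"
    by (subst nn_integral_distr) auto
  also have "\<dots> = (\<integral>\<^sup>+x. 0 \<partial>\<mu>)" using c by (rule nn_integral_cong)
  finally show "(\<integral>\<^sup>+p. c (fst p) (snd p) \<partial>distr \<mu> (\<mu> \<Otimes>\<^sub>M \<mu>) (\<lambda>x. (x, x))) = 0" by simp
qed simp

lemma lsc_on_borel_measurable:
  assumes "lsc_on T f" "sets N = sets (borel_of T)"
  shows "f \<in> borel_measurable N"
proof -
  have "f \<in> borel_measurable (borel_of T)"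
    by (rule borel_measurableI_greater) (use assms(1) in \<open>auto simp: lsc_on_def intro!: openin_borel_of\<close>)
  then show ?thesis using assms(2) by (simp cong: measurable_cong_sets)
qed

text \<open>The bound does not depend on \<open>A\<close>, so L1-closeness of densities becomes the
  uniform marginal error that \<open>coupling_limit\<close> asks for.\<close>

lemma nn_integral_weight_close:
  fixes f h :: "'a \<Rightarrow> real"
  assumes [measurable]: "f \<in> borel_measurable M" "h \<in> borel_measurable M" "A \<in> sets M"
    and f0: "\<And>z. 0 \<le> f z" and h0: "\<And>z. 0 \<le> h z"
    and e: "(\<integral>\<^sup>+z. ennreal \<bar>f z - h z\<bar> \<partial>M) \<le> ennreal e" "0 \<le> e"
    and a: "(\<integral>\<^sup>+z. indicator A z * ennreal (f z) \<partial>M) = ennreal a" "0 \<le> a"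
    and b: "(\<integral>\<^sup>+z. indicator A z * ennreal (h z) \<partial>M) = ennreal b" "0 \<le> b"
  shows "\<bar>b - a\<bar> \<le> e"
proof -
  have *: "(\<integral>\<^sup>+z. indicator A z * ennreal (u z) \<partial>M) \<le> (\<integral>\<^sup>+z. indicator A z * ennreal (v z) \<partial>M) + ennreal e"
    if [measurable]: "u \<in> borel_measurable M" "v \<in> borel_measurable M" and "\<And>z. 0 \<le> v z"
      and "\<And>z. \<bar>u z - v z\<bar> = \<bar>f z - h z\<bar>" for u v
  proof -
    have "(\<integral>\<^sup>+z. indicator A z * ennreal (u z) \<partial>M) \<le> (\<integral>\<^sup>+z. indicator A z * ennreal (v z) + ennreal \<bar>f z - h z\<bar> \<partial>M)"
      using that(3) by (intro nn_integral_mono)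
        (auto simp: indicator_def that(4)[symmetric] simp flip: ennreal_plus intro!: ennreal_leI)
    also have "\<dots> = (\<integral>\<^sup>+z. indicator A z * ennreal (v z) \<partial>M) + (\<integral>\<^sup>+z. ennreal \<bar>f z - h z\<bar> \<partial>M)"
      by (rule nn_integral_add) measurable
    finally show ?thesis using e(1) by (meson add_left_mono order_trans)
  qed
  have "ennreal a \<le> ennreal b + ennreal e" "ennreal b \<le> ennreal a + ennreal e"
    using *[of f h] *[of h f] f0 h0 unfolding a b by (auto simp: abs_minus_commute)
  then have "a \<le> b + e" "b \<le> a + e" using a b e by (simp_all flip: ennreal_plus)
  then show ?thesis by simp
qed

text \<open>In the application \<open>P\<close> carries the law of the coordinates other than
  \<open>i\<close>, \<open>\<xi>\<close> keeps those already coupled, \<open>f\<close> is the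
  conditional density of the new coordinate and \<open>J\<close> its information. In
  \<open>2 * \<delta>\<close>, one \<open>\<delta>\<close> pays for a near-optimal
  \<open>\<Gamma>\<close> and one for near-optimal couplings of the representatives. Their mean cost
  \<open>\<rho>\<close> varies with the marginal error \<open>e\<close>; the supremum over all
  admissible \<open>\<rho>\<close> makes the bound independent of \<open>e\<close>.\<close>

lemma transport_step_approx:
  fixes \<mu> :: "nat \<Rightarrow> 'a measure" and T :: "nat \<Rightarrow> 'a topology" and f :: "'b \<times> 'a \<Rightarrow> real"
    and cI c' :: "(nat \<Rightarrow> 'a) \<Rightarrow> (nat \<Rightarrow> 'a) \<Rightarrow> ennreal" and J :: "'b \<Rightarrow> ennreal"
  assumes I: "finite I" "i \<notin> I" and \<mu>: "\<And>j. prob_space (\<mu> j)"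
    and T: "\<And>j. j \<in> insert i I \<Longrightarrow> polish_space (T j)"
    and \<mu>s: "\<And>j. j \<in> insert i I \<Longrightarrow> sets (\<mu> j) = sets (borel_of (T j))"
    and P: "prob_space P" and \<xi> [measurable]: "\<xi> \<in> P \<rightarrow>\<^sub>M PiM I \<mu>"
    and f [measurable]: "f \<in> borel_measurable (P \<Otimes>\<^sub>M \<mu> i)" and f0: "\<And>z. 0 \<le> f z"
    and good: "AE x in P. x \<in> G" "\<And>x. x \<in> G \<Longrightarrow> x \<in> space P \<and> (\<integral>\<^sup>+y. ennreal (f (x, y)) \<partial>\<mu> i) = 1"
    and \<nu>': "\<nu>' \<in> M1 (product_topology T (insert i I))"
      "\<And>A. A \<in> sets (PiM (insert i I) \<mu>) \<Longrightarrow>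
         emeasure \<nu>' A = (\<integral>\<^sup>+\<omega>. (\<integral>\<^sup>+y. indicator A ((\<xi> \<omega>)(i := y)) * ennreal (f (\<omega>, y)) \<partial>\<mu> i) \<partial>P)"
    and cI: "lsc_on (prod_topology (product_topology T I) (product_topology T I)) (\<lambda>p. cI (fst p) (snd p))"
    and ci: "cost_function (T i) ci"
    and c': "lsc_on (prod_topology (product_topology T (insert i I)) (product_topology T (insert i I))) (\<lambda>p. c' (fst p) (snd p))"
      "\<And>x y u v. x \<in> space (PiM I \<mu>) \<Longrightarrow> y \<in> space (PiM I \<mu>) \<Longrightarrow> c' (x(i := u)) (y(i := v)) = cI x y + ci u v"
    and \<alpha>: "rate_function \<alpha>" "Lim at_top \<alpha> = \<infinity>"
    and TI: "\<And>x. x \<in> G \<Longrightarrow> extend_infinity \<alpha> (transport_cost (T i) ci (density (\<mu> i) (\<lambda>y. ennreal (f (x, y)))) (\<mu> i)) \<le> J x"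
    and J: "\<And>x. x \<in> G \<Longrightarrow> J x < \<infinity>" "(\<integral>\<^sup>+x. J x \<partial>P) \<le> j"
    and C: "transport_cost (product_topology T I) cI (distr P (PiM I \<mu>) \<xi>) (PiM I \<mu>) = C" "C < \<infinity>"
    and \<delta>: "0 < \<delta>"
  shows "transport_cost (product_topology T (insert i I)) c' \<nu>' (PiM (insert i I) \<mu>) \<le>
    C + ennreal (2 * \<delta>) + (SUP \<rho>\<in>{\<rho>. 0 \<le> \<rho> \<and> \<alpha> \<rho> \<le> j + ennreal \<delta>}. ennreal \<rho>)"
    (is "_ \<le> ?b")
proof -
  let ?I = "PiM I \<mu>" and ?N = "PiM (insert i I) \<mu>"
  let ?TI = "product_topology T I" and ?TN = "product_topology T (insert i I)"
  interpret P: prob_space P by fact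
  interpret mi: prob_space "\<mu> i" by (rule \<mu>)
  have fin: "finite (insert i I)" using I by simp
  have sc: "second_countable (T j)" if "j \<in> insert i I" for j using T[OF that] by (simp add: polish_space_def)
  have setsI: "sets ?I = sets (borel_of ?TI)"
    using I \<mu>s sc by (intro sets_borel_of_product_topology[symmetric]) auto
  have setsN: "sets ?N = sets (borel_of ?TN)"
    using fin \<mu>s sc by (intro sets_borel_of_product_topology[symmetric]) auto
  have polI: "polish_space ?TI" and polN: "polish_space ?TN"
    using I T by (auto intro!: polish_space_product_topology)
  have scI: "second_countable ?TI" and scN: "second_countable ?TN" using polI polN by (auto simp: polish_space_def)
  have setsTN: "sets (?N \<Otimes>\<^sub>M ?N) = sets (borel_of (prod_topology ?TN ?TN))"
    unfolding sets_borel_of_prod_topology[OF scN scN] by (intro sets_pair_measure_cong setsN)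
  have setsTI: "sets (?I \<Otimes>\<^sub>M ?I) = sets (borel_of (prod_topology ?TI ?TI))"
    unfolding sets_borel_of_prod_topology[OF scI scI] by (intro sets_pair_measure_cong setsI)
  have setsTi: "sets (\<mu> i \<Otimes>\<^sub>M \<mu> i) = sets (borel_of (prod_topology (T i) (T i)))"
    unfolding sets_borel_of_prod_topology[OF sc[OF insertI1] sc[OF insertI1]]
    by (intro sets_pair_measure_cong \<mu>s insertI1)
  have spN: "space ?N = topspace ?TN" using sets_eq_imp_space_eq[OF setsN] by simp
  have cim [measurable]: "(\<lambda>p. ci (fst p) (snd p)) \<in> borel_measurable (\<mu> i \<Otimes>\<^sub>M \<mu> i)"
    by (rule lsc_on_borel_measurable[OF cost_function_lsc[OF ci] setsTi])
  have cIm [measurable]: "(\<lambda>p. cI (fst p) (snd p)) \<in> borel_measurable (?I \<Otimes>\<^sub>M ?I)"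
    by (rule lsc_on_borel_measurable[OF cI setsTI])
  have cm [measurable]: "(\<lambda>p. c' (fst p) (snd p)) \<in> borel_measurable (?N \<Otimes>\<^sub>M ?N)"
    by (rule lsc_on_borel_measurable[OF c'(1) setsTN])
  have \<mu>N: "prob_space ?N" by (rule prob_space_PiM) (rule \<mu>)
  interpret mN: prob_space ?N by (rule \<mu>N)
  have \<nu>s: "prob_space \<nu>'" "sets \<nu>' = sets ?N" using M1_D[OF \<nu>'(1)] setsN by auto
  interpret n: prob_space \<nu>' by (rule \<nu>s)
  have "\<exists>\<pi>\<in>couplings ?TN \<nu>' ?N. (\<integral>\<^sup>+p. c' (fst p) (snd p) \<partial>\<pi>) \<le> ?b"
  proof (rule coupling_limit[OF polN _ \<nu>'(1)])
    show "openin (prod_topology ?TN ?TN) {z \<in> topspace (prod_topology ?TN ?TN). a < c' (fst z) (snd z)}" for a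
      using c'(1) by (simp add: lsc_on_def)
    show "?N \<in> M1 ?TN" using \<mu>N setsN by (simp add: M1_def)
    fix e :: real assume e: "0 < e"
    obtain \<Gamma> where \<Gamma>: "\<Gamma> \<in> couplings ?TI (distr P ?I \<xi>) ?I" "(\<integral>\<^sup>+p. cI (fst p) (snd p) \<partial>\<Gamma>) \<le> C + ennreal \<delta>"
      using transport_cost_approx[of ?TI cI "distr P ?I \<xi>" ?I \<delta>] C \<delta> by auto
    note \<Gamma>' = couplings_D[OF scI setsI \<Gamma>(1)]
    have "\<exists>(\<kappa> :: 'b \<Rightarrow> nat) K r. \<kappa> \<in> P \<rightarrow>\<^sub>M count_space UNIV \<and> (\<forall>x. \<kappa> x \<le> K) \<and> (\<forall>k. r k \<in> G) \<and>
      (\<integral>\<^sup>+z. ennreal \<bar>f z - (if \<kappa> (fst z) = 0 then 1 else f (r (\<kappa> (fst z)), snd z))\<bar> \<partial>(P \<Otimes>\<^sub>M \<mu> i)) \<le> ennreal e \<and>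
      (\<Sum>k\<in>{1..K}. emeasure P (\<kappa> -` {k} \<inter> space P) * J (r k)) \<le> j + ennreal \<delta>"
      (is "\<exists>\<kappa> K r. ?Q \<kappa> K r") by (rule representative_selection[OF P \<mu>[of i] f f0 good(1) _ J(2) \<delta> e]) (rule good(2))
    then obtain \<kappa> :: "'b \<Rightarrow> nat" and K r where sel: "?Q \<kappa> K r"
      by (elim exE)
    then have \<kappa> [measurable]: "\<kappa> \<in> P \<rightarrow>\<^sub>M count_space UNIV" and K: "\<And>x. \<kappa> x \<le> K" and r: "\<And>k. r k \<in> G"
      and close: "(\<integral>\<^sup>+z. ennreal \<bar>f z - (if \<kappa> (fst z) = 0 then 1 else f (r (\<kappa> (fst z)), snd z))\<bar> \<partial>(P \<Otimes>\<^sub>M \<mu> i)) \<le> ennreal e"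
      and Jsum: "(\<Sum>k\<in>{1..K}. emeasure P (\<kappa> -` {k} \<inter> space P) * J (r k)) \<le> j + ennreal \<delta>"
      by simp_all
    define h where "h k y = (if k = 0 then 1 else f (r k, y))" for k y
    have hm [measurable]: "h k \<in> borel_measurable (\<mu> i)" for k
    proof -
      have [simp]: "r k \<in> space P" using good(2) r by blast
      show ?thesis unfolding h_def by (cases "k = 0") auto
    qed
    define \<eta> where "\<eta> k = density (\<mu> i) (\<lambda>y. ennreal (h k y))" for k
    define t where "t k = enn2real (transport_cost (T i) ci (\<eta> k) (\<mu> i))" for k
    have t: "transport_cost (T i) ci (\<eta> k) (\<mu> i) = ennreal (t k)" "\<alpha> (t k) \<le> J (r k)" if k: "k \<noteq> 0" for k
    proof -
      have le: "extend_infinity \<alpha> (transport_cost (T i) ci (\<eta> k) (\<mu> i)) \<le> J (r k)"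
        using TI[OF r[of k]] k by (simp add: \<eta>_def h_def)
      \<comment> \<open>An infinite cost would make the left side infinite, since
        \<open>\<alpha>\<close> tends to infinity, whereas \<open>J (r k)\<close> is finite. So
        \<open>t k\<close> is the true cost and not a default value.\<close>
      with J(1)[OF r[of k]] \<alpha>(2) have ne: "transport_cost (T i) ci (\<eta> k) (\<mu> i) \<noteq> \<infinity>"
        by (auto simp: extend_infinity_def)
      then show "transport_cost (T i) ci (\<eta> k) (\<mu> i) = ennreal (t k)" by (simp add: t_def less_top)
      show "\<alpha> (t k) \<le> J (r k)" using le ne by (simp add: extend_infinity_def t_def)
    qed
    have "\<exists>\<pi>. prob_space \<pi> \<and> sets \<pi> = sets (\<mu> i \<Otimes>\<^sub>M \<mu> i) \<and> distr \<pi> (\<mu> i) fst = \<eta> k \<and> distr \<pi> (\<mu> i) snd = \<mu> i \<and>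
       (\<integral>\<^sup>+p. ci (fst p) (snd p) \<partial>\<pi>) \<le> (if k = 0 then 0 else ennreal (t k) + ennreal \<delta>)"
      (is "\<exists>\<pi>. ?Q k \<pi>") for k
    proof (cases "k = 0")
      case True
      have "\<eta> k = \<mu> i" using True by (simp add: \<eta>_def h_def density_1)
      moreover have "ci x x = 0" if "x \<in> space (\<mu> i)" for x
        using ci that sets_eq_imp_space_eq[OF \<mu>s[of i]] by (simp add: cost_function_def)
      ultimately show ?thesis using True diagonal_coupling[OF \<mu>[of i] _ cim] by simp
    next
      case False
      have "transport_cost (T i) ci (\<eta> k) (\<mu> i) < \<infinity>" using t(1)[OF False] by simp
      from transport_cost_approx[OF this \<delta>] obtain \<pi> where \<pi>: "\<pi> \<in> couplings (T i) (\<eta> k) (\<mu> i)"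
        "(\<integral>\<^sup>+p. ci (fst p) (snd p) \<partial>\<pi>) \<le> ennreal (t k) + ennreal \<delta>" unfolding t(1)[OF False] by blast
      from couplings_D[OF sc[OF insertI1] \<mu>s[OF insertI1] \<pi>(1)] \<pi>(2) False
      show ?thesis by (intro exI[of _ \<pi>]) simp
    qed
    then have "\<exists>\<pi>. \<forall>k. ?Q k (\<pi> k)" by (intro choice allI)
    then obtain \<pi> where "\<forall>k. ?Q k (\<pi> k)" by (elim exE)
    then have \<pi>: "\<And>k. prob_space (\<pi> k)" "\<And>k. sets (\<pi> k) = sets (\<mu> i \<Otimes>\<^sub>M \<mu> i)" "\<And>k. distr (\<pi> k) (\<mu> i) snd = \<mu> i"
        "\<And>k. distr (\<pi> k) (\<mu> i) fst = \<eta> k"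
        "\<And>k. (\<integral>\<^sup>+p. ci (fst p) (snd p) \<partial>\<pi> k) \<le> (if k = 0 then 0 else ennreal (t k) + ennreal \<delta>)"
      by simp_all
    have "\<exists>\<Lambda>. prob_space \<Lambda> \<and> sets \<Lambda> = sets (?N \<Otimes>\<^sub>M ?N) \<and>
      (\<forall>A\<in>sets ?N. emeasure \<Lambda> (A \<times> space ?N) =
         (\<integral>\<^sup>+\<omega>. (\<integral>\<^sup>+y. indicator A ((\<xi> \<omega>)(i := y)) \<partial>distr (\<pi> (\<kappa> \<omega>)) (\<mu> i) fst) \<partial>P)) \<and>
      (\<forall>B\<in>sets ?N. emeasure \<Lambda> (space ?N \<times> B) = emeasure ?N B) \<and>
      (\<integral>\<^sup>+z. c' (fst z) (snd z) \<partial>\<Lambda>) = (\<integral>\<^sup>+z. cI (fst z) (snd z) \<partial>\<Gamma>) +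
         (\<Sum>k\<le>K. emeasure P (\<kappa> -` {k} \<inter> space P) * (\<integral>\<^sup>+w. ci (fst w) (snd w) \<partial>\<pi> k))"
      (is "\<exists>\<Lambda>. ?R \<Lambda>") by (rule glued_coupling[OF I \<mu> \<Gamma>' P \<xi> \<kappa> K \<pi>(1-3) cIm cim cm]) (simp add: c'(2))
    then obtain \<Lambda> where \<Lambda>: "?R \<Lambda>"
      by (elim exE)
    note L1 = \<Lambda>[THEN conjunct1] and L2 = \<Lambda>[THEN conjunct2, THEN conjunct1]
      and L3 = \<Lambda>[THEN conjunct2, THEN conjunct2, THEN conjunct1]
      and L4 = \<Lambda>[THEN conjunct2, THEN conjunct2, THEN conjunct2, THEN conjunct1]
      and L5 = \<Lambda>[THEN conjunct2, THEN conjunct2, THEN conjunct2, THEN conjunct2]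
    interpret L: prob_space \<Lambda> by (rule L1)
    have updm: "(\<lambda>z. (\<xi> (fst z))(i := snd z)) \<in> P \<Otimes>\<^sub>M \<mu> i \<rightarrow>\<^sub>M ?N"
      by (intro measurable_fun_upd[where J=I]) auto
    have hm2 [measurable]: "(\<lambda>z. h (\<kappa> (fst z)) (snd z)) \<in> borel_measurable (P \<Otimes>\<^sub>M \<mu> i)"
      by measurable
    have cl: "\<bar>measure \<Lambda> (A \<times> space ?N) - measure \<nu>' A\<bar> \<le> e" if A: "A \<in> sets ?N" for A
    proof -
      define A' where "A' = (\<lambda>z. (\<xi> (fst z))(i := snd z)) -` A \<inter> space (P \<Otimes>\<^sub>M \<mu> i)"
      have A'm [measurable]: "A' \<in> sets (P \<Otimes>\<^sub>M \<mu> i)" unfolding A'_def by (rule measurable_sets[OF updm A])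
      have ind: "indicator A ((\<xi> \<omega>)(i := y)) = (indicator A' (\<omega>, y) :: ennreal)"
        if "\<omega> \<in> space P" "y \<in> space (\<mu> i)" for \<omega> y
        using that by (auto simp: A'_def indicator_def space_pair_measure)
      have a: "(\<integral>\<^sup>+z. indicator A' z * ennreal (f z) \<partial>(P \<Otimes>\<^sub>M \<mu> i)) = ennreal (measure \<nu>' A)"
      proof -
        have "ennreal (measure \<nu>' A) = (\<integral>\<^sup>+\<omega>. (\<integral>\<^sup>+y. indicator A ((\<xi> \<omega>)(i := y)) * ennreal (f (\<omega>, y)) \<partial>\<mu> i) \<partial>P)"
          using \<nu>'(2)[OF A] by (simp add: n.emeasure_eq_measure)
        also have "\<dots> = (\<integral>\<^sup>+\<omega>. (\<integral>\<^sup>+y. indicator A' (\<omega>, y) * ennreal (f (\<omega>, y)) \<partial>\<mu> i) \<partial>P)"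
          by (intro nn_integral_cong) (simp add: ind)
        also have "\<dots> = (\<integral>\<^sup>+z. indicator A' z * ennreal (f z) \<partial>(P \<Otimes>\<^sub>M \<mu> i))"
          by (rule mi.nn_integral_fst) measurable
        finally show ?thesis ..
      qed
      have b: "(\<integral>\<^sup>+z. indicator A' z * ennreal (h (\<kappa> (fst z)) (snd z)) \<partial>(P \<Otimes>\<^sub>M \<mu> i)) = ennreal (measure \<Lambda> (A \<times> space ?N))"
      proof -
        have "ennreal (measure \<Lambda> (A \<times> space ?N)) = (\<integral>\<^sup>+\<omega>. (\<integral>\<^sup>+y. indicator A ((\<xi> \<omega>)(i := y)) \<partial>\<eta> (\<kappa> \<omega>)) \<partial>P)"
          using L3[rule_format, OF A] by (simp add: L.emeasure_eq_measure \<pi>(4))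
        also have "\<dots> = (\<integral>\<^sup>+\<omega>. (\<integral>\<^sup>+y. indicator A' (\<omega>, y) * ennreal (h (\<kappa> \<omega>) y) \<partial>\<mu> i) \<partial>P)"
        proof (rule nn_integral_cong)
          fix \<omega> assume w: "\<omega> \<in> space P"
          then have upd: "(\<lambda>y. (\<xi> \<omega>)(i := y)) \<in> \<mu> i \<rightarrow>\<^sub>M ?N"
            by (intro measurable_fun_upd[where J=I]) (auto intro: measurable_space[OF \<xi>])
          have [measurable]: "(\<lambda>y. indicator A ((\<xi> \<omega>)(i := y)) :: ennreal) \<in> borel_measurable (\<mu> i)"
            by (rule measurable_compose[OF upd borel_measurable_indicator[OF A]])
          have "(\<integral>\<^sup>+y. indicator A ((\<xi> \<omega>)(i := y)) \<partial>\<eta> (\<kappa> \<omega>)) =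
              (\<integral>\<^sup>+y. ennreal (h (\<kappa> \<omega>) y) * indicator A ((\<xi> \<omega>)(i := y)) \<partial>\<mu> i)"
            unfolding \<eta>_def by (rule nn_integral_density) measurable
          also have "\<dots> = (\<integral>\<^sup>+y. indicator A' (\<omega>, y) * ennreal (h (\<kappa> \<omega>) y) \<partial>\<mu> i)"
            using w by (intro nn_integral_cong) (simp add: ind mult.commute)
          finally show "(\<integral>\<^sup>+y. indicator A ((\<xi> \<omega>)(i := y)) \<partial>\<eta> (\<kappa> \<omega>)) = (\<integral>\<^sup>+y. indicator A' (\<omega>, y) * ennreal (h (\<kappa> \<omega>) y) \<partial>\<mu> i)" .
        qed
        also have "\<dots> = (\<integral>\<^sup>+z. indicator A' z * ennreal (h (\<kappa> (fst z)) (snd z)) \<partial>(P \<Otimes>\<^sub>M \<mu> i))"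
          by (subst mi.nn_integral_fst[symmetric]) auto
        finally show ?thesis ..
      qed
      show ?thesis
      proof (rule nn_integral_weight_close[OF f hm2 A'm f0 _ _ _ a _ b])
        show "(\<integral>\<^sup>+z. ennreal \<bar>f z - h (\<kappa> (fst z)) (snd z)\<bar> \<partial>(P \<Otimes>\<^sub>M \<mu> i)) \<le> ennreal e"
          using close unfolding h_def .
      qed (use e f0 in \<open>auto simp: h_def\<close>)
    qed
    define p where "p k = measure P (\<kappa> -` {k} \<inter> space P)" for k
    have pe: "emeasure P (\<kappa> -` {k} \<inter> space P) = ennreal (p k)" "0 \<le> p k" for k
      by (simp_all add: p_def P.emeasure_eq_measure)
    \<comment> \<open>Label 0 is left out, as its mass moves at no cost; hence a total of at most 1,
      for which Jensen's inequality was prepared.\<close>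
    have psum: "(\<Sum>k\<in>{1..K}. p k) \<le> 1"
    proof -
      have "(\<Sum>k\<in>{1..K}. p k) = measure P (\<Union>k\<in>{1..K}. \<kappa> -` {k} \<inter> space P)"
        unfolding p_def using \<kappa> by (intro P.finite_measure_finite_Union[symmetric]) (auto simp: disjoint_family_on_def)
      also have "\<dots> \<le> 1" by (rule P.prob_le_1)
      finally show ?thesis .
    qed
    define \<rho> where "\<rho> = (\<Sum>k\<in>{1..K}. p k * t k)"
    have t0: "0 \<le> t k" for k by (simp add: t_def)
    have \<rho>0: "0 \<le> \<rho>" unfolding \<rho>_def using pe t0 by (intro sum_nonneg) auto
    have "\<alpha> \<rho> \<le> (\<Sum>k\<in>{1..K}. ennreal (p k) * \<alpha> (t k))"
      unfolding \<rho>_def using pe(2) t0 psum by (intro rate_function_Jensen[OF \<alpha>(1)]) auto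
    also have "\<dots> \<le> (\<Sum>k\<in>{1..K}. emeasure P (\<kappa> -` {k} \<inter> space P) * J (r k))"
      unfolding pe(1) by (intro sum_mono mult_left_mono t(2)) auto
    also note Jsum
    finally have \<alpha>\<rho>: "\<alpha> \<rho> \<le> j + ennreal \<delta>" .
    have "(\<integral>\<^sup>+z. c' (fst z) (snd z) \<partial>\<Lambda>) \<le> ?b"
    proof -
      have "(\<Sum>k\<le>K. emeasure P (\<kappa> -` {k} \<inter> space P) * (\<integral>\<^sup>+w. ci (fst w) (snd w) \<partial>\<pi> k)) \<le>
          (\<Sum>k\<le>K. if k = 0 then 0 else ennreal (p k * t k + p k * \<delta>))"
      proof (rule sum_mono)
        fix k
        have "ennreal (p k) * (\<integral>\<^sup>+w. ci (fst w) (snd w) \<partial>\<pi> k) \<le> ennreal (p k) * (if k = 0 then 0 else ennreal (t k) + ennreal \<delta>)"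
          by (intro mult_left_mono \<pi>) simp
        also have "\<dots> = (if k = 0 then 0 else ennreal (p k * t k + p k * \<delta>))"
          using \<delta> t0[of k] pe(2)[of k] by (simp add: distrib_left ennreal_mult)
        finally show "emeasure P (\<kappa> -` {k} \<inter> space P) * (\<integral>\<^sup>+w. ci (fst w) (snd w) \<partial>\<pi> k) \<le> (if k = 0 then 0 else ennreal (p k * t k + p k * \<delta>))"
          by (simp only: pe(1))
      qed
      also have "\<dots> = (\<Sum>k\<in>{1..K}. ennreal (p k * t k + p k * \<delta>))"
        by (rule sum.mono_neutral_cong_right) auto
      also have "\<dots> = ennreal (\<Sum>k\<in>{1..K}. p k * t k + p k * \<delta>)"
        using \<delta> t0 pe(2) by (intro sum_ennreal) auto
      also have "\<dots> \<le> ennreal (\<rho> + \<delta>)"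
      proof (rule ennreal_leI)
        have "(\<Sum>k\<in>{1..K}. p k) * \<delta> \<le> 1 * \<delta>" using psum \<delta> by (intro mult_right_mono) auto
        then show "(\<Sum>k\<in>{1..K}. p k * t k + p k * \<delta>) \<le> \<rho> + \<delta>"
          by (simp add: sum.distrib \<rho>_def sum_distrib_right)
      qed
      finally have "(\<integral>\<^sup>+z. c' (fst z) (snd z) \<partial>\<Lambda>) \<le> (C + ennreal \<delta>) + ennreal (\<rho> + \<delta>)"
        unfolding L5 using \<Gamma>(2) by (intro add_mono)
      also have "\<dots> = C + ennreal (2 * \<delta>) + ennreal \<rho>"
      proof -
        have "ennreal (2 * \<delta>) = ennreal \<delta> + ennreal \<delta>"
          using ennreal_plus[of \<delta> \<delta>] \<delta> by (simp only: mult_2)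
        then show ?thesis using \<delta> \<rho>0 by (simp only: ennreal_plus less_imp_le ac_simps)
      qed
      also have "\<dots> \<le> ?b"
        using \<rho>0 \<alpha>\<rho> by (intro add_left_mono SUP_upper) auto
      finally show ?thesis .
    qed
    then show "\<exists>\<pi>\<in>M1 (prod_topology ?TN ?TN).
        (\<forall>A\<in>sets (borel_of ?TN). \<bar>measure \<pi> (A \<times> topspace ?TN) - measure \<nu>' A\<bar> \<le> e) \<and>
        (\<forall>B\<in>sets (borel_of ?TN). measure \<pi> (topspace ?TN \<times> B) = measure ?N B) \<and> (\<integral>\<^sup>+p. c' (fst p) (snd p) \<partial>\<pi>) \<le> ?b"
      using L1 L2 L4 cl unfolding setsN[symmetric] spN[symmetric]
      by (intro bexI[of _ \<Lambda>]) (auto simp: M1_def setsTN measure_def)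
  qed
  then show ?thesis using transport_cost_le by blast
qed

section \<open>Tensorization\<close>

text \<open>The witness is \<open>r = S - C\<close>, except in the degenerate cases where \<open>C\<close> is infinite or \<open>\<alpha>\<close> vanishes
  identically.\<close>

lemma rate_function_limit:
  assumes \<alpha>: "rate_function \<alpha>"
    and step: "\<And>\<delta>. Lim at_top \<alpha> = \<infinity> \<Longrightarrow> C < \<infinity> \<Longrightarrow> 0 < \<delta> \<Longrightarrow>
      S \<le> C + ennreal (2 * \<delta>) + (SUP \<rho>\<in>{\<rho>. 0 \<le> \<rho> \<and> \<alpha> \<rho> \<le> j + ennreal \<delta>}. ennreal \<rho>)"
  shows "\<exists>r. S \<le> C + r \<and> extend_infinity \<alpha> r \<le> j"
proof (cases "C < \<infinity> \<and> Lim at_top \<alpha> = \<infinity>")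
  case False
  show ?thesis
  proof (cases "C < \<infinity>")
    case True
    with False have "Lim at_top \<alpha> \<noteq> \<infinity>" by simp
    then have "\<alpha> s = 0" if "0 \<le> s" for s using rate_function_Lim_at_top[OF \<alpha> that] by auto
    moreover have "mono_on {0..} \<alpha>" using \<alpha> by (simp add: rate_function_def)
    ultimately have "Lim at_top \<alpha> = 0" by (auto simp: Lim_at_top_mono intro!: antisym SUP_least)
    then show ?thesis by (intro exI[of _ \<infinity>]) (simp add: extend_infinity_def)
  next
    case False
    then have "C = \<infinity>" by (metis infinity_ennreal_def less_top)
    then show ?thesis using \<alpha> by (intro exI[of _ 0]) (auto simp: extend_infinity_def rate_function_def)
  qed
next
  case True
  define R where "R \<delta> = (SUP \<rho>\<in>{\<rho>. 0 \<le> \<rho> \<and> \<alpha> \<rho> \<le> j + ennreal \<delta>}. ennreal \<rho>)" for \<delta>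
  define r where "r = S - C"
  have r: "r \<le> ennreal (2 * \<delta>) + R \<delta>" if "0 < \<delta>" for \<delta>
    using step[OF _ _ that] True unfolding r_def R_def by (auto simp: ennreal_minus_le_iff add.assoc)
  have "S \<le> C + r"
    unfolding r_def using True by (cases "C \<le> S") (auto simp: add_diff_inverse_ennreal intro: add_increasing2)
  moreover have "extend_infinity \<alpha> r \<le> j"
  proof (rule extend_infinity_le[OF \<alpha>])
    fix s assume s: "0 \<le> s" "ennreal s < r"
    show "\<alpha> s \<le> j"
    proof (rule ennreal_le_epsilon)
      fix \<epsilon> :: real assume \<epsilon>: "0 < \<epsilon>"
      obtain u where u: "ennreal s < u" "u < r" using dense[OF s(2)] by blast
      then obtain s' where s': "u = ennreal s'" "0 \<le> s'" by (cases u) auto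
      have ss': "s < s'" using u(1) s s' by (simp add: ennreal_less_iff)
      \<comment> \<open>At most half the gap, so that \<open>2 * \<delta> + s \<le> s' < r \<le> 2 *
        \<delta> + R \<delta>\<close>. Cancelling gives \<open>s < R \<delta>\<close>, hence an
        admissible \<open>\<rho>\<close> above \<open>s\<close>.\<close>
      define \<delta> where "\<delta> = min \<epsilon> ((s' - s) / 2)"
      have \<delta>: "0 < \<delta>" "\<delta> \<le> \<epsilon>" "s + 2 * \<delta> \<le> s'" using \<epsilon> ss' by (auto simp: \<delta>_def min_def field_simps)
      have "ennreal (2 * \<delta>) + ennreal s = ennreal (2 * \<delta> + s)"
        using \<delta> s by (intro ennreal_plus[symmetric]) auto
      also have "\<dots> \<le> ennreal s'" using \<delta>(3) by (intro ennreal_leI) simp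
      also have "ennreal s' < r" using u s' by simp
      also have "\<dots> \<le> ennreal (2 * \<delta>) + R \<delta>" by (rule r) fact
      finally have "ennreal s < R \<delta>" by simp
      then obtain \<rho> where \<rho>: "0 \<le> \<rho>" "\<alpha> \<rho> \<le> j + ennreal \<delta>" "ennreal s < ennreal \<rho>"
        unfolding R_def by (auto simp: less_SUP_iff)
      then have "\<alpha> s \<le> \<alpha> \<rho>"
        using \<alpha> s by (intro monotone_onD[of "{0..}" "(\<le>)" "(\<le>)" \<alpha>]) (auto simp: rate_function_def ennreal_less_iff)
      also note \<rho>(2)
      also have "j + ennreal \<delta> \<le> j + ennreal \<epsilon>" using \<delta> by (intro add_left_mono ennreal_leI)
      finally show "\<alpha> s \<le> j + ennreal \<epsilon>" .
    qed
  qed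
  ultimately show ?thesis by blast
qed

text \<open>Start of the chain of marginals: over the empty index set the sum cost is an empty sum,
  and the product measure is a coupling.\<close>

lemma transport_cost_zero:
  assumes "polish_space T" "\<nu> \<in> M1 T" "\<mu> \<in> M1 T" "\<And>x y. c x y = 0"
  shows "transport_cost T c \<nu> \<mu> = 0"
proof -
  have sc: "second_countable T" using assms by (simp add: polish_space_def)
  note n = M1_D[OF assms(2)] and m = M1_D[OF assms(3)]
  interpret n: prob_space \<nu> by (rule n)
  interpret m: prob_space \<mu> by (rule m)
  interpret pair_prob_space \<nu> \<mu> ..
  have "sets (\<nu> \<Otimes>\<^sub>M \<mu>) = sets (borel_of (prod_topology T T))"
    unfolding sets_borel_of_prod_topology[OF sc sc] by (intro sets_pair_measure_cong n m)
  moreover have "distr (\<nu> \<Otimes>\<^sub>M \<mu>) (borel_of T) fst = \<nu>"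
    using m.distr_pair_fst[of \<nu>] distr_cong[OF refl n(2), of "\<nu> \<Otimes>\<^sub>M \<mu>" fst fst] by (simp add: m.emeasure_space_1)
  moreover have "distr (\<nu> \<Otimes>\<^sub>M \<mu>) (borel_of T) snd = \<mu>"
  proof (rule measure_eqI)
    have sm: "snd \<in> \<nu> \<Otimes>\<^sub>M \<mu> \<rightarrow>\<^sub>M borel_of T" using measurable_snd[of \<nu> \<mu>] m(2) by (simp cong: measurable_cong_sets)
    fix A assume "A \<in> sets (distr (\<nu> \<Otimes>\<^sub>M \<mu>) (borel_of T) snd)"
    then have A: "A \<in> sets \<mu>" "A \<in> sets (borel_of T)" by (simp_all add: m)
    have "snd -` A \<inter> space (\<nu> \<Otimes>\<^sub>M \<mu>) = space \<nu> \<times> A"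
      using sets.sets_into_space[OF A(1)] by (auto simp: space_pair_measure)
    then show "emeasure (distr (\<nu> \<Otimes>\<^sub>M \<mu>) (borel_of T) snd) A = emeasure \<mu> A"
      using A sm by (simp add: emeasure_distr m.emeasure_pair_measure_Times n.emeasure_space_1)
  qed (simp add: m)
  ultimately have "\<nu> \<Otimes>\<^sub>M \<mu> \<in> couplings T \<nu> \<mu>"
    using prob_space_axioms by (simp add: couplings_def M1_def)
  then have "transport_cost T c \<nu> \<mu> \<le> 0" by (rule transport_cost_le) (simp add: assms)
  then show ?thesis by simp
qed

declare One_nat_def [simp del]

section \<open>Marginals of a product density and the chain of transport costs\<close>

text \<open>\<open>prob\<close> ranges over all indices, also outside \<open>{1..n}\<close>, because
  \<open>product_sigma_finite\<close> asks for a total family of measures.\<close>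

locale product_density =
  fixes n :: nat and T :: "nat \<Rightarrow> 'a topology" and \<mu> :: "nat \<Rightarrow> 'a measure" and f :: "(nat \<Rightarrow> 'a) \<Rightarrow> real"
  assumes T: "\<And>i. i \<in> {1..n} \<Longrightarrow> polish_space (T i)"
    and prob: "\<And>i. prob_space (\<mu> i)"
    and sets_\<mu>: "\<And>i. i \<in> {1..n} \<Longrightarrow> sets (\<mu> i) = sets (borel_of (T i))"
    and f [measurable]: "f \<in> borel_measurable (PiM {1..n} \<mu>)" and f0: "\<And>x. 0 \<le> f x"
    and int_f: "(\<integral>\<^sup>+x. ennreal (f x) \<partial>PiM {1..n} \<mu>) = 1"
begin

abbreviation "M \<equiv> PiM {1..n} \<mu>"
definition "marg k = distr (density M (\<lambda>x. ennreal (f x))) (PiM {1..k} \<mu>) (\<lambda>x. restrict x {1..k})"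
text \<open>\<open>fhat i\<close> is the density of the law of all coordinates except the \<open>i\<close>-th one. It is kept as a function on
  the whole product, where the \<open>i\<close>-th coordinate is a dummy.\<close>

definition "fhat i x = (\<integral>\<^sup>+y. ennreal (f (x(i := y))) \<partial>\<mu> i)"

lemma upd_measurable [measurable]: "i \<in> {1..n} \<Longrightarrow> (\<lambda>z. (fst z)(i := snd z)) \<in> M \<Otimes>\<^sub>M \<mu> i \<rightarrow>\<^sub>M M"
  by (rule measurable_fun_upd[where J="{1..n}"]) auto

lemma upd_measurable1: "i \<in> {1..n} \<Longrightarrow> x \<in> space M \<Longrightarrow> (\<lambda>y. x(i := y)) \<in> \<mu> i \<rightarrow>\<^sub>M M"
  by (rule measurable_fun_upd[where J="{1..n}"]) auto

lemma restrict_measurable [measurable]: "k \<le> n \<Longrightarrow> (\<lambda>x. restrict x {1..k}) \<in> M \<rightarrow>\<^sub>M PiM {1..k} \<mu>"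
  by (rule measurable_restrict_subset) auto

lemma nn_integral_upd_measurable:
  assumes "i \<in> {1..n}" and "\<phi> \<in> borel_measurable M"
  shows "(\<lambda>x. \<integral>\<^sup>+y. \<phi> (x(i := y)) \<partial>\<mu> i) \<in> borel_measurable M"
proof -
  interpret prob_space "\<mu> i" by (rule prob)
  have "(\<lambda>z. \<phi> ((fst z)(i := snd z))) \<in> borel_measurable (M \<Otimes>\<^sub>M \<mu> i)"
    using assms by (intro measurable_compose[OF upd_measurable])
  from borel_measurable_nn_integral_fst[OF this] show ?thesis by simp
qed

text \<open>Replacing one coordinate by an independent copy preserves a product measure. This lets
  the other coordinates be integrated on the whole product, without removing an index.\<close>

lemma resample:
  assumes i: "i \<in> {1..n}" and \<phi> [measurable]: "\<phi> \<in> borel_measurable M"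
  shows "(\<integral>\<^sup>+x. (\<integral>\<^sup>+y. \<phi> (x(i := y)) \<partial>\<mu> i) \<partial>M) = (\<integral>\<^sup>+x. \<phi> x \<partial>M)"
proof -
  interpret product_sigma_finite \<mu>
    by (simp add: product_sigma_finite_def prob prob_space_imp_sigma_finite)
  define I where "I = {1..n} - {i}"
  have I: "finite I" "i \<notin> I" "insert i I = {1..n}" using i by (auto simp: I_def)
  define \<psi> where "\<psi> x = (\<integral>\<^sup>+y. \<phi> (x(i := y)) \<partial>\<mu> i)" for x
  have \<psi>m: "\<psi> \<in> borel_measurable M" unfolding \<psi>_def by (rule nn_integral_upd_measurable[OF i \<phi>])
  have "(\<integral>\<^sup>+x. \<psi> x \<partial>M) = (\<integral>\<^sup>+x. (\<integral>\<^sup>+y. \<psi> (x(i := y)) \<partial>\<mu> i) \<partial>PiM I \<mu>)"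
    using product_nn_integral_insert[OF I(1,2), of \<psi>] \<psi>m unfolding I(3) by simp
  \<comment> \<open>\<open>\<psi>\<close> ignores coordinate \<open>i\<close>, so the probability
    \<open>\<mu> i\<close> integrates out.\<close>
  also have "\<dots> = (\<integral>\<^sup>+x. \<psi> x \<partial>PiM I \<mu>)"
    using prob_space.emeasure_space_1[OF prob[of i]] by (simp add: \<psi>_def)
  also have "\<dots> = (\<integral>\<^sup>+x. \<phi> x \<partial>M)"
    using product_nn_integral_insert[OF I(1,2), of \<phi>] \<phi> unfolding I(3) \<psi>_def by simp
  finally show ?thesis by (simp add: \<psi>_def)
qed

lemma fhat_measurable [measurable]: "i \<in> {1..n} \<Longrightarrow> fhat i \<in> borel_measurable M"
  using nn_integral_upd_measurable[of i "\<lambda>x. ennreal (f x)"] by (simp add: fhat_def[abs_def])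

lemma int_fhat: "i \<in> {1..n} \<Longrightarrow> (\<integral>\<^sup>+x. fhat i x \<partial>M) = 1"
  using resample[of i "\<lambda>x. ennreal (f x)"] int_f by (simp add: fhat_def)

lemma prob_density: "prob_space (density M (\<lambda>x. ennreal (f x)))"
  by (rule prob_spaceI) (simp add: emeasure_density int_f cong: nn_integral_cong)

lemma prob_density_fhat:
  assumes i: "i \<in> {1..n}" shows "prob_space (density M (fhat i))"
proof (rule prob_spaceI)
  note [measurable] = fhat_measurable[OF i]
  have "emeasure (density M (fhat i)) (space M) = (\<integral>\<^sup>+x. fhat i x * indicator (space M) x \<partial>M)"
    by (rule emeasure_density) auto
  also have "\<dots> = (\<integral>\<^sup>+x. fhat i x \<partial>M)" by (intro nn_integral_cong) simp
  finally show "emeasure (density M (fhat i)) (space (density M (fhat i))) = 1" using int_fhat[OF i] by simp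
qed

lemma emeasure_marg:
  assumes k: "k \<le> n" and A: "A \<in> sets (PiM {1..k} \<mu>)"
  shows "emeasure (marg k) A = (\<integral>\<^sup>+x. indicator A (restrict x {1..k}) * ennreal (f x) \<partial>M)"
proof -
  note [measurable] = restrict_measurable[OF k] A
  have "emeasure (marg k) A = (\<integral>\<^sup>+x. indicator A x \<partial>marg k)" by (simp add: marg_def)
  also have "\<dots> = (\<integral>\<^sup>+x. indicator A (restrict x {1..k}) \<partial>density M (\<lambda>x. ennreal (f x)))"
    unfolding marg_def by (rule nn_integral_distr) auto
  also have "\<dots> = (\<integral>\<^sup>+x. ennreal (f x) * indicator A (restrict x {1..k}) \<partial>M)"
    by (rule nn_integral_density) auto
  finally show ?thesis by (simp add: mult.commute)
qed

text \<open>Passing from \<open>f\<close> to \<open>fhat (Suc k)\<close> only resamples coordinate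
  \<open>k + 1\<close>, which the restriction to the first \<open>k\<close> coordinates does not
  see. The first marginal of the previous coupling is thereby an image of the law used for
  conditioning.\<close>

lemma marg_eq_distr_fhat:
  assumes k: "Suc k \<le> n"
  shows "marg k = distr (density M (fhat (Suc k))) (PiM {1..k} \<mu>) (\<lambda>x. restrict x {1..k})"
proof (rule measure_eqI)
  let ?i = "Suc k"
  have i: "?i \<in> {1..n}" and k': "k \<le> n" using k by auto
  fix A assume "A \<in> sets (marg k)"
  then have A [measurable]: "A \<in> sets (PiM {1..k} \<mu>)" by (simp add: marg_def)
  note [measurable] = restrict_measurable[OF k'] fhat_measurable[OF i]
  have "emeasure (distr (density M (fhat ?i)) (PiM {1..k} \<mu>) (\<lambda>x. restrict x {1..k})) A =
      (\<integral>\<^sup>+x. indicator A x \<partial>distr (density M (fhat ?i)) (PiM {1..k} \<mu>) (\<lambda>x. restrict x {1..k}))" by simp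
  also have "\<dots> = (\<integral>\<^sup>+x. indicator A (restrict x {1..k}) \<partial>density M (fhat ?i))"
    by (rule nn_integral_distr) auto
  also have "\<dots> = (\<integral>\<^sup>+x. fhat ?i x * indicator A (restrict x {1..k}) \<partial>M)"
    by (rule nn_integral_density) auto
  also have "\<dots> = (\<integral>\<^sup>+x. (\<integral>\<^sup>+y. ennreal (f (x(?i := y))) * indicator A (restrict (x(?i := y)) {1..k}) \<partial>\<mu> ?i) \<partial>M)"
  proof (rule nn_integral_cong)
    fix x assume x: "x \<in> space M"
    note [measurable] = upd_measurable1[OF i x]
    have "restrict (x(?i := y)) {1..k} = restrict x {1..k}" for y by (auto simp: restrict_def)
    then show "fhat ?i x * indicator A (restrict x {1..k}) =
        (\<integral>\<^sup>+y. ennreal (f (x(?i := y))) * indicator A (restrict (x(?i := y)) {1..k}) \<partial>\<mu> ?i)"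
      unfolding fhat_def by (simp only:) (rule nn_integral_multc[symmetric], measurable)
  qed
  also have "\<dots> = (\<integral>\<^sup>+x. ennreal (f x) * indicator A (restrict x {1..k}) \<partial>M)"
    by (rule resample[OF i]) measurable
  also have "\<dots> = emeasure (marg k) A"
    using emeasure_marg[OF k' A] by (simp add: mult.commute)
  finally show "emeasure (marg k) A = emeasure (distr (density M (fhat ?i)) (PiM {1..k} \<mu>) (\<lambda>x. restrict x {1..k})) A" ..
qed (simp add: marg_def)

lemma sets_PiM_topology: "k \<le> n \<Longrightarrow> sets (PiM {1..k} \<mu>) = sets (borel_of (product_topology T {1..k}))"
  using T sets_\<mu> by (intro sets_borel_of_product_topology[symmetric]) (auto simp: polish_space_def)

lemma marg_M1: "k \<le> n \<Longrightarrow> marg k \<in> M1 (product_topology T {1..k})"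
  using prob_space.prob_space_distr[OF prob_density, of "\<lambda>x. restrict x {1..k}" "PiM {1..k} \<mu>"]
  by (simp add: M1_def marg_def sets_PiM_topology)

lemma PiM_M1: "k \<le> n \<Longrightarrow> PiM {1..k} \<mu> \<in> M1 (product_topology T {1..k})"
  by (simp add: M1_def sets_PiM_topology prob_space_PiM prob)

text \<open>Instance of \<open>transport_step_approx\<close> with conditioning law
  \<open>fhat i\<close> times \<open>M\<close>, conditional density \<open>F\<close> and information
  \<open>J\<close>. Multiplying \<open>J\<close> by \<open>fhat i\<close> gives back the form of the
  section, so its integral against the conditioning law is bounded by that of the form against
  \<open>M\<close>.\<close>

lemma transport_step:
  assumes k: "Suc k \<le> n"
    and c: "\<And>i. i \<in> {1..n} \<Longrightarrow> cost_function (T i) (c i)"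
    and DE: "dirichlet_form (\<mu> (Suc k)) D E" and \<alpha>: "rate_function \<alpha>"
    and TI: "\<And>\<nu>. \<nu> \<in> M1 (T (Suc k)) \<Longrightarrow> extend_infinity \<alpha> (transport_cost (T (Suc k)) (c (Suc k)) \<nu> (\<mu> (Suc k)))
        \<le> fisher_dv_information (\<mu> (Suc k)) D (\<lambda>g. E g g) \<nu>"
    and sec: "AE x in M. section_fun (\<lambda>x. sqrt (f x)) x (Suc k) \<in> D"
  shows "\<exists>r. transport_cost (product_topology T {1..Suc k}) (sum_cost (Suc k) c) (marg (Suc k)) (PiM {1..Suc k} \<mu>)
       \<le> transport_cost (product_topology T {1..k}) (sum_cost k c) (marg k) (PiM {1..k} \<mu>) + r \<and>
     extend_infinity \<alpha> r \<le> (\<integral>\<^sup>+x. ennreal (E (section_fun (\<lambda>x. sqrt (f x)) x (Suc k)) (section_fun (\<lambda>x. sqrt (f x)) x (Suc k))) \<partial>M)"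
proof -
  define i where "i = Suc k"
  have i: "i \<in> {1..n}" and k': "k \<le> n" and i': "i \<le> n" using k by (auto simp: i_def)
  have ins: "insert i {1..k} = {1..i}" by (auto simp: i_def)
  note [measurable] = restrict_measurable[OF k'] restrict_measurable[OF i'] fhat_measurable[OF i] upd_measurable[OF i]
  interpret mi: prob_space "\<mu> i" by (rule prob)
  define s where "s x = section_fun (\<lambda>x. sqrt (f x)) x i" for x
  define Z where "Z x = enn2real (fhat i x)" for x
  define F where "F z = f ((fst z)(i := snd z)) / Z (fst z)" for z
  \<comment> \<open>No measurability is claimed for \<open>G\<close>, because of the condition
    \<open>s x \<in> D\<close>; almost every point being in it is enough.\<close>
  define G where "G = {x \<in> space M. 0 < fhat i x \<and> fhat i x < \<infinity> \<and> s x \<in> D}"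
  define J where "J x = ennreal (E (s x) (s x)) / fhat i x" for x
  let ?P = "density M (fhat i)"
  let ?S = "transport_cost (product_topology T (insert i {1..k})) (sum_cost i c) (marg i) (PiM (insert i {1..k}) \<mu>)"
  let ?C = "transport_cost (product_topology T {1..k}) (sum_cost k c) (distr ?P (PiM {1..k} \<mu>) (\<lambda>x. restrict x {1..k})) (PiM {1..k} \<mu>)"
  let ?J = "\<integral>\<^sup>+x. ennreal (E (s x) (s x)) \<partial>M"
  have ZG: "0 < Z x" "fhat i x = ennreal (Z x)" if "0 < fhat i x" "fhat i x < \<infinity>" for x
    using that by (auto simp: Z_def enn2real_positive_iff)
  have Zm [measurable]: "Z \<in> borel_measurable M" unfolding Z_def by measurable
  have Z0: "0 \<le> Z x" for x by (simp add: Z_def)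
  have F0: "0 \<le> F z" for z using f0 Z0 by (simp add: F_def)
  have Fm: "F \<in> borel_measurable (M \<Otimes>\<^sub>M \<mu> i)" unfolding F_def by measurable
  then have FmP: "F \<in> borel_measurable (?P \<Otimes>\<^sub>M \<mu> i)" by (simp cong: measurable_cong_sets)
  have norm: "(\<integral>\<^sup>+y. ennreal (F (x, y)) \<partial>\<mu> i) = 1" if x: "x \<in> space M" "0 < fhat i x" "fhat i x < \<infinity>" for x
  proof -
    note [measurable] = upd_measurable1[OF i x(1)]
    have "(\<integral>\<^sup>+y. ennreal (F (x, y)) \<partial>\<mu> i) = (\<integral>\<^sup>+y. ennreal (f (x(i := y))) / ennreal (Z x) \<partial>\<mu> i)"
      using ZG(1)[OF x(2,3)] f0 by (intro nn_integral_cong) (simp add: F_def divide_ennreal)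
    also have "\<dots> = fhat i x / ennreal (Z x)"
      unfolding fhat_def by (rule nn_integral_divide) measurable
    also have "\<dots> = 1"
      using ZG[OF x(2,3)] by (simp add: divide_ennreal)
    finally show ?thesis .
  qed
  have J_eq: "J x = ennreal (E (s x) (s x) / Z x)" if "x \<in> G" for x
  proof -
    from that have "0 < fhat i x" "fhat i x < \<infinity>" "s x \<in> D" by (auto simp: G_def)
    moreover have "0 \<le> E (s x) (s x)" using DE \<open>s x \<in> D\<close> by (simp add: dirichlet_form_def)
    ultimately show ?thesis using ZG[of x] by (simp add: J_def divide_ennreal)
  qed
  have AE_fin: "AE x in M. fhat i x < \<infinity>"
    using nn_integral_noteq_infinite[of "fhat i" M] int_fhat[OF i] by (simp add: less_top)
  have s_sq: "(s x y)\<^sup>2 = f (x(i := y))" "0 \<le> s x y" for x y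
    using f0 by (simp_all add: s_def section_fun_def)
  have "\<exists>r. ?S \<le> ?C + r \<and> extend_infinity \<alpha> r \<le> ?J"
  proof (rule rate_function_limit[OF \<alpha>])
    fix \<delta> :: real
    assume lim: "Lim at_top \<alpha> = \<infinity>" and \<delta>: "0 < \<delta>"
      and fin: "?C < \<infinity>"
    show "?S \<le> ?C + ennreal (2 * \<delta>) + (SUP \<rho>\<in>{\<rho>. 0 \<le> \<rho> \<and> \<alpha> \<rho> \<le> ?J + ennreal \<delta>}. ennreal \<rho>)"
    proof (rule transport_step_approx[where G=G and f=F and J=J and ci="c i"])
      show "finite {1..k}" "i \<notin> {1..k}" by (auto simp: i_def)
      show "prob_space (\<mu> j)" for j by (rule prob)
      show "polish_space (T j)" "sets (\<mu> j) = sets (borel_of (T j))" if "j \<in> insert i {1..k}" for j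
        using that i' T sets_\<mu> unfolding ins by auto
      show "prob_space ?P" by (rule prob_density_fhat[OF i])
      show "(\<lambda>x. restrict x {1..k}) \<in> ?P \<rightarrow>\<^sub>M PiM {1..k} \<mu>" by simp
      show "F \<in> borel_measurable (?P \<Otimes>\<^sub>M \<mu> i)" by (rule FmP)
      show "0 \<le> F z" for z by (rule F0)
      \<comment> \<open>Points with \<open>fhat i x = 0\<close> are null for \<open>?P\<close>,
        which is why positivity may be part of \<open>G\<close>.\<close>
      show "AE x in ?P. x \<in> G"
        using AE_fin sec AE_space unfolding AE_density[OF fhat_measurable[OF i]]
        by eventually_elim (simp add: G_def s_def i_def)
      show "x \<in> space ?P \<and> (\<integral>\<^sup>+y. ennreal (F (x, y)) \<partial>\<mu> i) = 1" if "x \<in> G" for x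
        using that norm[of x] by (auto simp: G_def)
      show "marg i \<in> M1 (product_topology T (insert i {1..k}))" unfolding ins by (rule marg_M1[OF i'])
      show "emeasure (marg i) A = (\<integral>\<^sup>+w. (\<integral>\<^sup>+y. indicator A ((restrict w {1..k})(i := y)) * ennreal (F (w, y)) \<partial>\<mu> i) \<partial>?P)"
        if A: "A \<in> sets (PiM (insert i {1..k}) \<mu>)" for A
      proof -
        have A' [measurable]: "A \<in> sets (PiM {1..i} \<mu>)" using A by (simp only: ins)
        have upd: "(restrict x {1..k})(i := y) = restrict (x(i := y)) {1..i}" for x :: "nat \<Rightarrow> 'a" and y
          by (auto simp: i_def restrict_def)
        have ind_m: "(\<lambda>z. indicator A ((restrict (fst z) {1..k})(i := snd z)) * ennreal (F z)) \<in> borel_measurable (M \<Otimes>\<^sub>M \<mu> i)"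
          unfolding upd using Fm by measurable
        have inner_m [measurable]: "(\<lambda>w. \<integral>\<^sup>+y. indicator A ((restrict w {1..k})(i := y)) * ennreal (F (w, y)) \<partial>\<mu> i) \<in> borel_measurable M"
          using mi.borel_measurable_nn_integral_fst[OF ind_m] by simp
        have "(\<integral>\<^sup>+w. (\<integral>\<^sup>+y. indicator A ((restrict w {1..k})(i := y)) * ennreal (F (w, y)) \<partial>\<mu> i) \<partial>?P) =
            (\<integral>\<^sup>+w. fhat i w * (\<integral>\<^sup>+y. indicator A ((restrict w {1..k})(i := y)) * ennreal (F (w, y)) \<partial>\<mu> i) \<partial>M)"
          by (rule nn_integral_density) measurable
        also have "\<dots> = (\<integral>\<^sup>+w. (\<integral>\<^sup>+y. indicator A (restrict (w(i := y)) {1..i}) * ennreal (f (w(i := y))) \<partial>\<mu> i) \<partial>M)"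
        proof (rule nn_integral_cong_AE)
          show "AE w in M. fhat i w * (\<integral>\<^sup>+y. indicator A ((restrict w {1..k})(i := y)) * ennreal (F (w, y)) \<partial>\<mu> i) =
              (\<integral>\<^sup>+y. indicator A (restrict (w(i := y)) {1..i}) * ennreal (f (w(i := y))) \<partial>\<mu> i)"
            using AE_fin AE_space
          proof eventually_elim
          case (elim w)
          note um = upd_measurable1[OF i elim(2)]
          have [measurable]: "(\<lambda>y. indicator A (restrict (w(i := y)) {1..i}) :: ennreal) \<in> borel_measurable (\<mu> i)"
            by (intro measurable_compose[OF um measurable_compose[OF restrict_measurable[OF i'] borel_measurable_indicator[OF A']]])
          have [measurable]: "(\<lambda>y. F (w, y)) \<in> borel_measurable (\<mu> i)"
            unfolding F_def fst_conv snd_conv by (intro borel_measurable_divide measurable_compose[OF um f] borel_measurable_const)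
          show ?case
          \<comment> \<open>Where the mass of the fibre is 0, both sides vanish: the right one is
            bounded by this mass.\<close>
          proof (cases "fhat i w = 0")
            case True
            have "(\<integral>\<^sup>+y. indicator A (restrict (w(i := y)) {1..i}) * ennreal (f (w(i := y))) \<partial>\<mu> i) \<le> fhat i w"
              unfolding fhat_def by (intro nn_integral_mono) (auto simp: indicator_def)
            then show ?thesis using True by simp
          next
            case False
            then have z: "0 < Z w" "fhat i w = ennreal (Z w)" using ZG[of w] elim by (auto simp: zero_less_iff_neq_zero)
            have "fhat i w * (\<integral>\<^sup>+y. indicator A ((restrict w {1..k})(i := y)) * ennreal (F (w, y)) \<partial>\<mu> i) =
                (\<integral>\<^sup>+y. fhat i w * (indicator A ((restrict w {1..k})(i := y)) * ennreal (F (w, y))) \<partial>\<mu> i)"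
              unfolding upd by (rule nn_integral_cmult[symmetric]) measurable
            also have "\<dots> = (\<integral>\<^sup>+y. indicator A (restrict (w(i := y)) {1..i}) * ennreal (f (w(i := y))) \<partial>\<mu> i)"
            proof (rule nn_integral_cong)
              fix y
              have "ennreal (Z w) * ennreal (F (w, y)) = ennreal (f (w(i := y)))"
                using z f0 F0 by (subst ennreal_mult[symmetric]) (auto simp: F_def)
              then show "fhat i w * (indicator A ((restrict w {1..k})(i := y)) * ennreal (F (w, y))) =
                  indicator A (restrict (w(i := y)) {1..i}) * ennreal (f (w(i := y)))"
                unfolding upd z(2) by (metis mult.left_commute)
            qed
            finally show ?thesis .
          qed
        qed
        qed
        also have "\<dots> = (\<integral>\<^sup>+x. indicator A (restrict x {1..i}) * ennreal (f x) \<partial>M)"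
          by (rule resample[OF i]) measurable
        also have "\<dots> = emeasure (marg i) A" by (rule emeasure_marg[OF i' A', symmetric])
        finally show ?thesis ..
      qed
      show "lsc_on (prod_topology (product_topology T {1..k}) (product_topology T {1..k})) (\<lambda>p. sum_cost k c (fst p) (snd p))"
        using c k' by (intro lsc_on_sum_cost) auto
      show "cost_function (T i) (c i)" by (rule c[OF i])
      show "lsc_on (prod_topology (product_topology T (insert i {1..k})) (product_topology T (insert i {1..k}))) (\<lambda>p. sum_cost i c (fst p) (snd p))"
        unfolding ins using c i' by (intro lsc_on_sum_cost) auto
      show "sum_cost i c (x(i := u)) (y(i := v)) = sum_cost k c x y + c i u v" for x y u v
      proof -
        have "sum_cost i c (x(i := u)) (y(i := v)) = (\<Sum>j\<in>insert i {1..k}. c j ((x(i := u)) j) ((y(i := v)) j))"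
          by (simp only: sum_cost_def ins)
        also have "\<dots> = c i u v + (\<Sum>j\<in>{1..k}. c j ((x(i := u)) j) ((y(i := v)) j))"
          by (subst sum.insert) (auto simp: i_def)
        also have "(\<Sum>j\<in>{1..k}. c j ((x(i := u)) j) ((y(i := v)) j)) = sum_cost k c x y"
          unfolding sum_cost_def by (intro sum.cong) (auto simp: i_def)
        finally show ?thesis by (simp only: add.commute)
      qed
      show "rate_function \<alpha>" "Lim at_top \<alpha> = \<infinity>" "0 < \<delta>" by fact+
      show "J x < \<infinity>" if "x \<in> G" for x
        using J_eq[OF that] by simp
      show "extend_infinity \<alpha> (transport_cost (T i) (c i) (density (\<mu> i) (\<lambda>y. ennreal (F (x, y)))) (\<mu> i)) \<le> J x"
        if x: "x \<in> G" for x
      proof -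
        have xG: "x \<in> space M" "0 < fhat i x" "fhat i x < \<infinity>" "s x \<in> D" using x by (auto simp: G_def)
        note z = ZG[OF xG(2,3)]
        note [measurable] = upd_measurable1[OF i xG(1)]
        have [measurable]: "(\<lambda>y. F (x, y)) \<in> borel_measurable (\<mu> i)" unfolding F_def by simp
        have "prob_space (density (\<mu> i) (\<lambda>y. ennreal (F (x, y))))"
          by (rule prob_spaceI) (simp add: emeasure_density norm[OF xG(1-3)] cong: nn_integral_cong)
        then have "density (\<mu> i) (\<lambda>y. ennreal (F (x, y))) \<in> M1 (T i)"
          using sets_\<mu>[OF i] by (simp add: M1_def)
        from TI[folded i_def, OF this]
        have "extend_infinity \<alpha> (transport_cost (T i) (c i) (density (\<mu> i) (\<lambda>y. ennreal (F (x, y)))) (\<mu> i))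
            \<le> fisher_dv_information (\<mu> i) D (\<lambda>g. E g g) (density (\<mu> i) (\<lambda>y. ennreal (F (x, y))))" .
        also have "(\<lambda>y. ennreal (F (x, y))) = (\<lambda>y. ennreal ((s x y)\<^sup>2 / Z x))"
          by (simp add: F_def s_sq)
        also have "fisher_dv_information (\<mu> i) D (\<lambda>g. E g g) (density (\<mu> i) (\<lambda>y. ennreal ((s x y)\<^sup>2 / Z x))) = ennreal (E (s x) (s x) / Z x)"
          using DE xG(4) s_sq(2) z(1) by (intro fisher_dv_information_normalized mi.sigma_finite_measure_axioms) (auto simp: i_def)
        also have "\<dots> = J x" by (rule J_eq[OF x, symmetric])
        finally show ?thesis by (simp add: F_def s_sq)
      qed
      show "(\<integral>\<^sup>+x. J x \<partial>?P) \<le> ?J"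
      proof -
        have "(\<integral>\<^sup>+x. J x \<partial>?P) \<le> (\<integral>\<^sup>+x. fhat i x * J x \<partial>M)" by (rule nn_integral_density_le) measurable
        also have "\<dots> \<le> ?J"
        proof (rule nn_integral_mono)
          fix x
          show "fhat i x * J x \<le> ennreal (E (s x) (s x))"
          \<comment> \<open>In the two extreme cases the left side is 0, by
            \<open>0 * \<infinity> = 0\<close> and because division by \<open>\<infinity>\<close>
            gives 0.\<close>
          proof (cases "fhat i x = 0 \<or> fhat i x = \<infinity>")
            case False
            then have "0 < Z x" "fhat i x = ennreal (Z x)" using ZG[of x] by (auto simp: zero_less_iff_neq_zero less_top)
            then show ?thesis
              by (cases "0 \<le> E (s x) (s x)")
                (simp_all add: J_def divide_ennreal ennreal_neg flip: ennreal_mult)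
          qed (auto simp: J_def)
        qed
        finally show ?thesis .
      qed
    qed (rule refl, rule fin)
  qed
  then show ?thesis
    unfolding ins marg_eq_distr_fhat[OF k] unfolding s_def i_def .
qed

lemma transport_cost_tensorization:
  assumes n: "n \<ge> 1"
    and c: "\<And>i. i \<in> {1..n} \<Longrightarrow> cost_function (T i) (c i)"
    and DE: "\<And>i. i \<in> {1..n} \<Longrightarrow> dirichlet_form (\<mu> i) (D i) (E i)"
    and \<alpha>: "\<And>i. i \<in> {1..n} \<Longrightarrow> rate_function (\<alpha> i)"
    and TI: "\<And>i \<nu>. i \<in> {1..n} \<Longrightarrow> \<nu> \<in> M1 (T i) \<Longrightarrow> extend_infinity (\<alpha> i) (transport_cost (T i) (c i) \<nu> (\<mu> i))
        \<le> fisher_dv_information (\<mu> i) (D i) (\<lambda>g. E i g g) \<nu>"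
    and sec: "\<And>i. i \<in> {1..n} \<Longrightarrow> AE x in M. section_fun (\<lambda>x. sqrt (f x)) x i \<in> D i"
  shows "extend_infinity (inf_convolution n \<alpha>)
      (transport_cost (product_topology T {1..n}) (sum_cost n c) (density M (\<lambda>x. ennreal (f x))) M)
    \<le> sum_form_integral n \<mu> E (\<lambda>x. sqrt (f x))"
proof -
  let ?s = "section_fun (\<lambda>x. sqrt (f x))"
  define S where "S k = transport_cost (product_topology T {1..k}) (sum_cost k c) (marg k) (PiM {1..k} \<mu>)" for k
  define J where "J i = (\<integral>\<^sup>+x. ennreal (E i (?s x i) (?s x i)) \<partial>M)" for i
  have "\<exists>r. S (Suc k) \<le> S k + r \<and> extend_infinity (\<alpha> (Suc k)) r \<le> J (Suc k)" if "Suc k \<le> n" for k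
    unfolding S_def J_def using that
    by (intro transport_step[where D="D (Suc k)"] c DE \<alpha> TI sec) auto
  then have "\<forall>k. \<exists>r. Suc k \<le> n \<longrightarrow> S (Suc k) \<le> S k + r \<and> extend_infinity (\<alpha> (Suc k)) r \<le> J (Suc k)" by blast
  then obtain r where r: "\<And>k. Suc k \<le> n \<Longrightarrow> S (Suc k) \<le> S k + r k \<and> extend_infinity (\<alpha> (Suc k)) (r k) \<le> J (Suc k)"
    by metis
  \<comment> \<open>\<open>r k\<close> is the increment from \<open>k\<close> to
    \<open>k + 1\<close>, hence the shift \<open>i - 1\<close> when summing over coordinates from
    1.\<close>
  have S_le: "S k \<le> (\<Sum>i\<in>{1..k}. r (i - 1))" if "k \<le> n" for k
    using that
  proof (induction k)
    case 0
    have "polish_space (product_topology T {1..0})" by (intro polish_space_product_topology) auto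
    then show ?case
      unfolding S_def using marg_M1[of 0] PiM_M1[of 0]
      by (subst transport_cost_zero) (auto simp: sum_cost_def)
  next
    case (Suc k)
    have "S (Suc k) \<le> S k + r k" using r[of k] Suc.prems by simp
    also have "\<dots> \<le> (\<Sum>i\<in>{1..k}. r (i - 1)) + r k" using Suc by (intro add_right_mono) simp
    also have "\<dots> = (\<Sum>i\<in>{1..Suc k}. r (i - 1))" by simp
    finally show ?case .
  qed
  have marg_n: "marg n = density M (\<lambda>x. ennreal (f x))"
  proof (rule measure_eqI)
    fix A assume "A \<in> sets (marg n)"
    then have A: "A \<in> sets M" by (simp add: marg_def)
    \<comment> \<open>Elements of the product space are extensional on \<open>{1..n}\<close>, so
      restricting them changes nothing.\<close>
    have "emeasure (marg n) A = (\<integral>\<^sup>+x. ennreal (f x) * indicator A x \<partial>M)"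
      unfolding emeasure_marg[OF order_refl A]
      by (intro nn_integral_cong) (simp add: space_PiM PiE_restrict mult.commute)
    also have "\<dots> = emeasure (density M (\<lambda>x. ennreal (f x))) A"
      using A by (intro emeasure_density[symmetric]) auto
    finally show "emeasure (marg n) A = emeasure (density M (\<lambda>x. ennreal (f x))) A" .
  qed (simp add: marg_def)
  have "extend_infinity (inf_convolution n \<alpha>) (S n) \<le> (\<Sum>i\<in>{1..n}. J i)"
  proof (rule inf_convolution_extend_le[OF n \<alpha> _ S_le])
    fix i assume "i \<in> {1..n}"
    then show "extend_infinity (\<alpha> i) (r (i - 1)) \<le> J i" using r[of "i - 1"] by simp
  qed auto
  also have "\<dots> \<le> sum_form_integral n \<mu> E (\<lambda>x. sqrt (f x))"
    unfolding J_def sum_form_integral_def by (rule nn_integral_superadditive_sum) simp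
  finally show ?thesis unfolding S_def marg_n .
qed

end

theorem theorem2p7:
  fixes n :: nat
    and X :: "nat \<Rightarrow> 'a metric"
    and \<mu> :: "nat \<Rightarrow> 'a measure"
    and c :: "nat \<Rightarrow> 'a \<Rightarrow> 'a \<Rightarrow> ennreal"
    and P :: "nat \<Rightarrow> real \<Rightarrow> 'a \<Rightarrow> 'a measure"
    and D :: "nat \<Rightarrow> ('a \<Rightarrow> real) set"
    and E :: "nat \<Rightarrow> ('a \<Rightarrow> real) \<Rightarrow> ('a \<Rightarrow> real) \<Rightarrow> real"
    and \<alpha> :: "nat \<Rightarrow> real \<Rightarrow> ennreal"
  assumes "n \<ge> 1"
    and "\<And>i. i \<in> {1..n} \<Longrightarrow> polish_metric (X i)"
    and "\<And>i. i \<in> {1..n} \<Longrightarrow> \<mu> i \<in> M1 (mtopology_of (X i))"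
    and "\<And>i. i \<in> {1..n} \<Longrightarrow> cost_function (mtopology_of (X i)) (c i)"
    and "\<And>i. i \<in> {1..n} \<Longrightarrow> ergodic_process (\<mu> i) (P i)"
    and "\<And>i. i \<in> {1..n} \<Longrightarrow> dirichlet_form_of_process (\<mu> i) (P i) (D i) (E i)"
    and "\<And>i. i \<in> {1..n} \<Longrightarrow> rate_function (\<alpha> i)"
    and "\<And>i \<nu>. i \<in> {1..n} \<Longrightarrow> \<nu> \<in> M1 (mtopology_of (X i)) \<Longrightarrow>
           extend_infinity (\<alpha> i) (transport_cost (mtopology_of (X i)) (c i) \<nu> (\<mu> i))
             \<le> fisher_dv_information (\<mu> i) (D i) (\<lambda>g. E i g g) \<nu>"
  shows "\<forall>\<nu> \<in> M1 (product_topology (\<lambda>i. mtopology_of (X i)) {1..n}).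
           extend_infinity (inf_convolution n \<alpha>)
             (transport_cost (product_topology (\<lambda>i. mtopology_of (X i)) {1..n})
                (sum_cost n c) \<nu> (PiM {1..n} \<mu>))
             \<le> fisher_dv_information (PiM {1..n} \<mu>) (sum_form_domain n \<mu> D E)
                  (sum_form n \<mu> E) \<nu>"
proof
  let ?T = "\<lambda>i. mtopology_of (X i)"
  fix \<nu> assume \<nu>: "\<nu> \<in> M1 (product_topology ?T {1..n})"
  \<comment> \<open>Indices outside \<open>{1..n}\<close> receive the probability
    \<open>\<mu> 1\<close>, available since \<open>n \<ge> 1\<close>, to give the locale its total
    family; the product measure is unchanged.\<close>
  define \<mu>' where "\<mu>' i = (if i \<in> {1..n} then \<mu> i else \<mu> 1)" for i
  have \<mu>'_eq: "\<mu>' i = \<mu> i" if "i \<in> {1..n}" for i using that by (simp add: \<mu>'_def)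
  have Pi_eq: "PiM {1..n} \<mu>' = PiM {1..n} \<mu>" by (intro PiM_cong) (auto simp: \<mu>'_eq)
  have prob': "prob_space (\<mu>' i)" for i
    using M1_D(1)[OF assms(3)] assms(1) by (simp add: \<mu>'_def)
  let ?M = "PiM {1..n} \<mu>"
  have "prob_space ?M" unfolding Pi_eq[symmetric] using prob' by (rule prob_space_PiM)
  then interpret M: prob_space ?M .
  define f0 where "f0 = RN_deriv ?M \<nu>"
  define f where "f x = enn2real (f0 x)" for x
  show "extend_infinity (inf_convolution n \<alpha>) (transport_cost (product_topology ?T {1..n}) (sum_cost n c) \<nu> ?M)
     \<le> fisher_dv_information ?M (sum_form_domain n \<mu> D E) (sum_form n \<mu> E) \<nu>"
  proof (cases "\<nu> = density ?M f0 \<and> (\<lambda>x. sqrt (f x)) \<in> sum_form_domain n \<mu> D E")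
    case False
    then have "fisher_dv_information ?M (sum_form_domain n \<mu> D E) (sum_form n \<mu> E) \<nu> = \<infinity>"
      unfolding fisher_dv_information_def Let_def f0_def[symmetric] f_def[symmetric] by (rule if_not_P)
    then show ?thesis by simp
  next
    case True
    then have info: "fisher_dv_information ?M (sum_form_domain n \<mu> D E) (sum_form n \<mu> E) \<nu> =
        ennreal (sum_form n \<mu> E (\<lambda>x. sqrt (f x)))"
      unfolding fisher_dv_information_def Let_def f0_def[symmetric] f_def[symmetric] by (rule if_P)
    have dom: "\<And>i. i \<in> {1..n} \<Longrightarrow> AE x in ?M. section_fun (\<lambda>x. sqrt (f x)) x i \<in> D i"
        "sum_form_integral n \<mu> E (\<lambda>x. sqrt (f x)) < \<infinity>"
      using True by (auto simp: sum_form_domain_def)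
    have f0m [measurable]: "f0 \<in> borel_measurable ?M" unfolding f0_def by simp
    have "(\<integral>\<^sup>+x. f0 x \<partial>?M) = emeasure (density ?M f0) (space ?M)"
      by (subst emeasure_density) (auto cong: nn_integral_cong)
    also have "\<dots> = 1"
      using True prob_space.emeasure_space_1[OF M1_D(1)[OF \<nu>]] by (metis space_density)
    finally have int_f0: "(\<integral>\<^sup>+x. f0 x \<partial>?M) = 1" .
    \<comment> \<open>A density of total mass 1 is finite almost everywhere, so its real version
      \<open>f\<close>, the one under the square root, represents \<open>\<nu>\<close> as
      well.\<close>
    then have "AE x in ?M. f0 x \<noteq> \<infinity>" by (intro nn_integral_noteq_infinite) auto
    then have AE_f: "AE x in ?M. f0 x = ennreal (f x)"
      by eventually_elim (simp add: f_def less_top)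
    have fm [measurable]: "f \<in> borel_measurable ?M" unfolding f_def by measurable
    have \<nu>_eq: "\<nu> = density ?M (\<lambda>x. ennreal (f x))"
      using AE_f by (intro trans[OF conjunct1[OF True] density_cong]) auto
    interpret product_density n ?T \<mu>' f
    proof (rule product_density.intro)
      show "polish_space (?T i)" "sets (\<mu>' i) = sets (borel_of (?T i))" if "i \<in> {1..n}" for i
        using that assms(2) M1_D(2)[OF assms(3)] by (simp_all add: \<mu>'_eq polish_metric_imp_polish_space)
      show "prob_space (\<mu>' i)" for i by (rule prob')
      show "f \<in> borel_measurable (PiM {1..n} \<mu>')" unfolding Pi_eq by (rule fm)
      show "0 \<le> f x" for x by (simp add: f_def)
      show "(\<integral>\<^sup>+x. ennreal (f x) \<partial>PiM {1..n} \<mu>') = 1"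
        unfolding Pi_eq int_f0[symmetric] using AE_f by (intro nn_integral_cong_AE) auto
    qed
    have "extend_infinity (inf_convolution n \<alpha>)
      (transport_cost (product_topology ?T {1..n}) (sum_cost n c) (density (PiM {1..n} \<mu>') (\<lambda>x. ennreal (f x))) (PiM {1..n} \<mu>'))
      \<le> sum_form_integral n \<mu>' E (\<lambda>x. sqrt (f x))"
    proof (rule transport_cost_tensorization[where D=D])
      show "dirichlet_form (\<mu>' i) (D i) (E i)" if "i \<in> {1..n}" for i
        using assms(6)[OF that] that by (simp add: \<mu>'_eq dirichlet_form_of_process_def)
      show "extend_infinity (\<alpha> i) (transport_cost (?T i) (c i) \<nu>' (\<mu>' i))
          \<le> fisher_dv_information (\<mu>' i) (D i) (\<lambda>g. E i g g) \<nu>'" if "i \<in> {1..n}" "\<nu>' \<in> M1 (?T i)" for i \<nu>'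
        using assms(8)[OF that] that by (simp add: \<mu>'_eq)
      show "AE x in PiM {1..n} \<mu>'. section_fun (\<lambda>x. sqrt (f x)) x i \<in> D i" if "i \<in> {1..n}" for i
        unfolding Pi_eq by (rule dom(1)[OF that])
    qed (use assms in auto)
    then have "extend_infinity (inf_convolution n \<alpha>) (transport_cost (product_topology ?T {1..n}) (sum_cost n c) \<nu> ?M)
      \<le> sum_form_integral n \<mu> E (\<lambda>x. sqrt (f x))"
      unfolding Pi_eq \<nu>_eq[symmetric] sum_form_integral_def .
    \<comment> \<open>Finiteness of the form integral, part of the domain condition, makes the
      passage to the real number \<open>sum_form\<close> lossless.\<close>
    also have "\<dots> = fisher_dv_information ?M (sum_form_domain n \<mu> D E) (sum_form n \<mu> E) \<nu>"
      unfolding info sum_form_def using dom(2) by simp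
    finally show ?thesis .
  qed
qed

end
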